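(* Under the standing assumptions on $\Omega,Y,\Gamma_R,\Gamma_N,A,D,R,p_F,\kappa,\rho_I,f,g$ listed in the context, and for given finite element spaces $V_H$ and $W_h$, there exists a unique Galerkin solution $(\pi^H,\rho^{H,h})$, i.e. a unique pair $(\pi^H,\rho^{H,h})\in L^2(S;V_H)\times L^2(S;V_H\otimes W_h)$ with $\partial_t\rho^{H,h}\in L^2(S;V_H\otimes W_h)$ such that for all $\varphi\in V_H$, all $\psi\in V_H\otimes W_h$ and almost every $t\in S$ $$A\int_\Omega\nabla_x\pi^H\cdot\nabla_x\varphi\,dx=\int_\Omega f(\pi^H,g(\rho^{H,h}))\varphi\,dx,$$ $$\int_\Omega\int_Y\partial_t\rho^{H,h}\psi\,dy\,dx+D\int_\Omega\int_Y\nabla_y\rho^{H,h}\cdot\nabla_y\psi\,dy\,dx=\kappa\int_\Omega\int_{\Gamma_R}(\pi^H+p_F-R\rho^{H,h})\psi\,d\sigma_y\,dx,$$ together with the initial conditions $\pi^H(0)=\pi_I^H$ and $\rho^{H,h}(0)=\rho_I^{H,h}$.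
   Context: Setting. $d_1,d_2\in\{1,2,3\}$, $T>0$, $S=(0,T)$; $\Omega\subset\mathbb{R}^{d_1}$ and $Y\subset\mathbb{R}^{d_2}$ are convex polygons (bounded convex polytopal domains); $\partial Y=\Gamma_R\cup\Gamma_N$ with $\Gamma_R\cap\Gamma_N=\emptyset$; $d\sigma_y$ is surface measure on $\partial Y$. $\mathcal{C}_\Omega$ denotes the constant in Poincaré's inequality $\|u\|^2_{L^2(\Omega)}\le\mathcal{C}_\Omega\|\nabla_x u\|^2_{L^2(\Omega)}$, $u\in H_0^1(\Omega)$. Standing assumptions. $A,D,R,p_F,\kappa$ are positive constants and $2\mathcal{C}_\Omega/A<1$. The initial datum satisfies $\rho_I\in L^2(\Omega;H^1(Y))$. The function $f:\mathbb{R}^2\to\mathbb{R}$ satisfies: (i) its weak partial derivatives $D_1f,D_2f$ belong to $L^\infty(\mathbb{R}^2)$ with $\|D_1f\|_{L^\infty}\le\theta$, $\|D_2f\|_{L^\infty}\le\theta$, where $\theta<2\mathcal{C}_\Omega/A$, $\theta<1/\mathcal{C}_\Omega$, $1+4\theta^2<3/2$; (ii) $f(0,s)=0$ for all $s\in\mathbb{R}$; (iii) $|f(r,s)|\le C_f\min(|r|,|r|^\alpha)$ for some constants $C_f>0$, $\alpha\in(0,1)$ and all $r,s\in\mathbb{R}$. $g$ is a linear map from $L^2(\Omega;H^1(Y))$ to $L^2(\Omega)$ (applied at each time) with $\int_\Omega g(\rho)^2dx\le C_g\|\rho\|^2_{L^2(\Omega;H^1(Y))}$ for some constant $C_g>0$.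 Discretization. $\mathcal{B}_H$ is a partition of $\Omega$ into simplices with mesh size $H$ (maximal element diameter) and $\mathcal{K}_h$ a similar partition of $Y$ with mesh size $h$. With $\mathbb{P}^1$ the polynomials of degree at most $1$, $V_H=\{v\in C(\overline\Omega): v|_B\in\mathbb{P}^1(B)\ \forall B\in\mathcal{B}_H,\ v=0\text{ on }\partial\Omega\}$, $W_h=\{w\in C(\overline Y): w|_K\in\mathbb{P}^1(K)\ \forall K\in\mathcal{K}_h\}$. $V_H\otimes W_h$ is the span of the products $\xi(x)\eta(y)$, $\xi\in V_H$, $\eta\in W_h$. Discrete initial data. $\rho_I^{H,h}\in V_H\otimes W_h$ is the Galerkin approximation ($L^2(\Omega\times Y)$-projection onto $V_H\otimes W_h$) of $\rho_I$, and $\pi_I^H\in V_H$ is the Galerkin approximation of the initial macroscopic pressure, i.e. $A\int_\Omega\nabla_x\pi_I^H\cdot\nabla_x\varphi\,dx=\int_\Omega f(\pi_I^H,g(\rho_I^{H,h}))\varphi\,dx$ for all $\varphi\in V_H$.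
   Formalization: The function f is additionally assumed continuous (the Lipschitz representative); weak partial derivatives leave f arbitrary on null sets, and then uniqueness can fail, e.g. with g = 0 and f(r,0) = μr for small r, μ being A times a discrete eigenvalue. *)

theory Defs
  imports "HOL-Analysis.Analysis"
begin

section \<open>Smooth functions, weak derivatives, Sobolev spaces\<close>

primrec C_k :: "nat \<Rightarrow> ('a::euclidean_space \<Rightarrow> real) \<Rightarrow> bool" where
  "C_k 0 u \<longleftrightarrow> continuous_on UNIV u"
| "C_k (Suc k) u \<longleftrightarrow> (\<forall>x. u differentiable at x) \<and>
     (\<forall>b\<in>Basis. C_k k (\<lambda>x. frechet_derivative u (at x) b))"

definition test_function :: "'a::euclidean_space set \<Rightarrow> ('a \<Rightarrow> real) \<Rightarrow> bool" where
  "test_function U \<phi> \<longleftrightarrow> (\<forall>k. C_k k \<phi>) \<and>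
     (\<exists>K. compact K \<and> K \<subseteq> U \<and> (\<forall>x. x \<notin> K \<longrightarrow> \<phi> x = 0))"

definition locally_integrable :: "'a::euclidean_space set \<Rightarrow> ('a \<Rightarrow> real) \<Rightarrow> bool" where
  "locally_integrable U u \<longleftrightarrow> (\<forall>K. compact K \<and> K \<subseteq> U \<longrightarrow> integrable (lebesgue_on K) u)"

text \<open>\<open>v\<close> is the weak derivative of \<open>u\<close> in direction \<open>b\<close> on the open set \<open>U\<close>.\<close>

definition has_weak_partial ::
  "'a::euclidean_space set \<Rightarrow> 'a \<Rightarrow> ('a \<Rightarrow> real) \<Rightarrow> ('a \<Rightarrow> real) \<Rightarrow> bool" where
  "has_weak_partial U b u v \<longleftrightarrow> locally_integrable U u \<and> locally_integrable U v \<and>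
     (\<forall>\<phi>. test_function U \<phi> \<longrightarrow>
        (LINT x|lebesgue_on U. u x * frechet_derivative \<phi> (at x) b)
          = - (LINT x|lebesgue_on U. v x * \<phi> x))"

definition has_weak_gradient ::
  "'a::euclidean_space set \<Rightarrow> ('a \<Rightarrow> real) \<Rightarrow> ('a \<Rightarrow> 'a) \<Rightarrow> bool" where
  "has_weak_gradient U u G \<longleftrightarrow> (\<forall>b\<in>Basis. has_weak_partial U b u (\<lambda>x. G x \<bullet> b))"

text \<open>Weak gradients are unique up to null sets, and \<open>weak_grad\<close> is only used under
  integrals.\<close>

definition weak_grad :: "'a::euclidean_space set \<Rightarrow> ('a \<Rightarrow> real) \<Rightarrow> 'a \<Rightarrow> 'a" where
  "weak_grad U u = (SOME G. has_weak_gradient U u G)"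

text \<open>Elements of Lebesgue and Sobolev spaces are represented by functions, not by
  equivalence classes modulo null sets.\<close>

definition L2 :: "'a measure \<Rightarrow> ('a \<Rightarrow> 'b::euclidean_space) set" where
  "L2 M = {u. u \<in> borel_measurable M \<and> integrable M (\<lambda>x. (norm (u x))\<^sup>2)}"

definition H1 :: "'a::euclidean_space set \<Rightarrow> ('a \<Rightarrow> real) set" where
  "H1 U = {u \<in> L2 (lebesgue_on U). \<exists>G \<in> L2 (lebesgue_on U). has_weak_gradient U u G}"

definition H1_norm :: "'a::euclidean_space set \<Rightarrow> ('a \<Rightarrow> real) \<Rightarrow> real" where
  "H1_norm U u = sqrt ((LINT x|lebesgue_on U. (u x)\<^sup>2)
                     + (LINT x|lebesgue_on U. (norm (weak_grad U u x))\<^sup>2))"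

definition H10 :: "'a::euclidean_space set \<Rightarrow> ('a \<Rightarrow> real) set" where
  "H10 U = {u \<in> H1 U. \<exists>\<phi>. (\<forall>n::nat. test_function U (\<phi> n)) \<and>
                        (\<lambda>n. H1_norm U (\<phi> n - u)) \<longlonglongrightarrow> 0}"

definition poincare_constant :: "'a::euclidean_space set \<Rightarrow> real \<Rightarrow> bool" where
  "poincare_constant U C \<longleftrightarrow>
     (\<forall>u\<in>H10 U. (LINT x|lebesgue_on U. (u x)\<^sup>2)
                  \<le> C * (LINT x|lebesgue_on U. (norm (weak_grad U u x))\<^sup>2))"

section \<open>Bochner spaces\<close>

text \<open>The square-integrable Bochner space of functions into the space \<open>X\<close> with (semi)norm \<open>N\<close>;
  the second condition is strong measurability. The spaces \<open>X\<close> are sets of functions, and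
  \<open>minus\<close> is pointwise subtraction.\<close>

definition bochner_L2 ::
  "'t measure \<Rightarrow> 'x::minus set \<Rightarrow> ('x \<Rightarrow> real) \<Rightarrow> ('t \<Rightarrow> 'x) set" where
  "bochner_L2 M X N = {u.
     (AE t in M. u t \<in> X) \<and>
     (\<exists>s. (\<forall>n::nat. simple_function M (s n) \<and> s n \<in> space M \<rightarrow> X) \<and>
          (AE t in M. (\<lambda>n. N (s n t - u t)) \<longlonglongrightarrow> 0)) \<and>
     integrable M (\<lambda>t. (N (u t))\<^sup>2)}"

definition L2H1 ::
  "'a::euclidean_space set \<Rightarrow> 'b::euclidean_space set \<Rightarrow> ('a \<Rightarrow> 'b \<Rightarrow> real) set" where
  "L2H1 \<Omega> Y = bochner_L2 (lebesgue_on \<Omega>) (H1 Y) (H1_norm Y)"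

definition L2H1_norm ::
  "'a::euclidean_space set \<Rightarrow> 'b::euclidean_space set \<Rightarrow> ('a \<Rightarrow> 'b \<Rightarrow> real) \<Rightarrow> real" where
  "L2H1_norm \<Omega> Y u = sqrt (LINT x|lebesgue_on \<Omega>. (H1_norm Y (u x))\<^sup>2)"

text \<open>Linear maps between spaces of equivalence classes, acting on representatives: linearity is
  required almost everywhere.\<close>

definition linear_L2H1_L2 ::
  "'a::euclidean_space set \<Rightarrow> 'b::euclidean_space set \<Rightarrow>
     (('a \<Rightarrow> 'b \<Rightarrow> real) \<Rightarrow> ('a \<Rightarrow> real)) \<Rightarrow> bool" where
  "linear_L2H1_L2 \<Omega> Y g \<longleftrightarrow>
     (\<forall>u\<in>L2H1 \<Omega> Y. g u \<in> L2 (lebesgue_on \<Omega>)) \<and>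
     (\<forall>u\<in>L2H1 \<Omega> Y. \<forall>v\<in>L2H1 \<Omega> Y.
        AE x in lebesgue_on \<Omega>. g (\<lambda>x y. u x y + v x y) x = g u x + g v x) \<and>
     (\<forall>u\<in>L2H1 \<Omega> Y. \<forall>c.
        AE x in lebesgue_on \<Omega>. g (\<lambda>x y. c * u x y) x = c * g u x)"

text \<open>\<open>u(0) = u0\<close> for an almost everywhere defined \<open>u\<close> on \<open>(0,T)\<close> means that \<open>u\<close> has a
  representative that is continuous on \<open>[0,T]\<close> and takes the value \<open>u0\<close> at time 0.\<close>

definition has_initial_value ::
  "real \<Rightarrow> 'x::minus set \<Rightarrow> ('x \<Rightarrow> real) \<Rightarrow> (real \<Rightarrow> 'x) \<Rightarrow> 'x \<Rightarrow> bool" where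
  "has_initial_value T X N u u0 \<longleftrightarrow>
     (\<exists>w. (\<forall>t\<in>{0..T}. w t \<in> X) \<and>
          (\<forall>t\<in>{0..T}. ((\<lambda>s. N (w s - w t)) \<longlongrightarrow> 0) (at t within {0..T})) \<and>
          (AE t in lebesgue_on {0<..<T}. w t = u t) \<and>
          w 0 = u0)"

section \<open>Polytopal domains and surface measure\<close>

definition convex_polytopal_domain :: "'a::euclidean_space set \<Rightarrow> bool" where
  "convex_polytopal_domain U \<longleftrightarrow> open U \<and> U \<noteq> {} \<and> convex U \<and> polytope (closure U)"

definition facet_normal :: "'a::euclidean_space set \<Rightarrow> 'a" where
  "facet_normal F = (SOME n. norm n = 1 \<and> (\<forall>x\<in>F. \<forall>y\<in>F. n \<bullet> (x - y) = 0))"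

text \<open>Surface measure on the boundary of a convex polytopal domain: the sum over the facets of
  \<open>(d - 1)\<close>-dimensional Lebesgue measure. For a subset of a facet the latter equals, by
  Fubini, the \<open>d\<close>-dimensional volume of the right prism of height 1 over this subset; the sign of
  the normal does not matter. In dimension 1 this counts the end points.\<close>

definition surface_measure :: "'a::euclidean_space set \<Rightarrow> 'a measure" where
  "surface_measure U = measure_of UNIV (sets borel)
     (\<lambda>E. \<Sum>F | F facet_of closure U.
        emeasure lborel {x + t *\<^sub>R facet_normal F | x t. x \<in> E \<inter> F \<and> t \<in> {0..1}})"

section \<open>Finite element spaces\<close>

definition simplicial_partition ::
  "'a::euclidean_space set \<Rightarrow> real \<Rightarrow> 'a set set \<Rightarrow> bool" where
  "simplicial_partition U H \<B> \<longleftrightarrow> finite \<B> \<and>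
     (\<forall>B\<in>\<B>. int DIM('a) simplex B) \<and>
     \<Union>\<B> = closure U \<and>
     (\<forall>B\<in>\<B>. \<forall>B'\<in>\<B>. B \<noteq> B' \<longrightarrow> interior B \<inter> interior B' = {}) \<and>
     H = Max (diameter ` \<B>)"

text \<open>Functions on \<open>closure U\<close> are extended by 0, so that they are determined as HOL functions.\<close>

definition P1_space :: "'a::euclidean_space set \<Rightarrow> 'a set set \<Rightarrow> ('a \<Rightarrow> real) set" where
  "P1_space U \<B> = {v. continuous_on (closure U) v \<and>
     (\<forall>B\<in>\<B>. \<exists>a c. \<forall>x\<in>B. v x = a \<bullet> x + c) \<and>
     (\<forall>x. x \<notin> closure U \<longrightarrow> v x = 0)}"

definition P1_space0 :: "'a::euclidean_space set \<Rightarrow> 'a set set \<Rightarrow> ('a \<Rightarrow> real) set" where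
  "P1_space0 U \<B> = {v \<in> P1_space U \<B>. \<forall>x\<in>frontier U. v x = 0}"

definition tensor_span :: "('a \<Rightarrow> real) set \<Rightarrow> ('b \<Rightarrow> real) set \<Rightarrow> ('a \<Rightarrow> 'b \<Rightarrow> real) set" where
  "tensor_span V W = {\<lambda>x y. \<Sum>i<n. c i * (\<xi> i x * \<eta> i y) | (n::nat) c \<xi> \<eta>.
     (\<forall>i<n. \<xi> i \<in> V \<and> \<eta> i \<in> W)}"

section \<open>The Galerkin problem\<close>

definition pressure_eq ::
  "'a::euclidean_space set \<Rightarrow> real \<Rightarrow> (real \<times> real \<Rightarrow> real) \<Rightarrow> ('a \<Rightarrow> real) \<Rightarrow> ('a \<Rightarrow> real) \<Rightarrow>
     ('a \<Rightarrow> real) \<Rightarrow> bool" where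
  "pressure_eq \<Omega> A f q p \<phi> \<longleftrightarrow>
     A * (LINT x|lebesgue_on \<Omega>. weak_grad \<Omega> p x \<bullet> weak_grad \<Omega> \<phi> x)
       = (LINT x|lebesgue_on \<Omega>. f (p x, q x) * \<phi> x)"

definition density_eq ::
  "'a::euclidean_space set \<Rightarrow> 'b::euclidean_space set \<Rightarrow> 'b set \<Rightarrow> real \<Rightarrow> real \<Rightarrow> real \<Rightarrow> real \<Rightarrow>
     ('a \<Rightarrow> real) \<Rightarrow> ('a \<Rightarrow> 'b \<Rightarrow> real) \<Rightarrow> ('a \<Rightarrow> 'b \<Rightarrow> real) \<Rightarrow> ('a \<Rightarrow> 'b \<Rightarrow> real) \<Rightarrow> bool" where
  "density_eq \<Omega> Y \<Gamma>R D \<kappa> pF R p r r' \<psi> \<longleftrightarrow>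
     (LINT x|lebesgue_on \<Omega>. LINT y|lebesgue_on Y. r' x y * \<psi> x y)
     + D * (LINT x|lebesgue_on \<Omega>. LINT y|lebesgue_on Y.
              weak_grad Y (r x) y \<bullet> weak_grad Y (\<psi> x) y)
     = \<kappa> * (LINT x|lebesgue_on \<Omega>. LINT y|restrict_space (surface_measure Y) \<Gamma>R.
              (p x + pF - R * r x y) * \<psi> x y)"

text \<open>Since \<open>VW\<close> is finite dimensional, point evaluations are continuous on it and the weak time
  derivative of a \<open>VW\<close>-valued function can be taken pointwise in the two space variables; for
  the same reason the choice of the norms on \<open>V\<close> and \<open>VW\<close> is immaterial.\<close>

definition galerkin_solution ::
  "real \<Rightarrow> 'a::euclidean_space set \<Rightarrow> 'b::euclidean_space set \<Rightarrow> 'b set \<Rightarrow>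
   real \<Rightarrow> real \<Rightarrow> real \<Rightarrow> real \<Rightarrow> real \<Rightarrow> (real \<times> real \<Rightarrow> real) \<Rightarrow>
   (('a \<Rightarrow> 'b \<Rightarrow> real) \<Rightarrow> ('a \<Rightarrow> real)) \<Rightarrow>
   ('a \<Rightarrow> real) set \<Rightarrow> ('b \<Rightarrow> real) set \<Rightarrow> ('a \<Rightarrow> real) \<Rightarrow> ('a \<Rightarrow> 'b \<Rightarrow> real) \<Rightarrow>
   (real \<Rightarrow> 'a \<Rightarrow> real) \<Rightarrow> (real \<Rightarrow> 'a \<Rightarrow> 'b \<Rightarrow> real) \<Rightarrow> bool" where
  "galerkin_solution T \<Omega> Y \<Gamma>R A D \<kappa> pF R f g V W \<pi>0 \<rho>0 \<pi> \<rho> \<longleftrightarrow>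
     (let VW = tensor_span V W; S = lebesgue_on {0<..<T} in
       \<pi> \<in> bochner_L2 S V (H1_norm \<Omega>) \<and>
       \<rho> \<in> bochner_L2 S VW (L2H1_norm \<Omega> Y) \<and>
       (\<exists>\<rho>' \<in> bochner_L2 S VW (L2H1_norm \<Omega> Y).
          (\<forall>x y. has_weak_partial {0<..<T} 1 (\<lambda>t. \<rho> t x y) (\<lambda>t. \<rho>' t x y)) \<and>
          (\<forall>\<phi>\<in>V. \<forall>\<psi>\<in>VW. AE t in S.
             pressure_eq \<Omega> A f (g (\<rho> t)) (\<pi> t) \<phi> \<and>
             density_eq \<Omega> Y \<Gamma>R D \<kappa> pF R (\<pi> t) (\<rho> t) (\<rho>' t) \<psi>)) \<and>
       has_initial_value T V (H1_norm \<Omega>) \<pi> \<pi>0 \<and>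
       has_initial_value T VW (L2H1_norm \<Omega> Y) \<rho> \<rho>0)"

end

theory Submission
  imports Defs "HOL-Computational_Algebra.Polynomial"
begin

text \<open>
  Since \<open>f (0, s) = 0\<close>, the zero function solves the discrete pressure equation for every density.
  It is the only solution. Indeed, the bound \<open>\<theta>\<close> on the weak derivative of \<open>f\<close> in the first variable
  implies \<open>\<bar>f (r, s)\<bar> \<le> \<theta> * \<bar>r\<bar>\<close>; testing the equation with the pressure itself and applying
  Poincare's inequality bounds \<open>A\<close> times the squared norm of its gradient by \<open>\<theta> * C\<Omega>\<close> times the same
  quantity, and the hypotheses on the constants force \<open>\<theta> * C\<Omega> < A\<close> (\<open>pressure_eq_imp_zero\<close>). Hence
  the pressure of a Galerkin solution vanishes at almost all times, the given initial pressure
  vanishes as well, and the coupling disappears.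

  What remains is a linear equation for the density in the finite-dimensional space \<open>tensor_span V W\<close>,
  with constant coefficients. In a nodal basis (\<open>nodal_basis\<close>) it is a system of differential
  equations with a symmetric positive definite mass matrix and a positive semidefinite matrix
  comprising diffusion and boundary absorption. A solution is given by a power series
  (\<open>density_problem_exists\<close>). Two solutions differ by a weak solution of the homogeneous system; it is
  classically differentiable by the lemma of du Bois-Reymond, and its
  energy is nonincreasing and starts at 0 (\<open>density_problem_unique\<close>).

  Most of the work goes into the analysis that these two arguments presuppose. Weak gradients are
  unique up to null sets (\<open>weak_zero\<close>), so that the chosen representatives \<open>weak_grad\<close> depend
  linearly on the function under integrals. Lipschitz functions that are differentiable almost
  everywhere, among them the finite element functions, have their classical gradient as weak
  gradient (\<open>lipschitz_has_weak_gradient\<close>). Finite element functions with zero boundary values are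
  limits of test functions, obtained by compressing them into the interior and mollifying
  (\<open>P1_space0_subset_H10\<close>); only this makes Poincare's inequality applicable to them. Finally, a continuous
  function with a bounded weak partial derivative is Lipschitz in the corresponding direction
  (\<open>weak_partial_bounded_imp_lipschitz\<close>), which gives both the bound on \<open>f\<close> and the lemma of du
  Bois-Reymond.
\<close>

section \<open>Smooth functions and test functions\<close>

subsection \<open>Closure properties\<close>

abbreviation smooth :: "('a::euclidean_space \<Rightarrow> real) \<Rightarrow> bool" where
  "smooth u \<equiv> (\<forall>k. C_k k u)"

lemma frechet_derivative_eqI:
  "(u has_derivative u') (at x) \<Longrightarrow> frechet_derivative u (at x) = u'"
  using frechet_derivative_at by metis

lemma C_k_imp_continuous: "C_k k u \<Longrightarrow> continuous_on UNIV u"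
  by (cases k) (auto intro!: continuous_at_imp_continuous_on differentiable_imp_continuous_within)

lemma C_k_Suc_imp: "C_k (Suc k) u \<Longrightarrow> C_k k u"
proof (induction k arbitrary: u)
  case 0
  then show ?case using C_k_imp_continuous[OF 0] by simp
next
  case (Suc k)
  show ?case unfolding C_k.simps(2)[of k] using Suc.IH Suc.prems by auto
qed

lemma C_k_const [simp]: "C_k k (\<lambda>x. c)"
  by (induction k arbitrary: c) auto

text \<open>A coinduction principle: a class of differentiable functions that is closed under partial
  derivatives consists of smooth functions, because \<open>C_k\<close> looks only at iterated partial
  derivatives. It replaces any computation of higher derivatives.\<close>

lemma smooth_class:
  assumes "u \<in> S"
    and "\<And>u x. u \<in> S \<Longrightarrow> u differentiable at x"
    and "\<And>u b. u \<in> S \<Longrightarrow> b \<in> Basis \<Longrightarrow> (\<lambda>x. frechet_derivative u (at x) b) \<in> S"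
  shows "C_k k u"
  using assms(1)
proof (induction k arbitrary: u)
  case 0
  then show ?case using assms(2)
    by (auto simp: continuous_on_eq_continuous_within intro: differentiable_imp_continuous_within)
next
  case (Suc k)
  then show ?case using assms(2,3) by auto
qed

lemma C_k_add: "C_k k u \<Longrightarrow> C_k k v \<Longrightarrow> C_k k (\<lambda>x. u x + v x)"
proof (induction k arbitrary: u v)
  case 0
  then show ?case by (auto intro: continuous_intros)
next
  case (Suc k)
  have "frechet_derivative (\<lambda>x. u x + v x) (at x) b
      = frechet_derivative u (at x) b + frechet_derivative v (at x) b" for x b
  proof -
    have "((\<lambda>x. u x + v x) has_derivative
        (\<lambda>h. frechet_derivative u (at x) h + frechet_derivative v (at x) h)) (at x)"
      using Suc.prems by (auto intro!: has_derivative_add simp: frechet_derivative_works[symmetric])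
    then show ?thesis by (simp add: frechet_derivative_eqI)
  qed
  then show ?case using Suc by simp
qed

lemma C_k_mult: "C_k k u \<Longrightarrow> C_k k v \<Longrightarrow> C_k k (\<lambda>x. u x * v x)"
proof (induction k arbitrary: u v)
  case 0
  then show ?case by (auto intro: continuous_intros)
next
  case (Suc k)
  have d: "((\<lambda>x. u x * v x) has_derivative
      (\<lambda>h. u x * frechet_derivative v (at x) h + frechet_derivative u (at x) h * v x)) (at x)" for x
    using Suc.prems by (auto intro!: has_derivative_mult simp: frechet_derivative_works[symmetric])
  have e: "frechet_derivative (\<lambda>x. u x * v x) (at x) b
      = u x * frechet_derivative v (at x) b + frechet_derivative u (at x) b * v x" for x b
    by (simp add: frechet_derivative_eqI[OF d])
  have "C_k k u" "C_k k v" using Suc.prems C_k_Suc_imp by auto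
  then show ?case using Suc.prems
    by (auto simp: e differentiable_def intro!: C_k_add Suc.IH d)
qed

text \<open>The outer function is generalised in the induction: by the chain rule the partial derivatives
  of the composition are products in which its derivative occurs as a new outer function.\<close>

lemma C_k_compose:
  fixes h :: "real \<Rightarrow> real"
  shows "smooth h \<Longrightarrow> C_k k u \<Longrightarrow> C_k k (\<lambda>x. h (u x))"
proof (induction k arbitrary: h u)
  case 0
  have "continuous_on UNIV h" using 0 C_k_imp_continuous by blast
  with 0 show ?case by (auto intro: continuous_on_compose2)
next
  case (Suc k)
  define h' where "h' t = frechet_derivative h (at t) 1" for t
  have hd: "h differentiable at t" for t using Suc.prems(1)[THEN spec, of "Suc 0"] by auto
  have h'1: "frechet_derivative h (at t) s = h' t * s" for t s
  proof -
    have "linear (frechet_derivative h (at t))" by (rule linear_frechet_derivative[OF hd])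
    from linear_scale[OF this, of s 1] show ?thesis by (simp add: h'_def)
  qed
  have sm: "smooth h'"
  proof
    fix j show "C_k j h'" using Suc.prems(1)[THEN spec, of "Suc j"] by (simp add: h'_def[abs_def])
  qed
  have d: "((\<lambda>x. h (u x)) has_derivative (\<lambda>b. h' (u x) * frechet_derivative u (at x) b)) (at x)" for x
  proof -
    have "(u has_derivative frechet_derivative u (at x)) (at x)"
      using Suc.prems by (simp add: frechet_derivative_works[symmetric])
    moreover have "(h has_derivative (\<lambda>s. h' (u x) * s)) (at (u x))"
      using hd[of "u x"] h'1[of "u x", abs_def] by (simp add: frechet_derivative_works)
    ultimately show ?thesis using has_derivative_compose by blast
  qed
  have e: "frechet_derivative (\<lambda>x. h (u x)) (at x) b = h' (u x) * frechet_derivative u (at x) b" for x b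
    by (simp add: frechet_derivative_eqI[OF d])
  have "C_k k u" using Suc.prems C_k_Suc_imp by auto
  from Suc.IH[OF sm this] Suc.prems show ?case
    by (auto simp: e differentiable_def intro!: C_k_mult d)
qed

lemma C_k_cmult: "C_k k u \<Longrightarrow> C_k k (\<lambda>x. c * u x)"
  by (intro C_k_mult) auto

lemma C_k_diff: "C_k k u \<Longrightarrow> C_k k v \<Longrightarrow> C_k k (\<lambda>x. u x - v x)"
  using C_k_add[OF _ C_k_cmult[of k v "-1"]] by simp

lemma C_k_prod: "(\<And>i. i \<in> I \<Longrightarrow> C_k k (u i)) \<Longrightarrow> C_k k (\<lambda>x. \<Prod>i\<in>I. u i x)"
  by (induction I rule: infinite_finite_induct) (auto intro: C_k_mult)

lemma C_k_affine: "C_k k (\<lambda>x. a \<bullet> x + c)"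
proof (cases k)
  case (Suc j)
  have d: "((\<lambda>x. a \<bullet> x + c) has_derivative (\<lambda>h. a \<bullet> h)) (at x)" for x
    by (auto intro!: derivative_eq_intros)
  show ?thesis unfolding Suc by (auto simp: frechet_derivative_eqI[OF d] differentiable_def intro: d)
qed (auto intro!: continuous_intros)

lemma has_derivative_reflect:
  assumes "u differentiable at (c - x)"
  shows "((\<lambda>x. u (c - x)) has_derivative (\<lambda>h. - frechet_derivative u (at (c - x)) h)) (at x)"
proof -
  have "(u has_derivative frechet_derivative u (at (c - x))) (at (c - x))"
    using assms by (simp add: frechet_derivative_works[symmetric])
  moreover have "((\<lambda>x. c - x) has_derivative (\<lambda>h. - h)) (at x)"
    by (auto intro!: derivative_eq_intros)
  ultimately have "((\<lambda>x. u (c - x)) has_derivative (\<lambda>h. frechet_derivative u (at (c - x)) (- h))) (at x)"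
    using has_derivative_compose[of "\<lambda>x. c - x" _ x] by blast
  then show ?thesis using linear_neg[OF linear_frechet_derivative[OF assms]] by simp
qed

lemma frechet_derivative_reflect:
  assumes "u differentiable at (c - x)"
  shows "frechet_derivative (\<lambda>x. u (c - x)) (at x) b = - frechet_derivative u (at (c - x)) b"
  by (simp add: frechet_derivative_eqI[OF has_derivative_reflect[OF assms]])

lemma C_k_reflect: "C_k k u \<Longrightarrow> C_k k (\<lambda>x. u (c - x))"
proof (induction k arbitrary: u)
  case 0
  then show ?case by (auto intro!: continuous_on_compose2[of UNIV u] continuous_intros)
next
  case (Suc k)
  have u: "u differentiable at (c - x)" for x using Suc.prems by simp
  have e: "frechet_derivative (\<lambda>x. u (c - x)) (at x) b = - 1 * frechet_derivative u (at (c - x)) b" for x b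
    by (simp add: frechet_derivative_reflect[OF u])
  have "C_k k (\<lambda>x. - 1 * frechet_derivative u (at (c - x)) b)" if "b \<in> Basis" for b
    using Suc.prems that by (intro C_k_cmult Suc.IH) simp
  then show ?case
    unfolding C_k.simps e using has_derivative_reflect[OF u] by (auto simp: differentiable_def)
qed

lemma smooth_exp: "smooth (exp :: real \<Rightarrow> real)"
proof
  fix k
  have d: "(exp has_derivative (\<lambda>h. exp x * h)) (at x)" for x :: real
    by (auto intro!: derivative_eq_intros)
  show "C_k k (exp :: real \<Rightarrow> real)"
    by (rule smooth_class[of _ "{exp}"])
       (auto simp: frechet_derivative_eqI[OF d] differentiable_def intro: d)
qed

subsection \<open>A smooth function vanishing on the negative half line\<close>

lemma poly_exp_tendsto_0:
  fixes p :: "real poly"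
  shows "((\<lambda>x. poly p (1 / x) * exp (- 1 / x)) \<longlongrightarrow> 0) (at_right 0)"
proof -
  have lim: "((\<lambda>y. poly p y * exp (- y)) \<longlongrightarrow> 0) at_top"
  proof -
    have "((\<lambda>y. \<Sum>i\<le>degree p. coeff p i * (y ^ i / exp y)) \<longlongrightarrow> (\<Sum>i\<le>degree p. coeff p i * 0)) at_top"
      by (intro tendsto_intros tendsto_power_div_exp_0)
    then show ?thesis
      by (simp add: poly_altdef sum_distrib_right exp_minus divide_inverse mult.assoc)
  qed
  have "filterlim (\<lambda>x::real. 1 / x) at_top (at_right 0)"
    using filterlim_inverse_at_top_right by (simp add: inverse_eq_divide)
  from filterlim_compose[OF lim this] show ?thesis by simp
qed

text \<open>For \<open>p = 1\<close> this is the usual function \<open>exp (- 1 / x)\<close>, extended by 0 to the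
  left. The polynomial factor makes the class closed under differentiation.\<close>

definition flat :: "real poly \<Rightarrow> real \<Rightarrow> real" where
  "flat p x = (if x > 0 then poly p (1 / x) * exp (- 1 / x) else 0)"

lemma flat_has_derivative:
  "(flat p has_real_derivative flat (([:0, 0, 1:]) * (p - pderiv p)) x) (at x)"
proof -
  consider "x > 0" | "x < 0" | "x = 0" by linarith
  then show ?thesis
  proof cases
    case 1
    have "((\<lambda>x. poly p (1 / x) * exp (- 1 / x)) has_real_derivative
        flat (([:0, 0, 1:]) * (p - pderiv p)) x) (at x)"
      using 1 by (auto intro!: derivative_eq_intros simp: flat_def field_simps power2_eq_square)
    then show ?thesis
      by (rule has_field_derivative_transform_within_open[of _ _ _ "{0<..}"])
         (use 1 in \<open>auto simp: flat_def\<close>)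
  next
    case 2
    have "((\<lambda>x. 0) has_real_derivative flat (([:0, 0, 1:]) * (p - pderiv p)) x) (at x)"
      using 2 by (auto simp: flat_def)
    then show ?thesis
      by (rule has_field_derivative_transform_within_open[of _ _ _ "{..<0}"])
         (use 2 in \<open>auto simp: flat_def\<close>)
  next
    case 3
    have "((\<lambda>y. (flat p y - flat p 0) / (y - 0)) \<longlongrightarrow> 0) (at 0)"
      proof (rule filterlim_split_at_real)
      have "((\<lambda>y::real. 0) \<longlongrightarrow> (0::real)) (at_left 0)" by simp
      then show "((\<lambda>y. (flat p y - flat p 0) / (y - 0)) \<longlongrightarrow> 0) (at_left 0)"
        by (rule Lim_transform_eventually) (auto simp: eventually_at_filter flat_def)
    next
      have "((\<lambda>x. poly ([:0,1:] * p) (1 / x) * exp (- 1 / x)) \<longlongrightarrow> 0) (at_right 0)"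
        by (rule poly_exp_tendsto_0)
      then show "((\<lambda>y. (flat p y - flat p 0) / (y - 0)) \<longlongrightarrow> 0) (at_right 0)"
        by (rule Lim_transform_eventually) (auto simp: eventually_at_filter flat_def)
    qed
    then show ?thesis unfolding 3 has_field_derivative_iff by (simp add: flat_def)
  qed
qed

lemma smooth_flat: "smooth (flat p)"
proof
  fix k
  have d: "(flat p has_derivative (\<lambda>h. flat (([:0, 0, 1:]) * (p - pderiv p)) x * h)) (at x)" for p x
    using flat_has_derivative[of p x] by (simp add: has_field_derivative_def mult_commute_abs)
  show "C_k k (flat p)"
    by (rule smooth_class[of _ "range flat"])
       (auto simp: frechet_derivative_eqI[OF d] differentiable_def intro: d)
qed

subsection \<open>Test functions\<close>

text \<open>The affine form of the arguments, \<open>a \<bullet> x + c\<close>, is the one in which smoothness of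
  affine functions is stated.\<close>

definition box_bump :: "'a::euclidean_space \<Rightarrow> 'a \<Rightarrow> 'a \<Rightarrow> real" where
  "box_bump a b x = (\<Prod>i\<in>Basis. flat 1 (i \<bullet> x + - (a \<bullet> i)) * flat 1 ((- i) \<bullet> x + b \<bullet> i))"

lemma flat_1: "flat 1 t \<ge> 0" "flat 1 t > 0 \<longleftrightarrow> t > 0" "flat 1 t = 0 \<longleftrightarrow> t \<le> 0"
  by (auto simp: flat_def)

lemma smooth_box_bump: "smooth (box_bump a b)"
  unfolding box_bump_def
  by (intro allI C_k_prod C_k_mult C_k_compose[OF smooth_flat] C_k_affine)

lemma box_bump_nonneg: "box_bump a b x \<ge> 0"
  unfolding box_bump_def by (intro prod_nonneg mult_nonneg_nonneg ballI flat_1)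

lemma box_bump_pos: "x \<in> box a b \<Longrightarrow> box_bump a b x > 0"
  unfolding box_bump_def
  by (intro prod_pos mult_pos_pos ballI flat_1(2)[THEN iffD2]) (auto simp: mem_box inner_commute)

lemma box_bump_zero: "x \<notin> box a b \<Longrightarrow> box_bump a b x = 0"
  unfolding box_bump_def by (rule prod_zero) (auto simp: mem_box inner_commute flat_1 not_less)

lemma smooth_differentiable: "smooth u \<Longrightarrow> u differentiable at x"
  by (drule spec[of _ "Suc 0"]) auto

lemma smooth_continuous: "smooth u \<Longrightarrow> continuous_on UNIV u"
  using C_k_imp_continuous by blast

lemma smooth_partial: "smooth u \<Longrightarrow> b \<in> Basis \<Longrightarrow> smooth (\<lambda>x. frechet_derivative u (at x) b)"
proof
  fix k assume "smooth u" "b \<in> Basis"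
  then show "C_k k (\<lambda>x. frechet_derivative u (at x) b)" by (auto dest: spec[of _ "Suc k"])
qed

definition grad :: "('a::euclidean_space \<Rightarrow> real) \<Rightarrow> 'a \<Rightarrow> 'a" where
  "grad u x = (\<Sum>b\<in>Basis. frechet_derivative u (at x) b *\<^sub>R b)"

lemma grad_inner_Basis: "b \<in> Basis \<Longrightarrow> grad u x \<bullet> b = frechet_derivative u (at x) b"
  by (simp add: grad_def)

lemma grad_has_derivative:
  assumes "u differentiable at x"
  shows "(u has_derivative (\<lambda>h. grad u x \<bullet> h)) (at x)"
proof -
  have "frechet_derivative u (at x) h = grad u x \<bullet> h" for h
  proof -
    interpret linear "frechet_derivative u (at x)" by (rule linear_frechet_derivative[OF assms])
    have "frechet_derivative u (at x) h = frechet_derivative u (at x) (\<Sum>b\<in>Basis. (h \<bullet> b) *\<^sub>R b)"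
      by (simp add: euclidean_representation)
    also have "\<dots> = grad u x \<bullet> h"
      unfolding grad_def inner_sum_left by (simp add: sum scale inner_commute mult.commute)
    finally show ?thesis .
  qed
  then have "frechet_derivative u (at x) = (\<lambda>h. grad u x \<bullet> h)" by blast
  then show ?thesis using assms by (simp add: frechet_derivative_works)
qed

lemma grad_eqI: "(u has_derivative (\<lambda>h. a \<bullet> h)) (at x) \<Longrightarrow> grad u x = a"
  by (simp add: grad_def frechet_derivative_eqI euclidean_representation)

lemma continuous_grad: "smooth u \<Longrightarrow> continuous_on UNIV (grad u)"
  unfolding grad_def
  by (intro continuous_intros smooth_continuous smooth_partial)

lemma test_functionE:
  assumes "test_function U \<phi>"
  obtains K where "smooth \<phi>" "compact K" "K \<subseteq> U" "\<And>x. x \<notin> K \<Longrightarrow> \<phi> x = 0"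
  using assms unfolding test_function_def by blast

lemma grad_zero_outside:
  assumes "closed K" "\<And>x. x \<notin> K \<Longrightarrow> \<phi> x = 0" "x \<notin> K"
  shows "grad \<phi> x = 0"
proof -
  have "((\<lambda>x. 0::real) has_derivative (\<lambda>h. 0 \<bullet> h)) (at x)" by simp
  then have "(\<phi> has_derivative (\<lambda>h. 0 \<bullet> h)) (at x)"
    by (rule has_derivative_transform_within_open[of _ _ _ _ "- K"]) (use assms in auto)
  then show ?thesis by (rule grad_eqI)
qed

lemma compact_support_bounded:
  fixes u :: "'a::euclidean_space \<Rightarrow> 'b::real_normed_vector"
  assumes "compact K" "continuous_on UNIV u" "\<And>x. x \<notin> K \<Longrightarrow> u x = 0"
  obtains C where "C \<ge> 0" "\<And>x. norm (u x) \<le> C"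
proof -
  have "compact (u ` K)" by (meson assms compact_continuous_image continuous_on_subset subset_UNIV)
  then obtain C where C: "\<And>x. x \<in> K \<Longrightarrow> norm (u x) \<le> C"
    by (meson bounded_iff compact_imp_bounded imageI)
  have "norm (u x) \<le> max C 0" for x using C[of x] assms(3)[of x] by (cases "x \<in> K") auto
  then show ?thesis using that[of "max C 0"] by auto
qed

lemma lipschitz_if_bounded_grad:
  assumes "\<And>x. x \<in> X \<Longrightarrow> (u has_derivative (\<lambda>h. G x \<bullet> h)) (at x)" "convex X"
    "\<And>x. x \<in> X \<Longrightarrow> norm (G x) \<le> C" "C \<ge> 0"
  shows "C-lipschitz_on X u"
proof (rule bounded_derivative_imp_lipschitz)
  show "(u has_derivative (\<lambda>h. G x \<bullet> h)) (at x within X)" if "x \<in> X" for x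
    using assms(1)[OF that] by (rule has_derivative_at_withinI)
  show "onorm (\<lambda>h. G x \<bullet> h) \<le> C" if "x \<in> X" for x
    by (rule onorm_bound[OF assms(4)])
       (use order_trans[OF Cauchy_Schwarz_ineq2[of "G x"] mult_right_mono[OF assms(3)[OF that] norm_ge_zero]]
         in auto)
qed (use assms in auto)

lemma test_function_lipschitz:
  assumes "test_function U \<phi>"
  obtains C where "C \<ge> 0" "C-lipschitz_on UNIV \<phi>" "\<And>x. norm (grad \<phi> x) \<le> C"
proof -
  obtain K where K: "smooth \<phi>" "compact K" "K \<subseteq> U" "\<And>x. x \<notin> K \<Longrightarrow> \<phi> x = 0"
    using assms by (rule test_functionE) blast
  obtain C where C: "C \<ge> 0" "\<And>x. norm (grad \<phi> x) \<le> C"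
    by (rule compact_support_bounded[OF K(2) continuous_grad[OF K(1)]
        grad_zero_outside[OF compact_imp_closed[OF K(2)] K(4)]]) auto
  have "C-lipschitz_on UNIV \<phi>"
    by (rule lipschitz_if_bounded_grad[where G = "grad \<phi>"])
       (use C grad_has_derivative[OF smooth_differentiable[OF K(1)]] in auto)
  then show ?thesis using C that by blast
qed

section \<open>Weak gradients\<close>

subsection \<open>The fundamental lemma of the calculus of variations\<close>

text \<open>Integrals over \<open>S\<close> of functions vanishing outside \<open>S\<close> are moved to the whole space,
  where translation invariance and comparison of different domains are available.\<close>

lemma lebesgue_on_support:
  fixes g :: "'a::euclidean_space \<Rightarrow> 'b::{banach, second_countable_topology}"
  assumes "S \<in> sets lebesgue" "\<And>x. x \<notin> S \<Longrightarrow> g x = 0"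
  shows integrable_lebesgue_on_support: "integrable (lebesgue_on S) g \<longleftrightarrow> integrable lebesgue g"
    and integral_lebesgue_on_support: "(LINT x|lebesgue_on S. g x) = (LINT x|lebesgue. g x)"
proof -
  have e: "(\<lambda>x. indicator S x *\<^sub>R g x) = g" using assms(2) by (auto simp: indicator_def)
  show "integrable (lebesgue_on S) g \<longleftrightarrow> integrable lebesgue g"
    using integrable_restrict_space[of S lebesgue g] assms(1) unfolding e by simp
  show "(LINT x|lebesgue_on S. g x) = (LINT x|lebesgue. g x)"
    using integral_restrict_space[of S lebesgue g] assms(1) unfolding e by simp
qed

lemma borel_measurable_lebesgue_onI:
  "continuous_on UNIV u \<Longrightarrow> u \<in> borel_measurable (lebesgue_on S)"
  by (rule measurable_restrict_space1, rule measurable_completion)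
     (simp add: borel_measurable_continuous_onI)

lemma locally_integrable_times_test:
  assumes "locally_integrable U v" "U \<in> sets lebesgue" "continuous_on UNIV \<phi>" "compact K" "K \<subseteq> U"
    and 0: "\<And>x. x \<notin> K \<Longrightarrow> \<phi> x = 0"
  shows "integrable (lebesgue_on U) (\<lambda>x. v x * \<phi> x)"
proof -
  obtain C where C: "C \<ge> 0" "\<And>x. norm (\<phi> x) \<le> C"
    by (rule compact_support_bounded[OF assms(4,3) 0]) auto
  have v: "integrable (lebesgue_on K) v" using assms unfolding locally_integrable_def by auto
  have K: "K \<in> sets lebesgue" using assms(4) by (simp add: lmeasurable_compact fmeasurableD)
  have "integrable (lebesgue_on K) (\<lambda>x. v x * \<phi> x)"
  proof (rule Bochner_Integration.integrable_bound[where f = "\<lambda>x. C * v x"])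
    show "(\<lambda>x. v x * \<phi> x) \<in> borel_measurable (lebesgue_on K)"
      by (intro borel_measurable_times borel_measurable_integrable[OF v]
          borel_measurable_lebesgue_onI assms)
    show "AE x in lebesgue_on K. norm (v x * \<phi> x) \<le> norm (C * v x)"
      using C(2) C(1) by (intro AE_I2) (auto simp: abs_mult mult.commute[of C] intro!: mult_left_mono)
  qed (use v in auto)
  moreover have "v x * \<phi> x = 0" if "x \<notin> K" for x using 0[OF that] by simp
  ultimately show ?thesis
    using integrable_lebesgue_on_support[OF K, of "\<lambda>x. v x * \<phi> x"]
      integrable_lebesgue_on_support[OF assms(2), of "\<lambda>x. v x * \<phi> x"] assms(5) by auto
qed

text \<open>The indicator function of an open box is the pointwise limit of the test functions
  \<open>1 - exp (- n * \<phi>)\<close>, where \<open>\<phi>\<close> is smooth and positive exactly on the box.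
  Dominated convergence transfers the hypothesis from test functions to boxes.\<close>

lemma weak_zero_box:
  assumes U: "open U" and v: "locally_integrable U v"
    and 0: "\<And>\<phi>. test_function U \<phi> \<Longrightarrow> (LINT x|lebesgue_on U. v x * \<phi> x) = 0"
    and ab: "cbox a b \<subseteq> U"
  shows "(LINT x|lebesgue_on U. indicator (box a b) x * v x) = 0"
proof -
  have U': "U \<in> sets lebesgue" using U by auto
  define \<phi> where "\<phi> n x = 1 - exp (- real n * box_bump a b x)" for n :: nat and x
  have smooth: "smooth (\<phi> n)" for n
    unfolding \<phi>_def[abs_def]
    by (intro allI C_k_diff C_k_const C_k_compose[OF smooth_exp] C_k_cmult)
       (use smooth_box_bump in blast)
  have supp: "\<phi> n x = 0" if "x \<notin> cbox a b" for n x
    using box_bump_zero[of x a b] that box_subset_cbox[of a b] by (auto simp: \<phi>_def)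
  have test: "test_function U (\<phi> n)" for n
    unfolding test_function_def using smooth supp ab by (auto intro!: exI[of _ "cbox a b"])
  have bnd: "\<bar>\<phi> n x\<bar> \<le> indicator (cbox a b) x" for n x
    using box_bump_nonneg[of a b x] supp[of x n] by (auto simp: \<phi>_def indicator_def)
  have lim: "(\<lambda>n. \<phi> n x) \<longlonglongrightarrow> indicator (box a b) x" for x
  proof (cases "x \<in> box a b")
    case True
    define q where "q = exp (- box_bump a b x)"
    have "norm q < 1" using box_bump_pos[OF True] by (simp add: q_def)
    then have "(\<lambda>n. 1 - q ^ n) \<longlonglongrightarrow> 1 - 0" by (intro tendsto_intros LIMSEQ_power_zero)
    then show ?thesis using True by (simp add: \<phi>_def q_def exp_of_nat_mult[symmetric] mult.commute)
  next
    case False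
    then show ?thesis by (simp add: \<phi>_def box_bump_zero)
  qed
  have iv: "integrable (lebesgue_on (cbox a b)) v"
    using v ab unfolding locally_integrable_def by auto
  have iv': "integrable lebesgue (\<lambda>x. indicator (cbox a b) x * v x)"
    using iv integrable_restrict_space[of "cbox a b" lebesgue v] by simp
  have *: "(LINT x|lebesgue_on U. v x * \<phi> n x) = (LINT x|lebesgue. v x * \<phi> n x)" for n
    by (rule integral_lebesgue_on_support[OF U']) (use supp ab in auto)
  have "(\<lambda>n. LINT x|lebesgue. v x * \<phi> n x)
      \<longlonglongrightarrow> (LINT x|lebesgue. (indicator (cbox a b) x * v x) * indicator (box a b) x)"
  proof (rule integral_dominated_convergence[where w = "\<lambda>x. \<bar>indicator (cbox a b) x * v x\<bar>"])
    have e: "v x * \<phi> n x = (indicator (cbox a b) x * v x) * \<phi> n x" for x n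
      using supp[of x n] by (auto simp: indicator_def)
    have [measurable]: "\<phi> n \<in> borel_measurable lebesgue" for n
      using borel_measurable_lebesgue_onI[OF smooth_continuous[OF smooth], of n UNIV] by simp
    note m = borel_measurable_integrable[OF iv']
    show "(\<lambda>x. v x * \<phi> n x) \<in> borel_measurable lebesgue" for n
      unfolding e by (intro borel_measurable_times[OF m]) measurable
    show "(\<lambda>x. indicator (cbox a b) x * v x * indicator (box a b) x) \<in> borel_measurable lebesgue"
      by (intro borel_measurable_times[OF m] borel_measurable_indicator) simp
    show "AE x in lebesgue. norm (v x * \<phi> n x) \<le> \<bar>indicator (cbox a b) x * v x\<bar>" for n
      using bnd[of n] by (intro AE_I2) (auto simp: abs_mult mult.commute intro!: mult_left_mono)
    show "AE x in lebesgue. (\<lambda>n. v x * \<phi> n x) \<longlonglongrightarrow> indicator (cbox a b) x * v x * indicator (box a b) x"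
      unfolding e by (intro AE_I2 tendsto_mult tendsto_const lim)
    show "integrable lebesgue (\<lambda>x. \<bar>indicator (cbox a b) x * v x\<bar>)" using iv' by auto
  qed
  then have "(LINT x|lebesgue. (indicator (cbox a b) x * v x) * indicator (box a b) x) = 0"
    using 0[OF test] by (simp add: * LIMSEQ_const_iff)
  moreover have "(LINT x|lebesgue_on U. indicator (box a b) x * v x)
      = (LINT x|lebesgue. indicator (box a b) x * v x)"
    by (rule integral_lebesgue_on_support[OF U']) (use ab box_subset_cbox in \<open>auto simp: indicator_def\<close>)
  moreover have "(indicator (cbox a b) x * v x) * indicator (box a b) x = indicator (box a b) x * v x" for x
    using box_subset_cbox[of a b] by (auto simp: indicator_def)
  ultimately show ?thesis by simp
qed

text \<open>Boxes form an intersection-stable generator of the Borel sets, so all integrals of \<open>v\<close>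
  over Borel sets vanish. The function is first replaced by a Borel measurable representative,
  since the argument cannot see Lebesgue null sets.\<close>

lemma AE_zero_if_box_integrals_zero:
  fixes v :: "'a::euclidean_space \<Rightarrow> real"
  assumes v: "integrable lebesgue v"
    and box: "\<And>a b. (LINT x|lebesgue. indicator (box a b) x * v x) = 0"
    and all: "(LINT x|lebesgue. v x) = 0"
  shows "AE x in lebesgue. v x = 0"
proof -
  obtain v' where v'[measurable]: "v' \<in> borel_measurable lborel" and vv': "AE x in lborel. v x = v' x"
    using completion_ex_borel_measurable_real[OF borel_measurable_integrable[OF v]] by auto
  have ae: "AE x in lebesgue. v x = v' x" by (rule AE_completion[OF vv'])
  note [measurable] = borel_measurable_integrable[OF v]
  have mv': "v' \<in> borel_measurable lebesgue" using v' by (rule measurable_completion)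
  have iv': "integrable lborel v'"
    using v ae integrable_cong_AE[OF _ mv' ae] integrable_completion[OF v'] by auto
  have eq: "(LINT x|lborel. indicator A x * v' x) = (LINT x|lebesgue. indicator A x * v x)"
    if A[measurable]: "A \<in> sets borel" for A
  proof -
    have "(LINT x|lborel. indicator A x * v' x) = (LINT x|lebesgue. indicator A x * v' x)"
      by (subst integral_completion) auto
    also have "\<dots> = (LINT x|lebesgue. indicator A x * v x)"
      by (rule integral_cong_AE) (use ae mv' in \<open>auto intro!: borel_measurable_times borel_measurable_indicator\<close>)
    finally show ?thesis .
  qed
  have ind: "integrable lborel (\<lambda>x. indicator A x * v' x)" if "A \<in> sets borel" for A
    using integrable_mult_indicator[OF _ iv', of A] that by simp
  have tot: "(LINT x|lborel. v' x) = 0" using eq[of UNIV] all by simp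
  have zero: "(LINT x|lborel. indicator A x * v' x) = 0" if "A \<in> sets borel" for A
  proof -
    let ?G = "range (\<lambda>(a, b). box a b :: 'a set)"
    have sb: "sets borel = sigma_sets UNIV ?G" unfolding borel_eq_box by (rule sets_measure_of) auto
    have "Int_stable ?G"
      unfolding Int_stable_def by (auto simp: image_iff box_Int_box)
    moreover have "?G \<subseteq> Pow UNIV" by auto
    moreover have "A \<in> sigma_sets UNIV ?G" using that sb by simp
    ultimately show ?thesis
    proof (induction rule: sigma_sets_induct_disjoint)
      case (basic A)
      then show ?case using box eq by auto
    next
      case empty
      then show ?case by simp
    next
      case (compl A)
      then have A: "A \<in> sets borel" by (simp add: sb)
      have "(LINT x|lborel. indicator (UNIV - A) x * v' x)
          = (LINT x|lborel. v' x - indicator A x * v' x)"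
        by (rule Bochner_Integration.integral_cong) (auto simp: indicator_def)
      also have "\<dots> = 0" using iv' ind[OF A] compl tot by simp
      finally show ?case .
    next
      case (union A)
      then have A: "A i \<in> sets borel" for i by (auto simp: sb)
      then have "(\<Union>i. A i) \<in> sets borel" by auto
      have "(LINT x:(\<Union>i. A i)|lborel. v' x) = (\<Sum>i. LINT x:A i|lborel. v' x)"
        by (rule lebesgue_integral_countable_add)
           (use union A ind[OF \<open>(\<Union>i. A i) \<in> sets borel\<close>]
             in \<open>auto simp: disjoint_family_on_def set_integrable_def\<close>)
      then show ?case using union by (simp add: set_lebesgue_integral_def)
    qed
  qed
  have "AE x in lborel. v' x = 0"
    by (rule density_unique_real[OF iv']) (use zero in \<open>auto simp: set_lebesgue_integral_def\<close>)
  then have "AE x in lebesgue. v' x = 0" by (rule AE_completion)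
  with ae show ?thesis by eventually_elim simp
qed

lemma AE_negligible: "negligible N \<Longrightarrow> AE x in lebesgue. x \<notin> N"
  by (simp add: AE_not_in negligible_iff_null_sets)

text \<open>The fundamental lemma of the calculus of variations. It makes weak derivatives unique, so that
  the choice in \<open>weak_grad\<close> does not matter under an integral.\<close>

lemma weak_zero:
  fixes v :: "'a::euclidean_space \<Rightarrow> real"
  assumes U: "open U" and v: "locally_integrable U v"
    and 0: "\<And>\<phi>. test_function U \<phi> \<Longrightarrow> (LINT x|lebesgue_on U. v x * \<phi> x) = 0"
  shows "AE x in lebesgue_on U. v x = 0"
proof -
  have U': "U \<in> sets lebesgue" using U by auto
  have int0: "(LINT x|lebesgue. indicator (box a b) x * v x) = 0" if "cbox a b \<subseteq> U" for a b
  proof -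
    have "(LINT x|lebesgue. indicator (box a b) x * v x) = (LINT x|lebesgue_on U. indicator (box a b) x * v x)"
      by (rule integral_lebesgue_on_support[OF U', symmetric])
         (use that box_subset_cbox in \<open>auto simp: indicator_def\<close>)
    then show ?thesis using weak_zero_box[OF U v 0 that] by simp
  qed
  have loc: "AE x in lebesgue. x \<in> cbox a b \<longrightarrow> v x = 0" if ab: "cbox a b \<subseteq> U" for a b
  proof -
    define w where "w x = indicator (box a b) x * v x" for x
    have "integrable (lebesgue_on (cbox a b)) v"
      using v ab unfolding locally_integrable_def by auto
    then have "integrable lebesgue (\<lambda>x. indicator (cbox a b) x *\<^sub>R v x)"
      using integrable_restrict_space[of "cbox a b" lebesgue v] by simp
    from integrable_mult_indicator[OF _ this, of "box a b"]
    have "integrable lebesgue (\<lambda>x. indicator (box a b) x *\<^sub>R indicator (cbox a b) x *\<^sub>R v x)" by simp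
    moreover have "indicator (box a b) x *\<^sub>R indicator (cbox a b) x *\<^sub>R v x = w x" for x
      using box_subset_cbox[of a b] by (auto simp: indicator_def w_def)
    ultimately have iw: "integrable lebesgue w" by simp
    have "AE x in lebesgue. w x = 0"
    proof (rule AE_zero_if_box_integrals_zero[OF iw])
      show "(LINT x|lebesgue. w x) = 0" using int0[OF ab] by (simp add: w_def)
      fix c d
      define p where "p = (\<Sum>i\<in>Basis. max (c\<bullet>i) (a\<bullet>i) *\<^sub>R i)"
      define q where "q = (\<Sum>i\<in>Basis. min (d\<bullet>i) (b\<bullet>i) *\<^sub>R i)"
      have 1: "box c d \<inter> box a b = box p q" unfolding p_def q_def by (rule box_Int_box)
      have "cbox p q \<subseteq> cbox a b" unfolding p_def q_def by (auto simp: mem_box)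
      then have "(LINT x|lebesgue. indicator (box p q) x * v x) = 0" using ab by (intro int0) auto
      moreover have "indicator (box c d) x * w x = indicator (box p q) x * v x" for x
        by (auto simp: indicator_def w_def 1[symmetric])
      ultimately show "(LINT x|lebesgue. indicator (box c d) x * w x) = 0" by simp
    qed
    with AE_negligible[OF negligible_frontier_interval[of a b]] show ?thesis
      by eventually_elim (auto simp: w_def)
  qed
  obtain \<D> where \<D>: "countable \<D>" "\<D> \<subseteq> Pow U" "\<And>X. X \<in> \<D> \<Longrightarrow> \<exists>a b. X = cbox a b" "\<Union>\<D> = U"
    using open_countable_Union_open_cbox[OF U] by metis
  have "AE x in lebesgue. \<forall>X\<in>\<D>. x \<in> X \<longrightarrow> v x = 0"
    unfolding AE_ball_countable[OF \<D>(1)] using loc \<D> by blast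
  then have "AE x in lebesgue. x \<in> U \<longrightarrow> v x = 0"
    by eventually_elim (use \<D>(4) in blast)
  then show ?thesis using U' by (simp add: AE_restrict_space_iff)
qed

subsection \<open>Uniqueness and linearity\<close>

lemma locally_integrable_add:
  "locally_integrable U u \<Longrightarrow> locally_integrable U v \<Longrightarrow> locally_integrable U (\<lambda>x. u x + v x)"
  unfolding locally_integrable_def by auto

lemma locally_integrable_cmult:
  "locally_integrable U u \<Longrightarrow> locally_integrable U (\<lambda>x. c * u x)"
  unfolding locally_integrable_def by auto

lemma test_partial:
  assumes "test_function U \<phi>" "b \<in> Basis"
  shows "test_function U (\<lambda>x. frechet_derivative \<phi> (at x) b)"
proof -
  obtain K where K: "smooth \<phi>" "compact K" "K \<subseteq> U" "\<And>x. x \<notin> K \<Longrightarrow> \<phi> x = 0"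
    using assms(1) by (rule test_functionE) blast
  have "frechet_derivative \<phi> (at x) b = 0" if "x \<notin> K" for x
    using grad_zero_outside[OF compact_imp_closed[OF K(2)] K(4) that] grad_inner_Basis[OF assms(2), of \<phi> x]
    by simp
  then show ?thesis unfolding test_function_def using smooth_partial[OF K(1) assms(2)] K by blast
qed

lemma integrable_times_test:
  assumes "locally_integrable U v" "open U" "test_function U \<phi>"
  shows "integrable (lebesgue_on U) (\<lambda>x. v x * \<phi> x)"
proof -
  obtain K where K: "smooth \<phi>" "compact K" "K \<subseteq> U" "\<And>x. x \<notin> K \<Longrightarrow> \<phi> x = 0"
    using assms(3) by (rule test_functionE) blast
  show ?thesis
    by (rule locally_integrable_times_test[OF assms(1) _ smooth_continuous[OF K(1)] K(2,3,4)])
       (use assms(2) in auto)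
qed

lemma has_weak_partial_add:
  assumes U: "open U" and b: "b \<in> Basis"
    and u: "has_weak_partial U b u1 v1" "has_weak_partial U b u2 v2"
  shows "has_weak_partial U b (\<lambda>x. u1 x + u2 x) (\<lambda>x. v1 x + v2 x)"
  unfolding has_weak_partial_def
proof (intro conjI allI impI)
  fix \<phi> assume \<phi>: "test_function U \<phi>"
  note d = test_partial[OF \<phi> b]
  show "(LINT x|lebesgue_on U. (u1 x + u2 x) * frechet_derivative \<phi> (at x) b)
      = - (LINT x|lebesgue_on U. (v1 x + v2 x) * \<phi> x)"
    using u \<phi> U d unfolding has_weak_partial_def
    by (simp add: distrib_right integrable_times_test)
qed (use u in \<open>auto simp: has_weak_partial_def locally_integrable_add\<close>)

lemma has_weak_partial_cmult:
  assumes "has_weak_partial U b u v"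
  shows "has_weak_partial U b (\<lambda>x. c * u x) (\<lambda>x. c * v x)"
  using assms unfolding has_weak_partial_def
  by (simp add: mult.assoc locally_integrable_cmult)

lemma has_weak_gradient_add:
  assumes "open U" "has_weak_gradient U u1 G1" "has_weak_gradient U u2 G2"
  shows "has_weak_gradient U (\<lambda>x. u1 x + u2 x) (\<lambda>x. G1 x + G2 x)"
  using assms unfolding has_weak_gradient_def by (simp add: has_weak_partial_add inner_add_left)

lemma has_weak_gradient_cmult:
  assumes "has_weak_gradient U u G"
  shows "has_weak_gradient U (\<lambda>x. c * u x) (\<lambda>x. c *\<^sub>R G x)"
  using assms unfolding has_weak_gradient_def by (simp add: has_weak_partial_cmult)

lemma has_weak_partial_unique:
  assumes U: "open U" and u: "has_weak_partial U b u v" "has_weak_partial U b u w"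
  shows "AE x in lebesgue_on U. v x = w x"
proof -
  have l: "locally_integrable U (\<lambda>x. v x + (-1) * w x)"
    using u unfolding has_weak_partial_def by (intro locally_integrable_add locally_integrable_cmult) auto
  have "AE x in lebesgue_on U. v x + (-1) * w x = 0"
  proof (rule weak_zero[OF U l])
    fix \<phi> assume \<phi>: "test_function U \<phi>"
    show "(LINT x|lebesgue_on U. (v x + (-1) * w x) * \<phi> x) = 0"
      using u \<phi> U integrable_times_test[OF _ U \<phi>] unfolding has_weak_partial_def
      by (simp add: left_diff_distrib)
  qed
  then show ?thesis by eventually_elim simp
qed

lemma has_weak_gradient_unique:
  fixes U :: "'a::euclidean_space set"
  assumes "open U" "has_weak_gradient U u G" "has_weak_gradient U u G'"
  shows "AE x in lebesgue_on U. G x = G' x"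
proof -
  have "AE x in lebesgue_on U. \<forall>b\<in>Basis. G x \<bullet> b = G' x \<bullet> b"
    using assms has_weak_partial_unique[OF assms(1)]
    unfolding has_weak_gradient_def by (intro AE_finite_allI) auto
  then show ?thesis by eventually_elim (simp add: euclidean_eq_iff[where 'a='a])
qed

lemma AE_weak_grad:
  assumes "open U" "has_weak_gradient U u G"
  shows "AE x in lebesgue_on U. weak_grad U u x = G x"
  using has_weak_gradient_unique[OF assms(1) _ assms(2), of "weak_grad U u"]
    someI[of "has_weak_gradient U u" G] assms(2) unfolding weak_grad_def by blast

subsection \<open>Lipschitz functions\<close>

lemma has_derivative_direction:
  fixes u :: "'a::real_normed_vector \<Rightarrow> real"
  assumes "(u has_derivative D) (at x)"
  shows "((\<lambda>t. u (x + t *\<^sub>R h)) has_real_derivative D h) (at 0)"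
proof -
  have "((\<lambda>t. x + t *\<^sub>R h) has_derivative (\<lambda>t. t *\<^sub>R h)) (at 0)"
    by (auto intro!: derivative_eq_intros)
  moreover have "(u has_derivative D) (at (x + 0 *\<^sub>R h))" using assms by simp
  ultimately have "((\<lambda>t. u (x + t *\<^sub>R h)) has_derivative (\<lambda>t. D (t *\<^sub>R h))) (at 0)"
    by (rule has_derivative_compose)
  then show ?thesis
    using linear_scale[OF has_derivative_linear[OF assms]]
    by (simp add: has_field_derivative_def mult_commute_abs)
qed

lemma difference_quotient_LIMSEQ:
  fixes u :: "'a::real_normed_vector \<Rightarrow> real"
  assumes "(u has_derivative D) (at x)" "t \<longlonglongrightarrow> 0" "\<And>n::nat. t n \<noteq> 0"
  shows "(\<lambda>n. (u (x + t n *\<^sub>R h) - u x) / t n) \<longlonglongrightarrow> D h"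
proof -
  have "((\<lambda>s. (u (x + s *\<^sub>R h) - u x) / s) \<longlongrightarrow> D h) (at 0)"
    using has_derivative_direction[OF assms(1), of h] by (simp add: has_field_derivative_iff)
  moreover have "filterlim t (at 0) sequentially"
    using assms(2,3) by (simp add: filterlim_at)
  ultimately show ?thesis by (rule filterlim_compose)
qed

text \<open>Only difference quotients in the direction of the gradient itself are needed.\<close>

lemma gradient_le_lipschitz:
  fixes u :: "'a::euclidean_space \<Rightarrow> real"
  assumes U: "open U" "x \<in> U" and L: "L-lipschitz_on U u" and d: "(u has_derivative (\<lambda>h. g \<bullet> h)) (at x)"
  shows "norm g \<le> L"
proof (cases "g = 0")
  case True
  then show ?thesis using lipschitz_on_nonneg[OF L] by simp
next
  case False
  obtain e where e: "e > 0" "cball x e \<subseteq> U" using U open_contains_cball by blast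
  define t where "t n = e / norm g / real (Suc n)" for n
  have t: "t \<longlonglongrightarrow> 0" unfolding t_def by (rule lim_const_over_n[THEN LIMSEQ_Suc])
  have t0: "t n > 0" for n using e False by (simp add: t_def)
  have "\<bar>(u (x + t n *\<^sub>R g) - u x) / t n\<bar> \<le> L * norm g" for n
  proof -
    have "norm (t n *\<^sub>R g) = e / real (Suc n)" using e False by (simp add: t_def)
    also have "\<dots> \<le> e" using e by (simp add: field_simps)
    finally have "norm (t n *\<^sub>R g) \<le> e" .
    then have "x + t n *\<^sub>R g \<in> U" using e by (auto simp: dist_norm)
    from lipschitz_onD[OF L this U(2)] t0[of n] show ?thesis
      by (simp add: dist_norm abs_divide field_simps)
  qed
  moreover have "(\<lambda>n. \<bar>(u (x + t n *\<^sub>R g) - u x) / t n\<bar>) \<longlonglongrightarrow> \<bar>g \<bullet> g\<bar>"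
    by (intro tendsto_rabs difference_quotient_LIMSEQ[OF d t]) (use t0 less_imp_neq in metis)
  ultimately have "\<bar>g \<bullet> g\<bar> \<le> L * norm g" by (intro LIMSEQ_le_const2) auto
  then show ?thesis using False by (simp add: dot_square_norm power2_eq_square)
qed

lemma integrable_bounded_compact:
  fixes u :: "'a::euclidean_space \<Rightarrow> 'b::{banach,second_countable_topology}"
  assumes "compact K" "u \<in> borel_measurable (lebesgue_on K)" "AE x in lebesgue_on K. norm (u x) \<le> C"
  shows "integrable (lebesgue_on K) u"
proof -
  have "finite_measure (lebesgue_on K)"
    using assms(1) by (intro finite_measure_lebesgue_on lmeasurable_compact)
  from finite_measure.integrable_const_bound[OF this assms(3,2)] show ?thesis .
qed

lemma locally_integrable_continuous:
  fixes u :: "'a::euclidean_space \<Rightarrow> real"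
  assumes "continuous_on U u"
  shows "locally_integrable U u"
  unfolding locally_integrable_def
proof (intro allI impI)
  fix K assume K: "compact K \<and> K \<subseteq> U"
  then have c: "continuous_on K u" using assms continuous_on_subset by blast
  then obtain C where C: "\<And>x. x \<in> K \<Longrightarrow> norm (u x) \<le> C"
    using compact_imp_bounded[OF compact_continuous_image, of K u] K by (auto simp: bounded_iff)
  show "integrable (lebesgue_on K) u"
  proof (rule integrable_bounded_compact)
    show "u \<in> borel_measurable (lebesgue_on K)"
      using K c by (intro continuous_imp_measurable_on_sets_lebesgue) (auto intro: fmeasurableD lmeasurable_compact)
    show "AE x in lebesgue_on K. norm (u x) \<le> C" using C by (intro AE_I2) auto
  qed (use K in auto)
qed

lemma integral_lborel_translate:
  fixes w :: "'a::euclidean_space \<Rightarrow> real"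
  assumes "w \<in> borel_measurable borel"
  shows "(LINT x|lborel. w (x + c)) = (LINT x|lborel. w x)"
proof -
  have "(LINT x|lborel. w (c + x)) = (LINT x|distr lborel borel ((+) c). w x)"
    using assms by (intro integral_distr[symmetric]) auto
  then show ?thesis by (simp add: lborel_distr_plus add.commute)
qed

text \<open>Integration by parts without the divergence theorem or Fubini. For a test function \<open>\<phi>\<close> the
  product \<open>u * \<phi>\<close> is Lipschitz with compact support, so the integral of its difference quotients
  is 0 by translation invariance. These quotients are bounded and converge almost everywhere to
  the derivative of the product, which therefore has integral 0 too. Applied to piecewise affine
  functions, this avoids all boundary terms on the faces of the mesh.\<close>

lemma lipschitz_has_weak_gradient:
  fixes u :: "'a::euclidean_space \<Rightarrow> real"
  assumes U: "open U" and L: "L-lipschitz_on U u" and G: "G \<in> borel_measurable (lebesgue_on U)"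
    and D: "AE x in lebesgue_on U. (u has_derivative (\<lambda>h. G x \<bullet> h)) (at x)"
  shows "has_weak_gradient U u G"
  unfolding has_weak_gradient_def
proof
  fix b :: 'a assume b: "b \<in> Basis"
  have U': "U \<in> sets lebesgue" using U by auto
  have cont: "continuous_on U u" using L by (rule lipschitz_on_continuous_on)
  have GL: "AE x in lebesgue. x \<in> U \<longrightarrow> norm (G x) \<le> L"
    using D unfolding AE_restrict_space_iff[of U lebesgue, simplified, OF U']
    by eventually_elim (use gradient_le_lipschitz[OF U _ L] in blast)
  have lG: "locally_integrable U (\<lambda>x. G x \<bullet> b)"
    unfolding locally_integrable_def
  proof (intro allI impI)
    fix K assume K: "compact K \<and> K \<subseteq> U"
    have "K \<in> sets lebesgue" using K by (auto intro: fmeasurableD lmeasurable_compact)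
    show "integrable (lebesgue_on K) (\<lambda>x. G x \<bullet> b)"
    proof (rule integrable_bounded_compact[where C = L])
      show "(\<lambda>x. G x \<bullet> b) \<in> borel_measurable (lebesgue_on K)"
        using measurable_restrict_mono[OF G, of K] K by auto
      have "AE x in lebesgue. x \<in> K \<longrightarrow> norm (G x \<bullet> b) \<le> L"
        using GL
      proof eventually_elim
        case (elim x)
        show ?case using elim K Basis_le_norm[OF b, of "G x"] by (auto simp: subset_iff)
      qed
      then show "AE x in lebesgue_on K. norm (G x \<bullet> b) \<le> L"
        using \<open>K \<in> sets lebesgue\<close> by (simp add: AE_restrict_space_iff)
    qed (use K in auto)
  qed
  show "has_weak_partial U b u (\<lambda>x. G x \<bullet> b)"
    unfolding has_weak_partial_def
  proof (intro conjI allI impI locally_integrable_continuous[OF cont] lG)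
    fix \<phi> assume \<phi>: "test_function U \<phi>"
    then obtain K where K: "smooth \<phi>" "compact K" "K \<subseteq> U" "\<And>x. x \<notin> K \<Longrightarrow> \<phi> x = 0"
      by (rule test_functionE) blast
    obtain C where C: "C \<ge> 0" "C-lipschitz_on UNIV \<phi>"
      using test_function_lipschitz[OF \<phi>] by metis
    obtain P where P: "P \<ge> 0" "\<And>x. norm (\<phi> x) \<le> P"
      by (rule compact_support_bounded[OF K(2) smooth_continuous[OF K(1)] K(4)]) auto
    have "bounded (u ` K)"
      using compact_imp_bounded[OF compact_continuous_image[OF continuous_on_subset[OF cont K(3)] K(2)]] .
    then obtain Q where Q: "\<And>x. x \<in> K \<Longrightarrow> \<bar>u x\<bar> \<le> Q" by (auto simp: bounded_iff)
    obtain e where e: "e > 0" "(\<Union>x\<in>K. ball x e) \<subseteq> U"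
      using compact_subset_open_imp_ball_epsilon_subset[OF K(2) U K(3)] by metis
    have L0: "L \<ge> 0" using lipschitz_on_nonneg[OF L] .
    define w where "w x = u x * \<phi> x" for x
    \<comment> \<open>A Lipschitz constant of the product near its support, where the possibly unbounded factor is bounded.\<close>
  define M where "M = \<bar>Q\<bar> * C + P * L"
    have M0: "M \<ge> 0" using C P L0 by (simp add: M_def)
    have wK: "w x = 0" if "x \<notin> K" for x using K(4)[OF that] by (simp add: w_def)
    have near: "\<bar>w y - w x\<bar> \<le> M * dist y x" if "x \<in> K" "dist x y < e" for x y
    proof -
      have "y \<in> ball x e" using that(2) by simp
      then have y: "y \<in> U" using that(1) e(2) by blast
      have "w y - w x = u x * (\<phi> y - \<phi> x) + \<phi> y * (u y - u x)" by (simp add: w_def algebra_simps)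
      also have "\<bar>\<dots>\<bar> \<le> \<bar>u x\<bar> * \<bar>\<phi> y - \<phi> x\<bar> + \<bar>\<phi> y\<bar> * \<bar>u y - u x\<bar>"
        by (metis (no_types) abs_mult abs_triangle_ineq)
      also have "\<dots> \<le> \<bar>Q\<bar> * (C * dist y x) + P * (L * dist y x)"
        using Q[OF that(1)] P(2)[of y] P(1) lipschitz_onD[OF C(2), of y x]
          lipschitz_onD[OF L y, of x] K(3) that(1)
        by (intro add_mono mult_mono) (auto simp: dist_real_def)
      also have "\<dots> = M * dist y x" by (simp add: M_def algebra_simps)
      finally show ?thesis .
    qed
    have wlip: "\<bar>w y - w x\<bar> \<le> M * dist y x" if "dist x y < e" for x y
    proof -
      consider "x \<in> K" | "y \<in> K" | "x \<notin> K" "y \<notin> K" by blast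
      then show ?thesis
      proof cases
        case 1
        then show ?thesis using near that by blast
      next
        case 2
        then show ?thesis using near[of y x] that by (simp add: dist_commute abs_minus_commute)
      next
        case 3
        then show ?thesis using wK M0 by simp
      qed
    qed
    have wcont: "continuous_on UNIV w"
      unfolding continuous_on_iff
    proof (intro ballI allI impI)
      fix x :: 'a and r :: real assume r: "r > 0"
      show "\<exists>d>0. \<forall>x'\<in>UNIV. dist x' x < d \<longrightarrow> dist (w x') (w x) < r"
      proof (intro exI conjI ballI impI)
        show "min e (r / (M + 1)) > 0" using e r M0 by simp
        fix y assume y: "dist y x < min e (r / (M + 1))"
        have "\<bar>w y - w x\<bar> \<le> M * dist y x" using wlip y by (simp add: dist_commute)
        also have "\<dots> \<le> (M + 1) * dist y x" by (simp add: mult_right_mono)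
        also have "\<dots> < r" using y M0 by (simp add: field_simps)
        finally show "dist (w y) (w x) < r" by (simp add: dist_real_def)
      qed
    qed
    have wmeas: "w \<in> borel_measurable borel" using wcont by (rule borel_measurable_continuous_onI)
    have wint: "integrable lebesgue w"
      using locally_integrable_times_test[OF locally_integrable_continuous[OF cont] U'
        smooth_continuous[OF K(1)] K(2,3,4)] integrable_lebesgue_on_support[OF U', of w] wK K(3)
      unfolding w_def by auto
    then have wint': "integrable lborel w" using integrable_completion[of w lborel] wmeas by simp
    define t where "t n = e / 2 / real (Suc n)" for n
    have t: "t \<longlonglongrightarrow> 0" unfolding t_def by (rule lim_const_over_n[THEN LIMSEQ_Suc])
    have t0: "t n > 0" for n using e by (simp add: t_def)
    have te: "t n \<le> e / 2" for n using e by (simp add: t_def field_simps)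
    define q where "q n x = (w (x + t n *\<^sub>R b) - w x) / t n" for n x
    define F where "F x = u x * frechet_derivative \<phi> (at x) b + (G x \<bullet> b) * \<phi> x" for x
    define K' where "K' = (\<Union>x\<in>K. \<Union>y\<in>cball 0 (e / 2). {x + y})"
    have K': "compact K'" unfolding K'_def by (intro compact_sums' K compact_cball)
    have q0: "(LINT x|lebesgue. q n x) = 0" for n
    proof -
      have m: "(\<lambda>x. w (x + t n *\<^sub>R b)) \<in> borel_measurable borel" using wmeas by measurable
      have i: "integrable lborel (\<lambda>x. w (x + t n *\<^sub>R b))"
        using integrable_distr[of "(+) (t n *\<^sub>R b)" lborel borel w] wint'
        by (simp add: lborel_distr_plus add.commute)
      have "(LINT x|lebesgue. q n x) = (LINT x|lborel. q n x)"
        unfolding q_def using wmeas m by (intro integral_completion) auto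
      also have "\<dots> = ((LINT x|lborel. w (x + t n *\<^sub>R b)) - (LINT x|lborel. w x)) / t n"
        unfolding q_def using i wint' by simp
      also have "\<dots> = 0" using integral_lborel_translate[OF wmeas] by simp
      finally show ?thesis .
    qed
    have qb: "\<bar>q n x\<bar> \<le> M * indicator K' x" for n x
    proof (cases "x \<in> K'")
      case True
      have "dist x (x + t n *\<^sub>R b) = t n" using b t0[of n] by (simp add: dist_norm)
      moreover have "t n < e" using te[of n] e by simp
      ultimately have "\<bar>w (x + t n *\<^sub>R b) - w x\<bar> \<le> M * t n" using wlip[of x "x + t n *\<^sub>R b"]
        by (simp add: dist_commute)
      then show ?thesis using True t0[of n] by (simp add: q_def abs_divide field_simps)
    next
      case False
      have "x \<notin> K" using False e unfolding K'_def by force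
      moreover have "x + t n *\<^sub>R b \<notin> K"
      proof
        assume "x + t n *\<^sub>R b \<in> K"
        moreover have "- (t n *\<^sub>R b) \<in> cball 0 (e / 2)" using b t0[of n] te[of n] by simp
        ultimately have "(x + t n *\<^sub>R b) + - (t n *\<^sub>R b) \<in> K'" unfolding K'_def by blast
        with False show False by simp
      qed
      ultimately show ?thesis using wK False by (simp add: q_def)
    qed
    have F0: "F x = 0" if "x \<notin> K" for x
      using K(4)[OF that] grad_zero_outside[OF compact_imp_closed[OF K(2)] K(4) that]
        grad_inner_Basis[OF b, of \<phi> x] by (simp add: F_def)
    note ph = smooth_differentiable[OF K(1)]
    have qlim: "AE x in lebesgue. (\<lambda>n. q n x) \<longlonglongrightarrow> F x"
      using D unfolding AE_restrict_space_iff[of U lebesgue, simplified, OF U']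
    proof eventually_elim
      case (elim x)
      show ?case
      proof (cases "x \<in> U")
        case True
        have "(w has_derivative (\<lambda>h. u x * (grad \<phi> x \<bullet> h) + (G x \<bullet> h) * \<phi> x)) (at x)"
          unfolding w_def[abs_def]
          by (intro has_derivative_mult grad_has_derivative ph elim[rule_format] True)
        from difference_quotient_LIMSEQ[OF this t, of b] show ?thesis
          using t0 unfolding q_def F_def grad_inner_Basis[OF b, symmetric] by (metis less_irrefl)
      next
        case False
        then have x: "x \<notin> K" using K by auto
        have "(w has_derivative (\<lambda>h. 0)) (at x)"
          by (rule has_derivative_transform_within_open[of "\<lambda>_. 0" _ _ _ "- K"])
             (use x K(2) wK compact_imp_closed in auto)
        from difference_quotient_LIMSEQ[OF this t, of b] show ?thesis
          using t0 unfolding q_def F0[OF x] by (metis less_irrefl)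
      qed
    qed
    have i1: "integrable (lebesgue_on U) (\<lambda>x. u x * frechet_derivative \<phi> (at x) b)"
      by (rule integrable_times_test[OF locally_integrable_continuous[OF cont] U test_partial[OF \<phi> b]])
    have i2: "integrable (lebesgue_on U) (\<lambda>x. (G x \<bullet> b) * \<phi> x)"
      by (rule integrable_times_test[OF lG U \<phi>])
    have iF: "integrable (lebesgue_on U) F" unfolding F_def using i1 i2 by auto
    have eF: "(LINT x|lebesgue_on U. F x) = (LINT x|lebesgue. F x)"
      by (rule integral_lebesgue_on_support[OF U']) (use F0 K in auto)
    have iF': "integrable lebesgue F"
      using iF integrable_lebesgue_on_support[OF U', of F] F0 K(3) by auto
    have "(\<lambda>n. LINT x|lebesgue. q n x) \<longlonglongrightarrow> (LINT x|lebesgue. F x)"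
    proof (rule integral_dominated_convergence[where w = "\<lambda>x. M * indicator K' x"])
      show "F \<in> borel_measurable lebesgue" using iF' by auto
      have "continuous_on UNIV (q n)" for n
        unfolding q_def using t0[of n] by (intro continuous_intros continuous_on_compose2[OF wcont]) auto
      then show "q n \<in> borel_measurable lebesgue" for n
        by (intro measurable_completion) (simp add: borel_measurable_continuous_onI)
      show "integrable lebesgue (\<lambda>x. M * indicator K' x)"
        using lmeasurable_compact[OF K'] by (auto simp: fmeasurable_def)
      show "AE x in lebesgue. norm (q n x) \<le> M * indicator K' x" for n using qb by auto
    qed (rule qlim)
    then have "(LINT x|lebesgue. F x) = 0" by (simp add: q0 LIMSEQ_const_iff)
    then show "(LINT x|lebesgue_on U. u x * frechet_derivative \<phi> (at x) b)
        = - (LINT x|lebesgue_on U. (G x \<bullet> b) * \<phi> x)"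
      using i1 i2 eF unfolding F_def by simp
  qed
qed

text \<open>The gradient is defined as a limit of difference quotients along a fixed sequence, because then
  its measurability is automatic.\<close>

lemma lipschitz_weak_gradient_exists:
  fixes u :: "'a::euclidean_space \<Rightarrow> real"
  assumes U: "open U" and L: "L-lipschitz_on U u"
    and D: "AE x in lebesgue_on U. u differentiable at x"
  obtains G where "G \<in> borel_measurable (lebesgue_on U)" "has_weak_gradient U u G"
    "AE x in lebesgue_on U. (u has_derivative (\<lambda>h. G x \<bullet> h)) (at x)"
    "AE x in lebesgue_on U. norm (G x) \<le> L"
proof -
  have U': "U \<in> sets lebesgue" using U by auto
  \<comment> \<open>Extended by 0, the function is Borel measurable and can be evaluated at translated points.\<close>
  define u' where "u' x = indicator U x *\<^sub>R u x" for x
  define t where "t n = 1 / real (Suc n)" for n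
  have t: "t \<longlonglongrightarrow> 0" unfolding t_def by (rule lim_const_over_n[THEN LIMSEQ_Suc])
  have t0: "t n > 0" for n by (simp add: t_def)
  define G where "G x = (\<Sum>b\<in>Basis. lim (\<lambda>n. (u' (x + t n *\<^sub>R b) - u' x) / t n) *\<^sub>R b)" for x
  have "continuous_on U u" using L by (rule lipschitz_on_continuous_on)
  then have [measurable]: "u' \<in> borel_measurable borel"
    unfolding u'_def using U by (intro borel_measurable_continuous_on_indicator) auto
  have "G \<in> borel_measurable borel" unfolding G_def by measurable
  then have m: "G \<in> borel_measurable (lebesgue_on U)"
    by (intro measurable_restrict_space1 measurable_completion) simp
  have der: "(u has_derivative (\<lambda>h. G x \<bullet> h)) (at x)" if d: "u differentiable at x" and x: "x \<in> U" for x
  proof -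
    have "(u has_derivative (\<lambda>h. grad u x \<bullet> h)) (at x)" using grad_has_derivative[OF d] .
    then have "(u' has_derivative (\<lambda>h. grad u x \<bullet> h)) (at x)"
      by (rule has_derivative_transform_within_open[OF _ U x]) (simp add: u'_def)
    then have "lim (\<lambda>n. (u' (x + t n *\<^sub>R b) - u' x) / t n) = grad u x \<bullet> b" for b
      by (intro limI difference_quotient_LIMSEQ[OF _ t]) (simp_all add: t_def)
    then have "G x = grad u x" unfolding G_def by (simp add: euclidean_representation)
    then show ?thesis using grad_has_derivative[OF d] by simp
  qed
  have D': "AE x in lebesgue_on U. (u has_derivative (\<lambda>h. G x \<bullet> h)) (at x) \<and> x \<in> U"
    using D AE_space[of "lebesgue_on U"] by eventually_elim (use der in auto)
  then have D1: "AE x in lebesgue_on U. (u has_derivative (\<lambda>h. G x \<bullet> h)) (at x)"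
    by eventually_elim simp
  have "AE x in lebesgue_on U. norm (G x) \<le> L"
    using D' by eventually_elim (use gradient_le_lipschitz[OF U _ L] in blast)
  with that[OF m lipschitz_has_weak_gradient[OF U L m D1] D1] show ?thesis by blast
qed

section \<open>Mollification\<close>

subsection \<open>Convolution with a smooth kernel\<close>

text \<open>The support condition is stated with the radius of the kernel, so that no scaling of a fixed
  kernel is needed.\<close>

definition mollifier :: "real \<Rightarrow> ('a::euclidean_space \<Rightarrow> real) \<Rightarrow> bool" where
  "mollifier e \<eta> \<longleftrightarrow> smooth \<eta> \<and> (\<forall>x. 0 \<le> \<eta> x) \<and> (\<forall>x. e < norm x \<longrightarrow> \<eta> x = 0) \<and>
     integrable lborel \<eta> \<and> (LINT x|lborel. \<eta> x) = 1"

lemma integrable_compact_support: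
  fixes u :: "'a::euclidean_space \<Rightarrow> real"
  assumes "continuous_on UNIV u" "compact K" "\<And>x. x \<notin> K \<Longrightarrow> u x = 0"
  shows "integrable lborel u"
proof -
  have "integrable (lebesgue_on K) u"
    using locally_integrable_continuous[OF assms(1)] assms(2) by (auto simp: locally_integrable_def)
  then have "integrable lebesgue u"
    using integrable_lebesgue_on_support[of K u] assms(2,3) by (simp add: lmeasurable_compact fmeasurableD)
  then show ?thesis using assms(1) by (simp add: integrable_completion borel_measurable_continuous_onI)
qed

lemma mollifier_exists:
  assumes e: "e > 0"
  obtains \<eta> :: "'a::euclidean_space \<Rightarrow> real" where "mollifier e \<eta>"
proof -
  \<comment> \<open>The cube with half-width \<open>d\<close> lies in the ball of radius \<open>e\<close>.\<close>
  define d where "d = e / real DIM('a)"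
  define Q where "Q = box (- d *\<^sub>R One) (d *\<^sub>R (One :: 'a))"
  define \<beta> :: "'a \<Rightarrow> real" where "\<beta> = box_bump (- d *\<^sub>R One) (d *\<^sub>R One)"
  have d: "d > 0" using e by (simp add: d_def)
  have small: "\<beta> x = 0" if "e < norm x" for x
  proof -
    have "x \<notin> Q"
    proof
      assume "x \<in> Q"
      then have "\<bar>x \<bullet> b\<bar> \<le> d" if "b \<in> Basis" for b using that unfolding Q_def mem_box
        by (auto simp: abs_le_iff)
      then have "norm x \<le> (\<Sum>b\<in>(Basis :: 'a set). d)"
        using order_trans[OF norm_le_l1[of x] sum_mono[of Basis "\<lambda>b. \<bar>x \<bullet> b\<bar>" "\<lambda>_. d"]] by blast
      then show False using that by (simp add: d_def)
    qed
    then show ?thesis unfolding \<beta>_def Q_def by (rule box_bump_zero)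
  qed
  have int: "integrable lborel \<beta>"
    by (rule integrable_compact_support[of _ "cball 0 e"])
       (use smooth_continuous smooth_box_bump small in \<open>auto simp: \<beta>_def\<close>)
  define I where "I = (LINT x|lborel. \<beta> x)"
  have nn: "\<beta> x \<ge> 0" for x unfolding \<beta>_def by (rule box_bump_nonneg)
  have "I \<noteq> 0"
  proof
    assume "I = 0"
    then have "AE x in lborel. \<beta> x = 0" 
      using integral_nonneg_eq_0_iff_AE[OF int] nn by (simp add: I_def)
    then have "AE x in lborel. x \<notin> Q"
      by eventually_elim (use box_bump_pos in \<open>force simp: \<beta>_def Q_def\<close>)
    then have "emeasure lborel Q = 0"
      using AE_iff_measurable[of Q lborel "\<lambda>x. x \<notin> Q"] by (simp add: Q_def)
    moreover have "emeasure lborel Q \<noteq> 0"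
      using d by (simp add: Q_def emeasure_lborel_box_eq inner_simps prod_zero_iff)
    ultimately show False by simp
  qed
  moreover have "I \<ge> 0" unfolding I_def by (rule integral_nonneg_AE) (use nn in auto)
  ultimately have I: "I > 0" by simp
  have "mollifier e (\<lambda>x. (1 / I) * \<beta> x)"
    unfolding mollifier_def
  proof (intro conjI allI)
    show "C_k k (\<lambda>x. (1 / I) * \<beta> x)" for k
      unfolding \<beta>_def by (intro C_k_cmult) (use smooth_box_bump in blast)
  qed (use I int nn small in \<open>auto simp: I_def[symmetric]\<close>)
  then show ?thesis using that by blast
qed

lemma mollifier_vanishes: "mollifier e \<eta> \<Longrightarrow> e < norm x \<Longrightarrow> \<eta> x = 0"
  by (simp add: mollifier_def)

lemma mollifier_smooth: "mollifier e \<eta> \<Longrightarrow> smooth \<eta>"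
  by (simp add: mollifier_def)

text \<open>Differentiation falls on the smooth kernel; the other factor is only continuous. Integration is
  over a box, as required by the Leibniz rule for the gauge integral.\<close>

lemma conv_has_derivative:
  fixes u :: "'a::euclidean_space \<Rightarrow> real"
  assumes u: "continuous_on (cbox a b) u" and \<eta>: "smooth \<eta>"
  shows "((\<lambda>x. integral (cbox a b) (\<lambda>y. u y * \<eta> (x - y))) has_derivative
     (\<lambda>h. integral (cbox a b) (\<lambda>y. u y * (grad \<eta> (x - y) \<bullet> h)))) (at x)"
proof -
  define D where "D x y = blinfun_inner_left (u y *\<^sub>R grad \<eta> (x - y))" for x y
  have cu: "continuous_on (UNIV \<times> cbox a b) (\<lambda>p. u (snd p))"
    by (rule continuous_on_compose2[OF u continuous_on_snd]) (auto intro: continuous_intros)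
  have cD: "continuous_on (UNIV \<times> cbox a b) (\<lambda>(x, y). D x y)"
    unfolding D_def split_beta
    by (intro continuous_intros cu continuous_on_compose2[OF continuous_grad[OF \<eta>]]) auto
  have c\<eta>: "continuous_on (cbox a b) (\<lambda>y. \<eta> (x - y))" for x
    by (intro continuous_on_compose2[OF smooth_continuous[OF \<eta>]] continuous_intros) auto
  have *: "((\<lambda>x. integral (cbox a b) (\<lambda>y. u y * \<eta> (x - y))) has_derivative
      blinfun_apply (integral (cbox a b) (D x))) (at x within UNIV)"
  proof (rule leibniz_rule[OF _ _ cD])
    show "((\<lambda>x. u y * \<eta> (x - y)) has_derivative blinfun_apply (D x y)) (at x within UNIV)" for x y
    proof -
      have "(\<eta> has_derivative (\<lambda>h. grad \<eta> (x - y) \<bullet> h)) (at (x - y))"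
        by (rule grad_has_derivative[OF smooth_differentiable[OF \<eta>]])
      moreover have "((\<lambda>x. x - y) has_derivative (\<lambda>h. h)) (at x)"
        by (auto intro!: derivative_eq_intros)
      ultimately have "((\<lambda>x. \<eta> (x - y)) has_derivative (\<lambda>h. grad \<eta> (x - y) \<bullet> h)) (at x)"
        using has_derivative_compose[of "\<lambda>x. x - y" _ x] by blast
      then have "((\<lambda>x. u y * \<eta> (x - y)) has_derivative (\<lambda>h. u y * (grad \<eta> (x - y) \<bullet> h))) (at x)"
        by (rule has_derivative_mult_right)
      then show ?thesis by (simp add: D_def inner_commute)
    qed
    show "(\<lambda>y. u y * \<eta> (x - y)) integrable_on cbox a b" for x
      by (intro integrable_continuous continuous_intros u c\<eta>)
  qed auto
  have iD: "D x integrable_on cbox a b"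
    unfolding D_def
    by (intro integrable_continuous continuous_intros u continuous_on_compose2[OF continuous_grad[OF \<eta>]]) auto
  have "blinfun_apply (integral (cbox a b) (D x)) h = integral (cbox a b) (\<lambda>y. u y * (grad \<eta> (x - y) \<bullet> h))" for h
    by (subst blinfun_apply_integral[OF iD]) (simp add: D_def inner_commute)
  then have "blinfun_apply (integral (cbox a b) (D x))
      = (\<lambda>h. integral (cbox a b) (\<lambda>y. u y * (grad \<eta> (x - y) \<bullet> h)))" by blast
  with * show ?thesis by simp
qed

lemma smooth_conv:
  fixes u :: "'a::euclidean_space \<Rightarrow> real"
  assumes u: "continuous_on (cbox a b) u" and \<eta>: "smooth \<eta>"
  shows "smooth (\<lambda>x. integral (cbox a b) (\<lambda>y. u y * \<eta> (x - y)))"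
proof
  fix k
  let ?S = "{(\<lambda>x. integral (cbox a b) (\<lambda>y. u y * \<eta> (x - y))) | \<eta>. smooth \<eta>}"
  show "C_k k (\<lambda>x. integral (cbox a b) (\<lambda>y. u y * \<eta> (x - y)))"
  proof (rule smooth_class[of _ ?S])
    fix v and c :: 'a assume "v \<in> ?S" and c: "c \<in> Basis"
    then obtain \<eta> where v: "v = (\<lambda>x. integral (cbox a b) (\<lambda>y. u y * \<eta> (x - y)))" and s: "smooth \<eta>"
      by blast
    have "(\<lambda>x. frechet_derivative v (at x) c)
      = (\<lambda>x. integral (cbox a b) (\<lambda>y. u y * frechet_derivative \<eta> (at (x - y)) c))"
      unfolding v frechet_derivative_eqI[OF conv_has_derivative[OF u s]] by (simp add: grad_inner_Basis[OF c])
    then show "(\<lambda>x. frechet_derivative v (at x) c) \<in> ?S"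
      using smooth_partial[OF s c]
      by (intro CollectI exI[of _ "\<lambda>x. frechet_derivative \<eta> (at x) c"]) simp
  next
    show "v differentiable at x" if "v \<in> ?S" for v x
      using that conv_has_derivative[OF u] unfolding differentiable_def by blast
  qed (use \<eta> in blast)
qed

lemma integral_lborel_reflect:
  fixes w :: "'a::euclidean_space \<Rightarrow> real"
  assumes "w \<in> borel_measurable borel"
  shows "(LINT y|lborel. w (x - y)) = (LINT y|lborel. w y)"
proof -
  have "lborel = distr lborel borel (\<lambda>y. x - y :: 'a)"
    using lborel_affine[of "-1" x] by (simp add: density_1)
  then have "(LINT y|lborel. w y) = (LINT y|distr lborel borel (\<lambda>y. x - y). w y)" by simp
  also have "\<dots> = (LINT y|lborel. w (x - y))" using assms by (intro integral_distr) auto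
  finally show ?thesis by simp
qed

definition mollify :: "('a::euclidean_space \<Rightarrow> real) \<Rightarrow> ('a \<Rightarrow> real) \<Rightarrow> 'a \<Rightarrow> real" where
  "mollify \<eta> u x = (LINT y|lborel. u (x - y) * \<eta> y)"

context
  fixes u \<eta> :: "'a::euclidean_space \<Rightarrow> real" and e :: real
  assumes u: "continuous_on UNIV u" and \<eta>: "mollifier e \<eta>"
begin

lemma mollify_integrable: "integrable lborel (\<lambda>y. u (x - y) * \<eta> y)"
  by (rule integrable_compact_support[of _ "cball 0 e"])
     (use mollifier_vanishes[OF \<eta>] in \<open>auto intro!: continuous_intros continuous_on_compose2[OF u]
         smooth_continuous[OF mollifier_smooth[OF \<eta>]]\<close>)

lemma mollify_eq_integral:
  assumes 0: "\<And>y. y \<notin> cbox a b \<Longrightarrow> u y * \<eta> (x - y) = 0"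
  shows "mollify \<eta> u x = integral (cbox a b) (\<lambda>y. u y * \<eta> (x - y))"
proof -
  have c: "continuous_on UNIV (\<lambda>y. u y * \<eta> (x - y))"
    by (intro continuous_intros u
        continuous_on_compose2[OF smooth_continuous[OF mollifier_smooth[OF \<eta>]]]) auto
  have "mollify \<eta> u x = (LINT y|lborel. u y * \<eta> (x - y))"
    unfolding mollify_def
    using integral_lborel_reflect[OF borel_measurable_continuous_onI[OF c], of x] by simp
  also have "\<dots> = integral UNIV (\<lambda>y. u y * \<eta> (x - y))"
    by (rule integral_lborel[symmetric], rule integrable_compact_support[OF c compact_cbox 0])
  also have "\<dots> = integral UNIV (\<lambda>y. if y \<in> cbox a b then u y * \<eta> (x - y) else 0)"
    by (rule arg_cong[where f = "integral UNIV"]) (use 0 in \<open>auto simp: fun_eq_iff\<close>)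
  also have "\<dots> = integral (cbox a b) (\<lambda>y. u y * \<eta> (x - y))"
    by (rule Henstock_Kurzweil_Integration.integral_restrict_UNIV)
  finally show ?thesis .
qed

lemma smooth_mollify:
  assumes K: "compact K" "\<And>x. x \<notin> K \<Longrightarrow> u x = 0"
  shows "smooth (mollify \<eta> u)"
proof -
  obtain a where a: "K \<subseteq> cbox (-a) a" using bounded_subset_cbox_symmetric[OF compact_imp_bounded[OF K(1)]] .
  have "u y * \<eta> (x - y) = 0" if "y \<notin> cbox (-a) a" for x y using that a K(2) by auto
  then have "mollify \<eta> u = (\<lambda>x. integral (cbox (-a) a) (\<lambda>y. u y * \<eta> (x - y)))"
    using mollify_eq_integral by blast
  then show ?thesis
    using smooth_conv[OF continuous_on_subset[OF u] mollifier_smooth[OF \<eta>]] by simp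
qed

lemma mollify_bound:
  assumes "\<And>y. norm y \<le> e \<Longrightarrow> \<bar>u (x - y) - c\<bar> \<le> C"
  shows "\<bar>mollify \<eta> u x - c\<bar> \<le> C"
proof -
  have i: "integrable lborel \<eta>" "(LINT y|lborel. \<eta> y) = 1" and nn: "\<eta> y \<ge> 0" for y
    using \<eta> by (auto simp: mollifier_def)
  have "mollify \<eta> u x - c = (LINT y|lborel. u (x - y) * \<eta> y - c * \<eta> y)"
    using mollify_integrable i unfolding mollify_def by simp
  also have "\<bar>\<dots>\<bar> \<le> (LINT y|lborel. C * \<eta> y)"
  proof (rule integral_abs_bound[THEN order_trans], rule integral_mono)
    show "integrable lborel (\<lambda>y. \<bar>u (x - y) * \<eta> y - c * \<eta> y\<bar>)"
      using mollify_integrable i by (intro integrable_abs Bochner_Integration.integrable_diff) auto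
    show "\<bar>u (x - y) * \<eta> y - c * \<eta> y\<bar> \<le> C * \<eta> y" for y
    proof (cases "norm y \<le> e")
      case True
      have "\<bar>u (x - y) * \<eta> y - c * \<eta> y\<bar> = \<bar>u (x - y) - c\<bar> * \<eta> y"
        by (simp add: left_diff_distrib[symmetric] abs_mult nn)
      then show ?thesis using assms[OF True] nn by (simp add: mult_right_mono)
    next
      case False
      then show ?thesis using \<eta> by (simp add: mollifier_def)
    qed
  qed (use i in auto)
  also have "\<dots> = C" using i by simp
  finally show ?thesis .
qed

lemma mollify_zero:
  assumes "\<And>y. norm y \<le> e \<Longrightarrow> u (x - y) = 0"
  shows "mollify \<eta> u x = 0"
  using mollify_bound[of x 0 0] assms by simp

lemma mollify_diff: "mollify \<eta> u x - mollify \<eta> u z = (LINT y|lborel. (u (x - y) - u (z - y)) * \<eta> y)"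
  unfolding mollify_def using mollify_integrable by (simp add: left_diff_distrib)

text \<open>Near a point where \<open>u\<close> is affine, mollification changes \<open>u\<close> only by a constant. Hence the
  gradients of mollified piecewise affine functions converge almost everywhere without any
  appeal to Lebesgue points.\<close>

lemma mollify_affine:
  assumes aff: "\<And>z. z \<in> ball x r \<Longrightarrow> u z = a \<bullet> z + c" and r: "e < r"
  shows "(mollify \<eta> u has_derivative (\<lambda>h. a \<bullet> h)) (at x)"
proof (rule has_derivative_transform_within_open[of "\<lambda>z. mollify \<eta> u x + a \<bullet> (z - x)" _ _ _ "ball x (r - e)"])
  show "((\<lambda>z. mollify \<eta> u x + a \<bullet> (z - x)) has_derivative (\<lambda>h. a \<bullet> h)) (at x)"
    by (auto intro!: derivative_eq_intros)
  fix z assume z: "z \<in> ball x (r - e)"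
  have "mollify \<eta> u z - mollify \<eta> u x = (LINT y|lborel. (a \<bullet> (z - x)) * \<eta> y)"
    unfolding mollify_diff
  proof (rule Bochner_Integration.integral_cong[OF refl])
    fix y
    show "(u (z - y) - u (x - y)) * \<eta> y = (a \<bullet> (z - x)) * \<eta> y"
    proof (cases "norm y \<le> e")
      case True
      have "dist x (z - y) \<le> dist x z + norm y"
        using norm_triangle_ineq[of "x - z" y] by (simp add: dist_norm algebra_simps)
      then have "z - y \<in> ball x r" "x - y \<in> ball x r" using True z r by (auto simp: dist_norm)
      then show ?thesis by (simp add: aff inner_diff_right)
    next
      case False
      then show ?thesis using \<eta> by (simp add: mollifier_def)
    qed
  qed
  also have "\<dots> = a \<bullet> (z - x)" using \<eta> by (simp add: mollifier_def)
  finally show "mollify \<eta> u x + a \<bullet> (z - x) = mollify \<eta> u z" by simp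
qed (use r in auto)

lemma mollify_lipschitz:
  assumes L: "L-lipschitz_on UNIV u"
  shows "L-lipschitz_on UNIV (mollify \<eta> u)"
proof (rule lipschitz_onI)
  fix x z :: 'a
  have i: "integrable lborel \<eta>" "(LINT y|lborel. \<eta> y) = 1" and nn: "\<eta> y \<ge> 0" for y
    using \<eta> by (auto simp: mollifier_def)
  have "\<bar>mollify \<eta> u x - mollify \<eta> u z\<bar> \<le> (LINT y|lborel. (L * dist x z) * \<eta> y)"
    unfolding mollify_diff
  proof (rule integral_abs_bound[THEN order_trans], rule integral_mono)
    show "integrable lborel (\<lambda>y. \<bar>(u (x - y) - u (z - y)) * \<eta> y\<bar>)"
      using Bochner_Integration.integrable_diff[OF mollify_integrable[of x] mollify_integrable[of z]]
      by (simp add: left_diff_distrib)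
    show "\<bar>(u (x - y) - u (z - y)) * \<eta> y\<bar> \<le> L * dist x z * \<eta> y" for y
      using lipschitz_onD[OF L, of "x - y" "z - y"] nn[of y]
      by (auto simp: abs_mult dist_norm intro!: mult_right_mono)
  qed (use i in auto)
  then show "dist (mollify \<eta> u x) (mollify \<eta> u z) \<le> L * dist x z" using i by (simp add: dist_real_def)
qed (use lipschitz_on_nonneg[OF L] in auto)

end

subsection \<open>Functions with a bounded weak partial derivative\<close>

text \<open>The partial derivative of the mollification of \<open>u\<close> at a point is the weak derivative \<open>v\<close> tested with the
  reflected kernel, hence bounded by \<open>\<theta>\<close>; the mean value theorem along the segment and
  convergence at its two end points give the claim. The lemma serves twice: for
  the nonlinearity \<open>f\<close> it gives a Lipschitz bound in the first variable, and with
  \<open>\<theta> = 0\<close> in one dimension it is the lemma of du Bois-Reymond.\<close>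

lemma weak_partial_bounded_imp_lipschitz:
  fixes u v :: "'a::euclidean_space \<Rightarrow> real"
  assumes U: "open U" "cbox a b \<subseteq> U" and u: "continuous_on U u"
    and i: "i \<in> Basis" and weak: "has_weak_partial U i u v"
    and v: "AE x in lebesgue_on U. \<bar>v x\<bar> \<le> \<theta>"
    and x: "x \<in> box a b" "x + s *\<^sub>R i \<in> box a b"
  shows "\<bar>u (x + s *\<^sub>R i) - u x\<bar> \<le> \<theta> * \<bar>s\<bar>"
proof -
  have U': "U \<in> sets lebesgue" using U by auto
  have uc: "continuous_on (cbox a b) u" using u U continuous_on_subset by blast
  \<comment> \<open>A continuous function on the whole space that agrees with \<open>u\<close> on the box.\<close>
  define w where "w = ext_cont u a b"
  have w: "continuous_on UNIV w" unfolding w_def using uc by (rule continuous_on_ext_cont)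
  have wu: "w y = u y" if "y \<in> cbox a b" for y using that by (simp add: w_def)
  have seg: "closed_segment x (x + s *\<^sub>R i) \<subseteq> box a b"
    using x convex_box by (intro closed_segment_subset) auto
  obtain e0 where e0: "e0 > 0" "(\<Union>z\<in>closed_segment x (x + s *\<^sub>R i). cball z e0) \<subseteq> box a b"
    using compact_subset_open_imp_cball_epsilon_subset[OF compact_segment open_box seg] by metis
  have est: "\<bar>u (x + s *\<^sub>R i) - u x\<bar> \<le> \<theta> * \<bar>s\<bar> + 2 * r" if r: "r > 0" for r
  proof -
    have "isCont w x" "isCont w (x + s *\<^sub>R i)"
      using w by (auto simp: continuous_on_eq_continuous_at)
    then obtain d1 d2 where d: "d1 > 0" "\<And>y. dist y x < d1 \<Longrightarrow> dist (w y) (w x) < r"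
      "d2 > 0" "\<And>y. dist y (x + s *\<^sub>R i) < d2 \<Longrightarrow> dist (w y) (w (x + s *\<^sub>R i)) < r"
      unfolding continuous_at_eps_delta dist_norm using r by (metis (no_types, lifting))
    define e where "e = min e0 (min d1 d2 / 2)"
    have e: "e > 0" "e \<le> e0" "e < d1" "e < d2" using e0 d by (auto simp: e_def)
    obtain \<eta> :: "'a \<Rightarrow> real" where \<eta>: "mollifier e \<eta>" using mollifier_exists[OF e(1)] .
    note sm = mollifier_smooth[OF \<eta>]
    define F where "F z = integral (cbox a b) (\<lambda>y. w y * \<eta> (z - y))" for z
    have F_eq: "F z = mollify \<eta> w z"
      and F_der: "\<exists>D. (F has_derivative D) (at z) \<and> \<bar>D i\<bar> \<le> \<theta>"
      if z: "z \<in> closed_segment x (x + s *\<^sub>R i)" for z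
    proof -
      have "cball z e \<subseteq> cball z e0" using e by (simp add: subset_cball)
      then have ball: "cball z e \<subseteq> box a b" using z e0(2) by blast
      have supp: "\<eta> (z - y) = 0" if "y \<notin> cball z e" for y
        using that mollifier_vanishes[OF \<eta>] by (simp add: dist_norm)
      have supp_cbox: "\<eta> (z - y) = 0" if "y \<notin> cbox a b" for y
        using supp that ball box_subset_cbox by blast
      have bU: "cball z e \<subseteq> U" using ball box_subset_cbox U by blast
      show "F z = mollify \<eta> w z"
        unfolding F_def
        by (rule mollify_eq_integral[OF w \<eta>, symmetric]) (simp add: supp_cbox)
      define \<phi> where "\<phi> y = \<eta> (z - y)" for y
      have \<phi>: "test_function U \<phi>"
        unfolding test_function_def \<phi>_def[abs_def]
        using C_k_reflect sm supp bU by (intro conjI exI[of _ "cball z e"]) auto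
      have d\<phi>: "frechet_derivative \<phi> (at y) i = - (grad \<eta> (z - y) \<bullet> i)" for y
        unfolding \<phi>_def[abs_def] grad_inner_Basis[OF i]
        by (rule frechet_derivative_reflect[OF smooth_differentiable[OF sm]])
      have supp': "grad \<eta> (z - y) \<bullet> i = 0" if "y \<notin> cball z e" for y
        using grad_zero_outside[of "cball z e" \<phi> y] that supp d\<phi>[of y] grad_inner_Basis[OF i, of \<phi> y]
        by (simp add: \<phi>_def)
      define D where "D h = integral (cbox a b) (\<lambda>y. w y * (grad \<eta> (z - y) \<bullet> h))" for h
      have "(F has_derivative D) (at z)"
        unfolding F_def[abs_def] D_def[abs_def]
        using w continuous_on_subset by (intro conv_has_derivative sm) blast
      moreover have "D i = (LINT y|lebesgue_on U. v y * \<phi> y)"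
      proof -
        have c: "continuous_on UNIV (\<lambda>y. w y * (grad \<eta> (z - y) \<bullet> i))"
          by (intro continuous_intros w continuous_on_compose2[OF continuous_grad[OF sm]]) auto
        have "integrable (lebesgue_on (cbox a b)) (\<lambda>y. w y * (grad \<eta> (z - y) \<bullet> i))"
          using locally_integrable_continuous[OF c] by (simp add: locally_integrable_def)
        then have "D i = (LINT y|lebesgue_on (cbox a b). w y * (grad \<eta> (z - y) \<bullet> i))"
          unfolding D_def by (simp add: lebesgue_integral_eq_integral)
        also have "\<dots> = (LINT y|lebesgue. w y * (grad \<eta> (z - y) \<bullet> i))"
        proof (rule integral_lebesgue_on_support)
          fix y assume "y \<notin> cbox a b"
          then have "y \<notin> cball z e" using ball box_subset_cbox by blast
          then show "w y * (grad \<eta> (z - y) \<bullet> i) = 0" using supp' by simp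
        qed simp
        also have "\<dots> = (LINT y|lebesgue. - (u y * frechet_derivative \<phi> (at y) i))"
        proof (rule Bochner_Integration.integral_cong[OF refl])
          fix y
          show "w y * (grad \<eta> (z - y) \<bullet> i) = - (u y * frechet_derivative \<phi> (at y) i)"
            using wu[of y] supp'[of y] ball box_subset_cbox[of a b]
            by (cases "y \<in> cball z e") (auto simp: d\<phi> subset_iff)
        qed
        also have "\<dots> = - (LINT y|lebesgue. u y * frechet_derivative \<phi> (at y) i)" by simp
        also have "(LINT y|lebesgue. u y * frechet_derivative \<phi> (at y) i)
            = (LINT y|lebesgue_on U. u y * frechet_derivative \<phi> (at y) i)"
          by (rule integral_lebesgue_on_support[OF U', symmetric])
             (use supp' bU in \<open>auto simp: d\<phi> subset_iff\<close>)
        also have "- \<dots> = (LINT y|lebesgue_on U. v y * \<phi> y)"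
          using weak \<phi> unfolding has_weak_partial_def by simp
        finally show ?thesis .
      qed
      moreover have "\<bar>LINT y|lebesgue_on U. v y * \<phi> y\<bar> \<le> \<theta>"
      proof -
        have iv: "integrable (lebesgue_on U) (\<lambda>y. v y * \<phi> y)"
          using weak by (intro integrable_times_test[OF _ U(1) \<phi>]) (simp add: has_weak_partial_def)
        have "locally_integrable U (\<lambda>x. \<theta>)" by (intro locally_integrable_continuous continuous_intros)
        then have i\<theta>: "integrable (lebesgue_on U) (\<lambda>y. \<theta> * \<phi> y)" by (rule integrable_times_test[OF _ U(1) \<phi>])
        have nn: "\<phi> y \<ge> 0" for y using \<eta> by (simp add: mollifier_def \<phi>_def)
        have "\<bar>LINT y|lebesgue_on U. v y * \<phi> y\<bar> \<le> (LINT y|lebesgue_on U. \<bar>v y * \<phi> y\<bar>)"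
          by (rule integral_abs_bound)
        also have "\<dots> \<le> (LINT y|lebesgue_on U. \<theta> * \<phi> y)"
        proof (rule integral_mono_AE)
          show "AE y in lebesgue_on U. \<bar>v y * \<phi> y\<bar> \<le> \<theta> * \<phi> y"
            using v by eventually_elim (auto simp: abs_mult nn mult_right_mono)
        qed (use iv i\<theta> in auto)
        also have "\<dots> = (LINT y|lebesgue. \<theta> * \<phi> y)"
          by (rule integral_lebesgue_on_support[OF U']) (use supp bU in \<open>auto simp: \<phi>_def subset_iff\<close>)
        also have "\<dots> = (LINT y|lborel. \<theta> * \<phi> y)"
        proof (rule integral_completion)
          have "continuous_on UNIV (\<lambda>y. \<theta> * \<phi> y)"
            using \<phi> unfolding test_function_def by (intro continuous_intros smooth_continuous) blast
          then show "(\<lambda>y. \<theta> * \<phi> y) \<in> borel_measurable lborel"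
            by (simp add: borel_measurable_continuous_onI)
        qed
        also have "\<dots> = \<theta> * (LINT y|lborel. \<eta> y)"
          unfolding \<phi>_def using integral_lborel_reflect[of \<eta> z]
            borel_measurable_continuous_onI[OF smooth_continuous[OF sm]] by simp
        also have "\<dots> = \<theta>" using \<eta> by (simp add: mollifier_def)
        finally show ?thesis .
      qed
      ultimately show "\<exists>D. (F has_derivative D) (at z) \<and> \<bar>D i\<bar> \<le> \<theta>" by auto
    qed
    have in_seg: "x + (t * s) *\<^sub>R i \<in> closed_segment x (x + s *\<^sub>R i)" if "t \<in> {0..1}" for t
      using that unfolding closed_segment_def
      by (intro CollectI exI[of _ t]) (auto simp: algebra_simps)
    have "\<exists>D. ((\<lambda>t. F (x + (t * s) *\<^sub>R i)) has_real_derivative D) (at t within {0..1}) \<and> \<bar>D\<bar> \<le> \<theta> * \<bar>s\<bar>"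
      if t: "t \<in> {0..1}" for t
    proof -
      obtain D where D: "(F has_derivative D) (at (x + (t * s) *\<^sub>R i))" "\<bar>D i\<bar> \<le> \<theta>"
        using F_der[OF in_seg[OF t]] by blast
      have "((\<lambda>t. x + (t * s) *\<^sub>R i) has_derivative (\<lambda>t. (t * s) *\<^sub>R i)) (at t)"
        by (auto intro!: derivative_eq_intros)
      from has_derivative_compose[OF this D(1)]
      have "((\<lambda>t. F (x + (t * s) *\<^sub>R i)) has_derivative (\<lambda>t. D ((t * s) *\<^sub>R i))) (at t)" .
      then have "((\<lambda>t. F (x + (t * s) *\<^sub>R i)) has_real_derivative (s * D i)) (at t)"
        using linear_scale[OF has_derivative_linear[OF D(1)]]
        by (simp add: has_field_derivative_def mult.assoc mult_commute_abs)
      moreover have "\<bar>s * D i\<bar> \<le> \<theta> * \<bar>s\<bar>"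
        using mult_left_mono[OF D(2), of "\<bar>s\<bar>"] by (simp add: abs_mult mult.commute)
      ultimately show ?thesis using has_field_derivative_at_within by blast
    qed
    then obtain D where D: "\<And>t. t \<in> {0..1} \<Longrightarrow>
        ((\<lambda>t. F (x + (t * s) *\<^sub>R i)) has_real_derivative D t) (at t within {0..1})"
      "\<And>t. t \<in> {0..1} \<Longrightarrow> \<bar>D t\<bar> \<le> \<theta> * \<bar>s\<bar>"
      by metis
    have "norm (F (x + (1 * s) *\<^sub>R i) - F (x + (0 * s) *\<^sub>R i)) \<le> (\<theta> * \<bar>s\<bar>) * norm (1 - (0::real))"
      by (rule field_differentiable_bound[of "{0..1}", OF _ D(1)]) (use D(2) in auto)
    then have "\<bar>mollify \<eta> w (x + s *\<^sub>R i) - mollify \<eta> w x\<bar> \<le> \<theta> * \<bar>s\<bar>"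
      using F_eq[of x] F_eq[of "x + s *\<^sub>R i"] by simp
    moreover have "\<bar>mollify \<eta> w x - w x\<bar> \<le> r"
    proof (rule mollify_bound[OF w \<eta>])
      fix y :: 'a assume "norm y \<le> e"
      then show "\<bar>w (x - y) - w x\<bar> \<le> r" using d(2)[of "x - y"] e(3) by (simp add: dist_norm)
    qed
    moreover have "\<bar>mollify \<eta> w (x + s *\<^sub>R i) - w (x + s *\<^sub>R i)\<bar> \<le> r"
    proof (rule mollify_bound[OF w \<eta>])
      fix y :: 'a assume "norm y \<le> e"
      then show "\<bar>w (x + s *\<^sub>R i - y) - w (x + s *\<^sub>R i)\<bar> \<le> r"
        using d(4)[of "x + s *\<^sub>R i - y"] e(4) by (simp add: dist_norm)
    qed
    moreover have "w x = u x" "w (x + s *\<^sub>R i) = u (x + s *\<^sub>R i)"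
      using x box_subset_cbox by (auto intro!: wu)
    ultimately show ?thesis by linarith
  qed
  show ?thesis
  proof (rule field_le_epsilon)
    fix r :: real assume "r > 0"
    then show "\<bar>u (x + s *\<^sub>R i) - u x\<bar> \<le> \<theta> * \<bar>s\<bar> + r" using est[of "r / 2"] by simp
  qed
qed

subsection \<open>Approximation by test functions\<close>

text \<open>A function vanishing outside a convex domain is first compressed towards an interior point
  \<open>x0\<close> by the factor \<open>1 + \<delta>\<close>, which moves its support into the interior, and then mollified with a radius
  that is small compared with the remaining distance to the boundary. The result is a test function that differs
  little from \<open>u\<close> and whose gradient is \<open>1 + \<delta>\<close> times that of \<open>u\<close> wherever \<open>u\<close> is affine in
  a sufficiently large ball.\<close>

lemma dilated_mollification:
  fixes u :: "'a::euclidean_space \<Rightarrow> real"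
  assumes U: "open U" "convex U" "bounded U" "x0 \<in> U"
    and L: "L-lipschitz_on UNIV u" and zero: "\<And>x. x \<notin> U \<Longrightarrow> u x = 0"
    and \<delta>: "0 < \<delta>" "\<delta> \<le> 1"
  obtains \<phi> where "test_function U \<phi>" "\<And>x. \<bar>\<phi> x - u x\<bar> \<le> L * \<delta> * (2 + dist x0 x)"
    "(2 * L)-lipschitz_on UNIV \<phi>"
    "\<And>x a c r. (\<And>z. z \<in> ball x r \<Longrightarrow> u z = a \<bullet> z + c) \<Longrightarrow> \<delta> * (2 + dist x0 x) < r \<Longrightarrow>
       (\<phi> has_derivative (\<lambda>h. ((1 + \<delta>) *\<^sub>R a) \<bullet> h)) (at x)"
proof -
  have L0: "L \<ge> 0" using lipschitz_on_nonneg[OF L] .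
  define k where "k = 1 + \<delta>"
  define v where "v x = u (x0 + k *\<^sub>R (x - x0))" for x
  define K where "K = (\<lambda>y. x0 + (1 / k) *\<^sub>R (y - x0)) ` closure U"
  have k: "1 < k" "k \<le> 2" using \<delta> by (auto simp: k_def)
  have K: "compact K" unfolding K_def
    using U by (intro compact_continuous_image continuous_intros) auto
  have KU: "K \<subseteq> U"
  proof
    fix z assume "z \<in> K"
    then obtain y where y: "y \<in> closure U" "z = x0 + (1 / k) *\<^sub>R (y - x0)" by (auto simp: K_def)
    have "y - (1 - 1 / k) *\<^sub>R (y - x0) \<in> interior U"
      by (rule mem_interior_closure_convex_shrink) (use U y k in \<open>auto simp: interior_open\<close>)
    moreover have "y - (1 - 1 / k) *\<^sub>R (y - x0) = z" unfolding y by (simp add: algebra_simps)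
    ultimately show "z \<in> U" using U by (simp add: interior_open)
  qed
  have vK: "v z = 0" if "z \<notin> K" for z
  proof (rule ccontr)
    assume "v z \<noteq> 0"
    then have "x0 + k *\<^sub>R (z - x0) \<in> closure U" using zero closure_subset by (fastforce simp: v_def)
    moreover have "z = x0 + (1 / k) *\<^sub>R ((x0 + k *\<^sub>R (z - x0)) - x0)" using k by simp
    ultimately show False using that unfolding K_def by blast
  qed
  have dk: "dist (x0 + k *\<^sub>R (x - x0)) (x0 + k *\<^sub>R (z - x0)) = k * dist x z" for x z
  proof -
    have "(x0 + k *\<^sub>R (x - x0)) - (x0 + k *\<^sub>R (z - x0)) = k *\<^sub>R (x - z)" by (simp add: algebra_simps)
    then show ?thesis using k by (simp add: dist_norm)
  qed
  have vlip: "(2 * L)-lipschitz_on UNIV v"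
  proof (rule lipschitz_onI)
    fix x z
    have "dist (v x) (v z) \<le> L * (k * dist x z)"
      unfolding v_def dk[symmetric] by (rule lipschitz_onD[OF L]) auto
    also have "\<dots> \<le> L * (2 * dist x z)" using L0 k by (intro mult_left_mono mult_right_mono) auto
    finally show "dist (v x) (v z) \<le> 2 * L * dist x z" by simp
  qed (use L0 in auto)
  have vc: "continuous_on UNIV v" using lipschitz_on_continuous_on[OF vlip] .
  obtain e0 where e0: "e0 > 0" "(\<Union>x\<in>K. cball x e0) \<subseteq> U"
    using compact_subset_open_imp_cball_epsilon_subset[OF K U(1) KU] by metis
  define e where "e = min e0 \<delta> / 2"
  have e: "e > 0" "e \<le> e0" "2 * e \<le> \<delta>" using e0 \<delta> by (auto simp: e_def)
  obtain \<eta> :: "'a \<Rightarrow> real" where \<eta>: "mollifier e \<eta>" using mollifier_exists[OF e(1)] .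
  define \<phi> where "\<phi> = mollify \<eta> v"
  show ?thesis
  proof (rule that[of \<phi>])
    show "test_function U \<phi>"
      unfolding test_function_def
    proof (intro conjI exI[of _ "\<Union>x\<in>K. \<Union>y\<in>cball 0 e. {x + y}"])
      show "smooth \<phi>" unfolding \<phi>_def using smooth_mollify[OF vc \<eta> K vK] .
      show "compact (\<Union>x\<in>K. \<Union>y\<in>cball 0 e. {x + y})" by (intro compact_sums' K compact_cball)
      have "x + y \<in> U" if "x \<in> K" "norm y \<le> e" for x y
      proof -
        have "x + y \<in> cball x e0" using that(2) e by (simp add: dist_norm)
        then show ?thesis using that(1) e0(2) by blast
      qed
      then show "(\<Union>x\<in>K. \<Union>y\<in>cball 0 e. {x + y}) \<subseteq> U" by auto
      show "\<forall>x. x \<notin> (\<Union>x\<in>K. \<Union>y\<in>cball 0 e. {x + y}) \<longrightarrow> \<phi> x = 0"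
      proof (intro allI impI)
        fix x assume x: "x \<notin> (\<Union>x\<in>K. \<Union>y\<in>cball 0 e. {x + y})"
        have "x - y \<notin> K" if "norm y \<le> e" for y using x that by force
        then show "\<phi> x = 0" unfolding \<phi>_def using vK by (intro mollify_zero[OF vc \<eta>]) blast
      qed
    qed
    show "(2 * L)-lipschitz_on UNIV \<phi>" unfolding \<phi>_def by (rule mollify_lipschitz[OF vc \<eta> vlip])
    have disp: "dist (x0 + k *\<^sub>R (z - x0)) x \<le> 2 * dist z x + \<delta> * dist x0 x" for x z
    proof -
      have "(x0 + k *\<^sub>R (z - x0)) - x = k *\<^sub>R (z - x) + \<delta> *\<^sub>R (x - x0)" by (simp add: k_def algebra_simps)
      then have "dist (x0 + k *\<^sub>R (z - x0)) x \<le> norm (k *\<^sub>R (z - x)) + norm (\<delta> *\<^sub>R (x - x0))"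
        unfolding dist_norm by (metis norm_triangle_ineq)
      also have "\<dots> \<le> 2 * dist z x + \<delta> * dist x0 x"
        using k \<delta> by (auto simp: dist_norm norm_minus_commute intro!: mult_right_mono)
      finally show ?thesis .
    qed
    show "\<bar>\<phi> x - u x\<bar> \<le> L * \<delta> * (2 + dist x0 x)" for x
      unfolding \<phi>_def
    proof (rule mollify_bound[OF vc \<eta>])
      fix y :: 'a assume y: "norm y \<le> e"
      have "\<bar>v (x - y) - u x\<bar> \<le> L * dist (x0 + k *\<^sub>R (x - y - x0)) x"
        using lipschitz_onD[OF L, of "x0 + k *\<^sub>R (x - y - x0)" x] by (simp add: v_def dist_real_def)
      also have "\<dots> \<le> L * (2 * dist (x - y) x + \<delta> * dist x0 x)"
        by (intro mult_left_mono disp L0)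
      also have "\<dots> \<le> L * (\<delta> * 2 + \<delta> * dist x0 x)"
        using y e \<delta> by (intro mult_left_mono L0) (simp add: dist_norm)
      finally show "\<bar>v (x - y) - u x\<bar> \<le> L * \<delta> * (2 + dist x0 x)" by (simp add: algebra_simps)
    qed
    fix x a c r
    assume aff: "\<And>z. z \<in> ball x r \<Longrightarrow> u z = a \<bullet> z + c" and r: "\<delta> * (2 + dist x0 x) < r"
    show "(\<phi> has_derivative (\<lambda>h. ((1 + \<delta>) *\<^sub>R a) \<bullet> h)) (at x)"
      unfolding \<phi>_def
    proof (rule mollify_affine[OF vc \<eta>])
      show "e < \<delta>" using e by simp
      fix z assume z: "z \<in> ball x \<delta>"
      have "dist (x0 + k *\<^sub>R (z - x0)) x < r"
        using disp[of z x] z r by (simp add: dist_commute algebra_simps)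
      then have "v z = a \<bullet> (x0 + k *\<^sub>R (z - x0)) + c" unfolding v_def by (intro aff) (simp add: dist_commute)
      then show "v z = ((1 + \<delta>) *\<^sub>R a) \<bullet> z + (a \<bullet> (x0 - k *\<^sub>R x0) + c)"
        by (simp add: k_def algebra_simps inner_add_right inner_diff_right)
    qed
  qed
qed

text \<open>Completeness of Lebesgue measure is what makes the arbitrarily chosen \<open>weak_grad\<close> measurable.\<close>

lemma borel_measurable_lebesgue_on_AE:
  fixes f :: "'a::euclidean_space \<Rightarrow> 'b::euclidean_space"
  assumes S: "S \<in> sets lebesgue" and g: "g \<in> borel_measurable (lebesgue_on S)"
    and ae: "AE x in lebesgue_on S. f x = g x"
  shows "f \<in> borel_measurable (lebesgue_on S)"
proof -
  have S': "S \<inter> space lebesgue \<in> sets lebesgue" using S by simp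
  have "(\<lambda>x. indicator S x *\<^sub>R g x) \<in> borel_measurable lebesgue"
    using g borel_measurable_restrict_space_iff[OF S'] by blast
  moreover have "AE x in lebesgue. indicator S x *\<^sub>R g x = indicator S x *\<^sub>R f x"
    using ae unfolding AE_restrict_space_iff[OF S'] by eventually_elim (auto simp: indicator_def)
  ultimately have "(\<lambda>x. indicator S x *\<^sub>R f x) \<in> borel_measurable lebesgue"
    by (rule borel_measurable_AE)
  then show ?thesis using borel_measurable_restrict_space_iff[OF S'] by blast
qed

lemma integral_lebesgue_on_cong_AE:
  fixes f g :: "'a::euclidean_space \<Rightarrow> real"
  assumes S: "S \<in> sets lebesgue" and g: "g \<in> borel_measurable (lebesgue_on S)"
    and ae: "AE x in lebesgue_on S. f x = g x"
  shows "(LINT x|lebesgue_on S. f x) = (LINT x|lebesgue_on S. g x)"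
  using integral_cong_AE[OF borel_measurable_lebesgue_on_AE[OF S g ae] g ae] .

lemma integrable_bounded_lebesgue_on:
  fixes u :: "'a::euclidean_space \<Rightarrow> 'b::{banach,second_countable_topology}"
  assumes "open U" "bounded U" "u \<in> borel_measurable (lebesgue_on U)"
    "AE x in lebesgue_on U. norm (u x) \<le> C"
  shows "integrable (lebesgue_on U) u"
proof -
  have "U \<in> lmeasurable" using assms(1,2) by (simp add: lmeasurable_open)
  then have "finite_measure (lebesgue_on U)" by (rule finite_measure_lebesgue_on)
  from finite_measure.integrable_const_bound[OF this assms(4,3)] show ?thesis .
qed

lemma weak_grad_integrals:
  fixes U :: "'a::euclidean_space set"
  assumes U: "open U" and u: "has_weak_gradient U u G" "G \<in> borel_measurable (lebesgue_on U)"
  shows "(LINT x|lebesgue_on U. (norm (weak_grad U u x))\<^sup>2) = (LINT x|lebesgue_on U. (norm (G x))\<^sup>2)"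
  by (rule integral_lebesgue_on_cong_AE) (use AE_weak_grad[OF U u(1)] U u(2) in auto)

lemma H1I:
  assumes U: "open U" "bounded U" and L: "L-lipschitz_on U u" and G: "has_weak_gradient U u G"
    "G \<in> borel_measurable (lebesgue_on U)" "AE x in lebesgue_on U. norm (G x) \<le> C"
  shows "u \<in> H1 U"
proof -
  have c: "continuous_on U u" using L by (rule lipschitz_on_continuous_on)
  have m: "u \<in> borel_measurable (lebesgue_on U)"
    using U by (intro continuous_imp_measurable_on_sets_lebesgue c) auto
  have "bounded (u ` U)" using lipschitz_on_uniformly_continuous[OF L] U(2)
    by (rule bounded_uniformly_continuous_image)
  then obtain M where M: "\<And>x. x \<in> U \<Longrightarrow> \<bar>u x\<bar> \<le> M" by (auto simp: bounded_iff)
  have "integrable (lebesgue_on U) (\<lambda>x. (norm (u x))\<^sup>2)"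
  proof (rule integrable_bounded_lebesgue_on[OF U])
    show "AE x in lebesgue_on U. norm ((norm (u x))\<^sup>2) \<le> M\<^sup>2"
      using M by (intro AE_I2) (auto simp: abs_le_square_iff[symmetric] intro!: order_trans[OF M abs_ge_self])
  qed (use m in measurable)
  moreover have "integrable (lebesgue_on U) (\<lambda>x. (norm (G x))\<^sup>2)"
  proof (rule integrable_bounded_lebesgue_on[OF U])
    show "AE x in lebesgue_on U. norm ((norm (G x))\<^sup>2) \<le> C\<^sup>2"
      using G(3) by eventually_elim (simp add: power_mono)
  qed (use G(2) in measurable)
  ultimately show ?thesis using G m by (auto simp: H1_def L2_def)
qed

text \<open>The dilated mollifications with \<open>\<delta> = 1 / (n + 1)\<close> converge to \<open>u\<close> uniformly, and their gradients converge
  almost everywhere and are uniformly bounded; dominated convergence gives convergence in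
  \<open>H1_norm\<close>.\<close>

lemma H10_if_locally_affine:
  fixes u :: "'a::euclidean_space \<Rightarrow> real"
  assumes U: "open U" "convex U" "bounded U" "U \<noteq> {}"
    and L: "L-lipschitz_on UNIV u" and zero: "\<And>x. x \<notin> U \<Longrightarrow> u x = 0"
    and aff: "AE x in lebesgue_on U. \<exists>r>0. \<exists>a c. \<forall>z\<in>ball x r. u z = a \<bullet> z + c"
  shows "u \<in> H10 U"
proof -
  have U': "U \<in> sets lebesgue" using U by auto
  have L0: "L \<ge> 0" using lipschitz_on_nonneg[OF L] .
  obtain x0 where x0: "x0 \<in> U" using U by blast
  have aff_der: "(u has_derivative (\<lambda>h. a \<bullet> h)) (at x)"
    if "r > 0" "\<forall>z\<in>ball x r. u z = a \<bullet> z + c" for r x a c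
  proof (rule has_derivative_transform_within_open[of "\<lambda>z. a \<bullet> z + c" _ _ _ "ball x r"])
    show "((\<lambda>z. a \<bullet> z + c) has_derivative (\<lambda>h. a \<bullet> h)) (at x)" by (auto intro!: derivative_eq_intros)
  qed (use that in auto)
  have LU: "L-lipschitz_on U u" using L by (rule lipschitz_on_subset) simp
  have "AE x in lebesgue_on U. u differentiable at x"
    using aff by eventually_elim (use aff_der in \<open>unfold differentiable_def, blast\<close>)
  from lipschitz_weak_gradient_exists[OF U(1) LU this] obtain G where
    G: "G \<in> borel_measurable (lebesgue_on U)" "has_weak_gradient U u G"
    "AE x in lebesgue_on U. (u has_derivative (\<lambda>h. G x \<bullet> h)) (at x)"
    "AE x in lebesgue_on U. norm (G x) \<le> L" by blast
  have uH1: "u \<in> H1 U" using H1I[OF U(1,3) LU G(2,1,4)] .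
  define \<delta> where "\<delta> n = 1 / real (Suc n)" for n
  have \<delta>: "0 < \<delta> n" "\<delta> n \<le> 1" for n by (auto simp: \<delta>_def)
  have \<delta>lim: "\<delta> \<longlonglongrightarrow> 0" unfolding \<delta>_def by (rule lim_const_over_n[THEN LIMSEQ_Suc])
  define P where "P n \<phi> \<longleftrightarrow> test_function U \<phi> \<and>
    (\<forall>x. \<bar>\<phi> x - u x\<bar> \<le> L * \<delta> n * (2 + dist x0 x)) \<and> (2 * L)-lipschitz_on UNIV \<phi> \<and>
    (\<forall>x a c r. (\<forall>z \<in> ball x r. u z = a \<bullet> z + c) \<longrightarrow> \<delta> n * (2 + dist x0 x) < r \<longrightarrow>
       (\<phi> has_derivative (\<lambda>h. ((1 + \<delta> n) *\<^sub>R a) \<bullet> h)) (at x))" for n \<phi>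
  have "\<exists>\<phi>. P n \<phi>" for n
    unfolding P_def by (rule dilated_mollification[OF U(1-3) x0 L zero \<delta>], assumption) blast
  then obtain \<phi> where P: "\<And>n. P n (\<phi> n)" by metis
  have test: "test_function U (\<phi> n)" and lip: "(2 * L)-lipschitz_on UNIV (\<phi> n)"
    and near: "\<bar>\<phi> n x - u x\<bar> \<le> L * \<delta> n * (2 + dist x0 x)" for n x
    using P unfolding P_def by blast+
  have der: "(\<phi> n has_derivative (\<lambda>h. ((1 + \<delta> n) *\<^sub>R a) \<bullet> h)) (at x)"
    if "\<forall>z \<in> ball x r. u z = a \<bullet> z + c" "\<delta> n * (2 + dist x0 x) < r" for n x a c r
    using P that unfolding P_def by blast
  have sm: "smooth (\<phi> n)" for n using test by (simp add: test_function_def)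
  define g where "g n = grad (\<phi> n)" for n
  have gd: "(\<phi> n has_derivative (\<lambda>h. g n x \<bullet> h)) (at x)" for n x
    unfolding g_def by (rule grad_has_derivative[OF smooth_differentiable[OF sm]])
  have gm: "g n \<in> borel_measurable (lebesgue_on U)" for n
    unfolding g_def by (rule borel_measurable_lebesgue_onI[OF continuous_grad[OF sm]])
  have gb: "norm (g n x) \<le> 2 * L" for n x
    using gradient_le_lipschitz[OF open_UNIV _ lip gd] by simp
  have wg: "has_weak_gradient U (\<phi> n) (g n)" for n
    by (rule lipschitz_has_weak_gradient[OF U(1) lipschitz_on_subset[OF lip] gm]) (use gd in auto)
  have glim: "AE x in lebesgue_on U. (\<lambda>n. g n x) \<longlonglongrightarrow> G x"
    using aff G(3)
  proof eventually_elim
    case (elim x)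
    from elim(1) obtain r a c where r: "r > 0" "\<forall>z\<in>ball x r. u z = a \<bullet> z + c" by blast
    have "(\<lambda>h. G x \<bullet> h) = (\<lambda>h. a \<bullet> h)" using has_derivative_unique[OF elim(2) aff_der[OF r]] .
    then have "G x \<bullet> b = a \<bullet> b" for b by (rule fun_cong)
    then have Ga: "G x = a" by (simp add: euclidean_eq_iff[where 'a='a])
    have "(\<lambda>n. \<delta> n * (2 + dist x0 x)) \<longlonglongrightarrow> 0 * (2 + dist x0 x)" by (intro tendsto_intros \<delta>lim)
    then have "\<forall>\<^sub>F n in sequentially. \<delta> n * (2 + dist x0 x) < r"
      using r(1) by (intro order_tendstoD) auto
    then have "\<forall>\<^sub>F n in sequentially. (1 + \<delta> n) *\<^sub>R a = g n x"
    proof eventually_elim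
      case (elim n)
      have "(\<lambda>h. g n x \<bullet> h) = (\<lambda>h. ((1 + \<delta> n) *\<^sub>R a) \<bullet> h)"
        using has_derivative_unique[OF gd der[OF r(2) elim]] .
      then have "g n x \<bullet> b = ((1 + \<delta> n) *\<^sub>R a) \<bullet> b" for b by (rule fun_cong)
      then show ?case by (simp add: euclidean_eq_iff[where 'a='a])
    qed
    moreover have "(\<lambda>n. (1 + \<delta> n) *\<^sub>R a) \<longlonglongrightarrow> (1 + 0) *\<^sub>R a" by (intro tendsto_intros \<delta>lim)
    ultimately have "(\<lambda>n. g n x) \<longlonglongrightarrow> (1 + 0) *\<^sub>R a"
      by (rule Lim_transform_eventually[rotated])
    then show ?case by (simp add: Ga)
  qed
  obtain B where B: "\<And>x. x \<in> U \<Longrightarrow> dist x0 x \<le> B" using U(3) by (auto simp: bounded_any_center[of U x0])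
  have B0: "B \<ge> 0" using B[OF x0] by simp
  have fin: "integrable (lebesgue_on U) (\<lambda>x. C::real)" for C
    by (rule integrable_bounded_lebesgue_on[OF U(1,3), of _ "\<bar>C\<bar>"]) auto
  have um: "u \<in> borel_measurable (lebesgue_on U)"
    by (rule borel_measurable_lebesgue_onI[OF lipschitz_on_continuous_on[OF L]])
  have \<phi>m: "\<phi> n \<in> borel_measurable (lebesgue_on U)" for n
    by (rule borel_measurable_lebesgue_onI[OF smooth_continuous[OF sm]])
  have lim1: "(\<lambda>n. LINT x|lebesgue_on U. (\<phi> n x - u x)\<^sup>2) \<longlonglongrightarrow> (LINT x|lebesgue_on U. 0)"
  proof (rule integral_dominated_convergence[where w = "\<lambda>x. (L * (2 + B))\<^sup>2"])
    have le: "\<bar>\<phi> n x - u x\<bar> \<le> \<delta> n * (L * (2 + B))" if "x \<in> U" for n x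
    proof -
      have "L * \<delta> n * (2 + dist x0 x) \<le> L * \<delta> n * (2 + B)"
        using B[OF that] L0 \<delta>[of n] by (intro mult_left_mono) auto
      with near[of n x] show ?thesis by (simp add: mult_ac)
    qed
    show "AE x in lebesgue_on U. norm ((\<phi> n x - u x)\<^sup>2) \<le> (L * (2 + B))\<^sup>2" for n
    proof (rule AE_I2)
      fix x assume "x \<in> space (lebesgue_on U)"
      then have "\<bar>\<phi> n x - u x\<bar> \<le> \<delta> n * (L * (2 + B))" using le by simp
      also have "\<dots> \<le> L * (2 + B)" using \<delta>[of n] L0 B0 by (intro mult_left_le_one_le) auto
      finally have "\<bar>\<phi> n x - u x\<bar>\<^sup>2 \<le> (L * (2 + B))\<^sup>2" by (intro power_mono) auto
      then show "norm ((\<phi> n x - u x)\<^sup>2) \<le> (L * (2 + B))\<^sup>2" by simp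
    qed
    show "AE x in lebesgue_on U. (\<lambda>n. (\<phi> n x - u x)\<^sup>2) \<longlonglongrightarrow> 0"
    proof (rule AE_I2)
      fix x assume "x \<in> space (lebesgue_on U)"
      then have x: "x \<in> U" by simp
      have "(\<lambda>n. \<delta> n * (L * (2 + B))) \<longlonglongrightarrow> 0 * (L * (2 + B))" by (intro tendsto_intros \<delta>lim)
      then have z: "(\<lambda>n. \<delta> n * (L * (2 + B))) \<longlonglongrightarrow> 0" by simp
      have "(\<lambda>n. \<phi> n x - u x) \<longlonglongrightarrow> 0"
        by (rule Lim_null_comparison[OF _ z]) (use le[OF x] in auto)
      from tendsto_power[OF this, of 2] show "(\<lambda>n. (\<phi> n x - u x)\<^sup>2) \<longlonglongrightarrow> 0" by simp
    qed
  qed (use fin um \<phi>m in auto)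
  have lim2: "(\<lambda>n. LINT x|lebesgue_on U. (norm (g n x - G x))\<^sup>2) \<longlonglongrightarrow> (LINT x|lebesgue_on U. 0)"
  proof (rule integral_dominated_convergence[where w = "\<lambda>x. (3 * L)\<^sup>2"])
    show "AE x in lebesgue_on U. norm ((norm (g n x - G x))\<^sup>2) \<le> (3 * L)\<^sup>2" for n
      using G(4)
    proof eventually_elim
      case (elim x)
      have "norm (g n x - G x) \<le> 3 * L" using norm_triangle_ineq4[of "g n x" "G x"] gb[of n x] elim by simp
      then have "(norm (g n x - G x))\<^sup>2 \<le> (3 * L)\<^sup>2" by (intro power_mono) auto
      then show ?case by simp
    qed
    show "AE x in lebesgue_on U. (\<lambda>n. (norm (g n x - G x))\<^sup>2) \<longlonglongrightarrow> 0"
      using glim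
    proof eventually_elim
      case (elim x)
      have "(\<lambda>n. norm (g n x - G x)) \<longlonglongrightarrow> 0" using elim by (simp add: LIM_zero tendsto_norm_zero)
      from tendsto_power[OF this, of 2] show ?case by simp
    qed
  qed (use fin gm G(1) in auto)
  have "H1_norm U (\<phi> n - u) = sqrt ((LINT x|lebesgue_on U. (\<phi> n x - u x)\<^sup>2) + (LINT x|lebesgue_on U. (norm (g n x - G x))\<^sup>2))" for n
  proof -
    have "has_weak_gradient U (\<lambda>x. \<phi> n x + (-1) * u x) (\<lambda>x. g n x + (-1) *\<^sub>R G x)"
      by (intro has_weak_gradient_add has_weak_gradient_cmult U wg G)
    moreover have "(\<lambda>x. \<phi> n x + (-1) * u x) = \<phi> n - u" by (auto simp: fun_eq_iff)
    ultimately have "has_weak_gradient U (\<phi> n - u) (\<lambda>x. g n x - G x)" by simp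
    from weak_grad_integrals[OF U(1) this] show ?thesis
      unfolding H1_norm_def using gm G(1) by simp
  qed
  moreover have "(\<lambda>n. sqrt ((LINT x|lebesgue_on U. (\<phi> n x - u x)\<^sup>2) + (LINT x|lebesgue_on U. (norm (g n x - G x))\<^sup>2)))
      \<longlonglongrightarrow> sqrt ((LINT x|lebesgue_on U. 0) + (LINT x|lebesgue_on U. 0))"
    by (intro tendsto_intros lim1 lim2)
  ultimately have "(\<lambda>n. H1_norm U (\<phi> n - u)) \<longlonglongrightarrow> 0" by simp
  then show ?thesis using uH1 test unfolding H10_def by blast
qed

section \<open>Finite element functions\<close>

lemma simplex_vertices:
  assumes "n simplex B"
  obtains C where "finite C" "B = convex hull C"
  using assms unfolding simplex_def using aff_independent_finite by metis

context
  fixes U :: "'a::euclidean_space set" and H :: real and \<B> :: "'a set set"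
  assumes U: "convex_polytopal_domain U" and mesh: "simplicial_partition U H \<B>"
begin

lemma domain: "open U" "convex U" "bounded U" "U \<noteq> {}" "compact (closure U)"
proof -
  show "open U" "convex U" "U \<noteq> {}" using U by (auto simp: convex_polytopal_domain_def)
  have "bounded (closure U)" using U by (auto simp: convex_polytopal_domain_def polytope_imp_bounded)
  then show "bounded U" by (rule bounded_subset[OF _ closure_subset])
  then show "compact (closure U)" by simp
qed

lemma cell:
  assumes "B \<in> \<B>"
  shows "convex B" "closed B" "B \<subseteq> closure U"
proof -
  have s: "int DIM('a) simplex B" "\<Union>\<B> = closure U" using assms mesh by (auto simp: simplicial_partition_def)
  obtain C where C: "finite C" "B = convex hull C" using simplex_vertices[OF s(1)] .
  show "convex B" unfolding C by (rule convex_convex_hull)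
  show "closed B" unfolding C using C(1) by (intro compact_imp_closed finite_imp_compact_convex_hull)
  show "B \<subseteq> closure U" using s(2) assms by blast
qed

lemma AE_interior_cell: "AE x in lebesgue_on U. \<exists>B\<in>\<B>. x \<in> interior B"
proof -
  have fin: "finite \<B>" and un: "\<Union>\<B> = closure U" using mesh by (auto simp: simplicial_partition_def)
  have "AE x in lebesgue. \<forall>B\<in>\<B>. x \<notin> frontier B"
    by (intro AE_finite_allI[OF fin] AE_negligible negligible_convex_frontier cell(1))
  then have "AE x in lebesgue. x \<in> U \<longrightarrow> (\<exists>B\<in>\<B>. x \<in> interior B)"
  proof eventually_elim
    case (elim x)
    show ?case
    proof
      assume "x \<in> U"
      then obtain B where B: "B \<in> \<B>" "x \<in> B" using un closure_subset by blast
      then have "x \<in> interior B" using elim cell(2)[OF B(1)] by (auto simp: frontier_def)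
      then show "\<exists>B\<in>\<B>. x \<in> interior B" using B by blast
    qed
  qed
  then show ?thesis using domain(1) by (simp add: AE_restrict_space_iff)
qed

lemma P1_cont: "v \<in> P1_space U \<B> \<Longrightarrow> continuous_on (closure U) v"
  by (simp add: P1_space_def)

lemma P1_outside: "v \<in> P1_space U \<B> \<Longrightarrow> x \<notin> closure U \<Longrightarrow> v x = 0"
  by (simp add: P1_space_def)

lemma P1_affine:
  assumes "v \<in> P1_space U \<B>" "B \<in> \<B>"
  obtains a c where "\<forall>x\<in>B. v x = a \<bullet> x + c"
proof -
  have "\<exists>a c. \<forall>x\<in>B. v x = a \<bullet> x + c" using assms by (simp add: P1_space_def)
  then show ?thesis using that by metis
qed

lemma P1_locally_affine:
  assumes v: "v \<in> P1_space U \<B>"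
  shows "AE x in lebesgue_on U. \<exists>r>0. \<exists>a c. \<forall>z\<in>ball x r. v z = a \<bullet> z + c"
  using AE_interior_cell
proof eventually_elim
  case (elim x)
  then obtain B where B: "B \<in> \<B>" "x \<in> interior B" by blast
  then obtain r where r: "r > 0" "ball x r \<subseteq> B" by (auto simp: mem_interior)
  obtain a c where "\<forall>z\<in>B. v z = a \<bullet> z + c" using P1_affine[OF v B(1)] by metis
  then show ?case using r by blast
qed

text \<open>On a segment between two points of the convex domain, the finitely many cells cut out closed
  sets on which the function is affine; a continuous function with this property is Lipschitz along the segment with the
  largest of the constants. The sum of the norms of all slopes is used in place of their maximum.\<close>

lemma P1_lipschitz:
  assumes v: "v \<in> P1_space U \<B>"
  obtains L where "L-lipschitz_on (closure U) v"
proof -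
  have fin: "finite \<B>" and un: "\<Union>\<B> = closure U" using mesh by (auto simp: simplicial_partition_def)
  have "\<forall>B\<in>\<B>. \<exists>a c. \<forall>x\<in>B. v x = a \<bullet> x + c" using v by (simp add: P1_space_def)
  then obtain a where a: "\<And>B. B \<in> \<B> \<Longrightarrow> \<exists>c. \<forall>x\<in>B. v x = a B \<bullet> x + c" by metis
  define L where "L = (\<Sum>B\<in>\<B>. norm (a B))"
  have L0: "L \<ge> 0" by (simp add: L_def sum_nonneg)
  have aL: "norm (a B) \<le> L" if "B \<in> \<B>" for B
    unfolding L_def by (rule member_le_sum) (use that fin in auto)
  have "L-lipschitz_on (closure U) v"
  proof (rule lipschitz_onI[OF _ L0])
    fix x y assume xy: "x \<in> closure U" "y \<in> closure U"
    define p where "p t = x + t *\<^sub>R (y - x)" for t :: real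
    have p_in: "p t \<in> closure U" if "t \<in> {0..1}" for t
    proof -
      have "p t = (1 - t) *\<^sub>R x + t *\<^sub>R y" by (simp add: p_def algebra_simps)
      then show ?thesis using that xy convex_closure[OF domain(2)] by (auto simp: convex_alt)
    qed
    have "(L * dist x y)-lipschitz_on {0..1} (\<lambda>t. v (p t))"
    proof (rule lipschitz_on_closed_Union[where I = \<B> and U = "\<lambda>B. {t\<in>{0..1}. p t \<in> B}"])
      fix B assume B: "B \<in> \<B>"
      obtain c where c: "\<forall>x\<in>B. v x = a B \<bullet> x + c" using a[OF B] by blast
      show "(L * dist x y)-lipschitz_on {t\<in>{0..1}. p t \<in> B} (\<lambda>t. v (p t))"
      proof (rule lipschitz_onI)
        fix s t assume "s \<in> {t\<in>{0..1}. p t \<in> B}" "t \<in> {t\<in>{0..1}. p t \<in> B}"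
        then have "v (p s) - v (p t) = (s - t) * (a B \<bullet> (y - x))"
          using c by (simp add: p_def algebra_simps inner_add_right inner_diff_right)
        also have "\<bar>\<dots>\<bar> \<le> \<bar>s - t\<bar> * (norm (a B) * norm (y - x))"
          unfolding abs_mult by (intro mult_left_mono Cauchy_Schwarz_ineq2) auto
        also have "\<dots> \<le> \<bar>s - t\<bar> * (L * norm (y - x))"
          by (intro mult_left_mono mult_right_mono aL B) auto
        finally show "dist (v (p s)) (v (p t)) \<le> L * dist x y * dist s t"
          by (simp add: dist_real_def dist_norm norm_minus_commute mult_ac)
      qed (use L0 in simp)
      have "closed {t\<in>{0..1}. p t \<in> B}"
        using continuous_closed_preimage[of "{0..1}" p B] cell(2)[OF B]
        by (simp add: p_def[abs_def] vimage_def Int_def continuous_intros)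
      then show "closed {t\<in>{0..1}. p t \<in> B}" .
    next
      show "{0..1} \<subseteq> (\<Union>B\<in>\<B>. {t\<in>{0..1}. p t \<in> B})" using p_in un by fastforce
    qed (use fin L0 in auto)
    from lipschitz_onD[OF this, of 0 1] show "dist (v x) (v y) \<le> L * dist x y"
      by (simp add: p_def)
  qed
  then show ?thesis using that by blast
qed

lemma P1_weak_gradient:
  assumes v: "v \<in> P1_space U \<B>"
  obtains G C where "has_weak_gradient U v G" "G \<in> borel_measurable (lebesgue_on U)"
    "AE x in lebesgue_on U. norm (G x) \<le> C"
proof -
  obtain L where "L-lipschitz_on (closure U) v" using P1_lipschitz[OF v] .
  then have L: "L-lipschitz_on U v" by (rule lipschitz_on_subset[OF _ closure_subset])
  have "AE x in lebesgue_on U. v differentiable at x"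
    using P1_locally_affine[OF v]
  proof eventually_elim
    case (elim x)
    then obtain r a c where r: "r > 0" "\<forall>z\<in>ball x r. v z = a \<bullet> z + c" by blast
    have "((\<lambda>z. a \<bullet> z + c) has_derivative (\<lambda>h. a \<bullet> h)) (at x)" by (auto intro!: derivative_eq_intros)
    then have "(v has_derivative (\<lambda>h. a \<bullet> h)) (at x)"
      by (rule has_derivative_transform_within_open[of _ _ _ _ "ball x r"]) (use r in auto)
    then show ?case by (auto simp: differentiable_def)
  qed
  from lipschitz_weak_gradient_exists[OF domain(1) L this] that show ?thesis by metis
qed

lemma P1_subset_H1: "P1_space U \<B> \<subseteq> H1 U"
proof
  fix v assume v: "v \<in> P1_space U \<B>"
  obtain L where "L-lipschitz_on (closure U) v" using P1_lipschitz[OF v] .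
  then have L: "L-lipschitz_on U v" by (rule lipschitz_on_subset[OF _ closure_subset])
  obtain G C where "has_weak_gradient U v G" "G \<in> borel_measurable (lebesgue_on U)"
    "AE x in lebesgue_on U. norm (G x) \<le> C" using P1_weak_gradient[OF v] .
  then show "v \<in> H1 U" using H1I[OF domain(1,3) L] by blast
qed

text \<open>This inclusion is what makes Poincare's inequality applicable to discrete pressures. A segment
  leaving the domain meets the frontier, where the function vanishes; so its extension by 0 is
  Lipschitz on the whole space.\<close>

lemma P1_space0_subset_H10: "P1_space0 U \<B> \<subseteq> H10 U"
proof
  fix v assume v0: "v \<in> P1_space0 U \<B>"
  then have v: "v \<in> P1_space U \<B>" by (simp add: P1_space0_def)
  have fr: "v x = 0" if "x \<notin> U" for x
    using v0 P1_outside[OF v, of x] that domain(1)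
    by (cases "x \<in> closure U") (auto simp: P1_space0_def frontier_def interior_open)
  obtain L where L: "L-lipschitz_on (closure U) v" using P1_lipschitz[OF v] .
  have L0: "L \<ge> 0" using lipschitz_on_nonneg[OF L] .
  have mixed: "dist (v x) (v y) \<le> L * dist x y" if "x \<in> U" "y \<notin> U" for x y
  proof -
    have "closed_segment x y \<inter> frontier U \<noteq> {}"
      by (rule connected_Int_frontier) (use that in auto)
    then obtain z where z: "z \<in> closed_segment x y" "z \<in> frontier U" by blast
    have "v z = 0" using z(2) domain(1) by (intro fr) (auto simp: frontier_def interior_open)
    then have "dist (v x) (v y) = dist (v x) (v z)" using fr[OF that(2)] by simp
    also have "\<dots> \<le> L * dist x z"
      using z(2) that(1) closure_subset by (intro lipschitz_onD[OF L]) (auto simp: frontier_def)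
    also have "\<dots> \<le> L * dist x y"
      using dist_in_closed_segment(1)[OF z(1)] L0
      by (intro mult_left_mono) (auto simp: dist_commute)
    finally show ?thesis .
  qed
  have "L-lipschitz_on UNIV v"
  proof (rule lipschitz_onI[OF _ L0])
    fix x y
    consider "x \<in> U" "y \<in> U" | "x \<in> U" "y \<notin> U" | "x \<notin> U" "y \<in> U" | "x \<notin> U" "y \<notin> U" by blast
    then show "dist (v x) (v y) \<le> L * dist x y"
    proof cases
      case 1
      then show ?thesis using closure_subset by (intro lipschitz_onD[OF L]) auto
    next
      case 3
      then show ?thesis using mixed[of y x] by (simp add: dist_commute)
    qed (use mixed fr L0 in auto)
  qed
  then show "v \<in> H10 U"
    using H10_if_locally_affine[OF domain(1-4) _ fr P1_locally_affine[OF v]] by blast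
qed

lemma P1_add:
  assumes "v \<in> P1_space U \<B>" "w \<in> P1_space U \<B>"
  shows "(\<lambda>x. v x + w x) \<in> P1_space U \<B>"
proof -
  have "\<exists>a c. \<forall>x\<in>B. v x + w x = a \<bullet> x + c" if B: "B \<in> \<B>" for B
  proof -
    obtain a1 c1 where "\<forall>x\<in>B. v x = a1 \<bullet> x + c1" using P1_affine[OF assms(1) B] by metis
    moreover obtain a2 c2 where "\<forall>x\<in>B. w x = a2 \<bullet> x + c2"
      using P1_affine[OF assms(2) B] by metis
    ultimately show ?thesis
      by (intro exI[of _ "a1 + a2"] exI[of _ "c1 + c2"]) (simp add: inner_add_left)
  qed
  then show ?thesis using assms by (simp add: P1_space_def continuous_on_add)
qed

lemma P1_cmult:
  assumes "v \<in> P1_space U \<B>"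
  shows "(\<lambda>x. k * v x) \<in> P1_space U \<B>"
proof -
  have "\<exists>a c. \<forall>x\<in>B. k * v x = a \<bullet> x + c" if B: "B \<in> \<B>" for B
  proof -
    obtain a1 c1 where "\<forall>x\<in>B. v x = a1 \<bullet> x + c1" using P1_affine[OF assms B] by metis
    then show ?thesis
      by (intro exI[of _ "k *\<^sub>R a1"] exI[of _ "k * c1"]) (simp add: algebra_simps)
  qed
  then show ?thesis using assms by (simp add: P1_space_def continuous_on_mult_left)
qed

lemma P1_zero: "(\<lambda>x. 0) \<in> P1_space U \<B>"
  unfolding P1_space_def by (auto intro!: exI[of _ 0])

text \<open>An affine function on a simplex is determined by its values at the vertices.\<close>

lemma P1_determined:
  obtains P where "finite P" "\<And>v. v \<in> P1_space U \<B> \<Longrightarrow> (\<And>x. x \<in> P \<Longrightarrow> v x = 0) \<Longrightarrow> v = (\<lambda>x. 0)"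
proof -
  have fin: "finite \<B>" and un: "\<Union>\<B> = closure U" using mesh by (auto simp: simplicial_partition_def)
  have "\<forall>B\<in>\<B>. \<exists>C. finite C \<and> B = convex hull C"
    using mesh simplex_vertices unfolding simplicial_partition_def by metis
  then obtain C where C: "\<And>B. B \<in> \<B> \<Longrightarrow> finite (C B)" "\<And>B. B \<in> \<B> \<Longrightarrow> B = convex hull (C B)" by metis
  show ?thesis
  proof (rule that[of "\<Union>B\<in>\<B>. C B"])
    show "finite (\<Union>B\<in>\<B>. C B)" using fin C by auto
    fix v assume v: "v \<in> P1_space U \<B>" and 0: "\<And>x. x \<in> (\<Union>B\<in>\<B>. C B) \<Longrightarrow> v x = 0"
    show "v = (\<lambda>x. 0)"
    proof
      fix x
      show "v x = 0"
      proof (cases "x \<in> closure U")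
        case False
        then show ?thesis using P1_outside[OF v] by simp
      next
        case True
        then obtain B where B: "B \<in> \<B>" "x \<in> B" using un by blast
        obtain a c where ac: "\<forall>x\<in>B. v x = a \<bullet> x + c" using P1_affine[OF v B(1)] by metis
        have sub: "C B \<subseteq> {z. a \<bullet> z = - c}"
        proof
          fix z assume z: "z \<in> C B"
          have "z \<in> B" by (subst C(2)[OF B(1)]) (rule hull_inc[OF z])
          then have "v z = a \<bullet> z + c" using ac by blast
          moreover have "v z = 0" using 0 z B(1) by blast
          ultimately show "z \<in> {z. a \<bullet> z = - c}" by simp
        qed
        have "B \<subseteq> {z. a \<bullet> z = - c}"
          using hull_minimal[OF sub, of convex] convex_hyperplane C(2)[OF B(1)] by metis
        then show ?thesis using ac B by auto
      qed
    qed
  qed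
qed

end

section \<open>Finite-dimensional function spaces\<close>

text \<open>A finite set of points that determines the functions of \<open>X\<close> and has minimal size has a dual
  basis in \<open>X\<close>: removing one point, some nonzero function vanishes at all the others, and it can be
  normalised at the removed point. The coordinates in this basis are point evaluations, which fits the
  definition of time derivatives pointwise in space.\<close>

lemma nodal_basis:
  fixes X :: "('z \<Rightarrow> real) set"
  assumes zero: "(\<lambda>z. 0) \<in> X" and add: "\<And>u v. u \<in> X \<Longrightarrow> v \<in> X \<Longrightarrow> (\<lambda>z. u z + v z) \<in> X"
    and cmult: "\<And>u c. u \<in> X \<Longrightarrow> (\<lambda>z. c * u z) \<in> X"
    and Z: "finite Z" "\<And>u. u \<in> X \<Longrightarrow> (\<And>z. z \<in> Z \<Longrightarrow> u z = 0) \<Longrightarrow> u = (\<lambda>z. 0)"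
  obtains I e where "finite I" "\<And>z. z \<in> I \<Longrightarrow> e z \<in> X"
    "\<And>z w. z \<in> I \<Longrightarrow> w \<in> I \<Longrightarrow> e z w = (if z = w then 1 else 0)"
    "\<And>u. u \<in> X \<Longrightarrow> u = (\<lambda>w. \<Sum>z\<in>I. u z * e z w)"
proof -
  define det where "det J \<longleftrightarrow> J \<subseteq> Z \<and> (\<forall>u\<in>X. (\<forall>z\<in>J. u z = 0) \<longrightarrow> u = (\<lambda>z. 0))" for J
  have "det Z" using Z by (auto simp: det_def)
  then obtain I where I: "det I" and min: "\<And>J. det J \<Longrightarrow> card I \<le> card J"
    using ex_has_least_nat[of det Z card] by blast
  have fin: "finite I" using I Z(1) by (auto simp: det_def intro: finite_subset)
  have sum: "(\<lambda>w. \<Sum>z\<in>J. c z * e z w) \<in> X" if "\<And>z. z \<in> J \<Longrightarrow> e z \<in> X" for J c and e :: "'z \<Rightarrow> 'z \<Rightarrow> real"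
    using that
  proof (induction J rule: infinite_finite_induct)
    case (insert x J)
    then show ?case using add[OF cmult[of "e x" "c x"] insert.IH] by simp
  qed (simp_all add: zero)
  have "\<exists>u\<in>X. \<forall>w\<in>I. u w = (if z = w then 1 else 0)" if z: "z \<in> I" for z
  proof -
    have "\<not> det (I - {z})" using min[of "I - {z}"] fin z card_gt_0_iff[of I] by (auto simp: card_Diff_singleton)
    then obtain u where u: "u \<in> X" "\<And>w. w \<in> I - {z} \<Longrightarrow> u w = 0" "u \<noteq> (\<lambda>z. 0)"
      using I by (auto simp: det_def)
    have "u z \<noteq> 0" using u I by (auto simp: det_def)
    then show ?thesis using u cmult[OF u(1), of "1 / u z"]
      by (intro bexI[of _ "\<lambda>w. 1 / u z * u w"]) auto
  qed
  then obtain e where e: "\<And>z. z \<in> I \<Longrightarrow> e z \<in> X"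
    "\<And>z w. z \<in> I \<Longrightarrow> w \<in> I \<Longrightarrow> e z w = (if z = w then 1 else 0)" by metis
  have rep: "u = (\<lambda>w. \<Sum>z\<in>I. u z * e z w)" if u: "u \<in> X" for u
  proof -
    define d where "d w = u w + (-1) * (\<Sum>z\<in>I. u z * e z w)" for w
    have "d \<in> X" unfolding d_def using sum e(1) by (intro add cmult u) blast
    moreover have "d w = 0" if w: "w \<in> I" for w
    proof -
      have "(\<Sum>z\<in>I. u z * e z w) = (\<Sum>z\<in>I. if z = w then u z else 0)"
        by (rule sum.cong) (use e(2) w in auto)
      then show ?thesis using fin w by (simp add: d_def)
    qed
    ultimately have "d = (\<lambda>z. 0)" using I by (auto simp: det_def)
    then have d0: "d w = 0" for w by (rule fun_cong)
    show ?thesis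
    proof
      fix w
      have "u w + (-1) * (\<Sum>z\<in>I. u z * e z w) = 0" using d0[of w] unfolding d_def .
      then show "u w = (\<Sum>z\<in>I. u z * e z w)" by linarith
    qed
  qed
  show ?thesis by (rule that[of I e]) (fact fin e rep)+
qed

text \<open>Block elimination: the last unknown is determined by the Schur complement \<open>s\<close>, which is
  positive because it is the value of the quadratic form at the vector \<open>v\<close> below.\<close>

lemma positive_definite_solve:
  fixes G :: "'i \<Rightarrow> 'i \<Rightarrow> real"
  assumes "finite I" and "\<And>i j. i \<in> I \<Longrightarrow> j \<in> I \<Longrightarrow> G i j = G j i"
    and "\<And>c. \<exists>i\<in>I. c i \<noteq> 0 \<Longrightarrow> (\<Sum>i\<in>I. \<Sum>j\<in>I. c i * c j * G i j) > 0"
  shows "\<exists>c. \<forall>j\<in>I. (\<Sum>i\<in>I. c i * G i j) = b j"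
  using assms
proof (induction I arbitrary: b rule: finite_induct)
  case empty
  then show ?case by simp
next
  case (insert k I)
  note sym = insert.prems(1) and pos = insert.prems(2)
  have pos': "(\<Sum>i\<in>I. \<Sum>j\<in>I. c i * c j * G i j) > 0" if c: "\<exists>i\<in>I. c i \<noteq> 0" for c
  proof -
    have *: "(\<Sum>j\<in>I. (c(k := 0)) i * (c(k := 0)) j * G i j) = (\<Sum>j\<in>I. c i * c j * G i j)" if "i \<in> I" for i
      by (rule sum.cong) (use insert.hyps that in auto)
    have "(\<Sum>i\<in>insert k I. \<Sum>j\<in>insert k I. (c(k := 0)) i * (c(k := 0)) j * G i j)
        = (\<Sum>i\<in>I. \<Sum>j\<in>I. c i * c j * G i j)"
      using insert.hyps * by (simp cong: sum.cong)
    moreover have "\<exists>i\<in>insert k I. (c(k := 0)) i \<noteq> 0" using c insert.hyps by auto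
    ultimately show ?thesis using pos[of "c(k := 0)"] by simp
  qed
  have IH: "\<exists>c. \<forall>j\<in>I. (\<Sum>i\<in>I. c i * G i j) = b j" for b
    by (rule insert.IH[OF _ pos']) (use sym in auto)
  obtain d where d: "\<And>j. j \<in> I \<Longrightarrow> (\<Sum>i\<in>I. d i * G i j) = G k j" using IH[of "G k"] by blast
  obtain c where c: "\<And>j. j \<in> I \<Longrightarrow> (\<Sum>i\<in>I. c i * G i j) = b j" using IH[of b] by blast
  define s where "s = G k k - (\<Sum>i\<in>I. d i * G i k)"
  have s: "s > 0"
  proof -
    define v where "v i = (if i = k then 1 else - d i)" for i
    have vk: "v k = 1" by (simp add: v_def)
    have vI: "v i = - d i" if "i \<in> I" for i using insert.hyps that by (auto simp: v_def)
    have row: "(\<Sum>j\<in>insert k I. v i * v j * G i j) = v i * (G i k - (\<Sum>j\<in>I. d j * G i j))" for i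
      using insert.hyps vk by (simp add: vI sum_distrib_left sum_negf algebra_simps cong: sum.cong)
    have r0: "G i k - (\<Sum>j\<in>I. d j * G i j) = 0" if i: "i \<in> I" for i
    proof -
      have "(\<Sum>j\<in>I. d j * G i j) = (\<Sum>j\<in>I. d j * G j i)" by (rule sum.cong) (use sym i in auto)
      then show ?thesis using d[OF i] sym[of i k] i by simp
    qed
    have "(\<Sum>j\<in>I. d j * G k j) = (\<Sum>j\<in>I. d j * G j k)" by (rule sum.cong) (use sym in auto)
    then have "(\<Sum>i\<in>insert k I. \<Sum>j\<in>insert k I. v i * v j * G i j) = s"
      unfolding row using insert.hyps r0 vk by (simp add: s_def cong: sum.cong)
    moreover have "\<exists>i\<in>insert k I. v i \<noteq> 0" using vk by (auto intro: exI[of _ k])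
    ultimately show ?thesis using pos[of v] by simp
  qed
  \<comment> \<open>Here \<open>c\<close> solves the smaller system for \<open>b\<close>, and \<open>d\<close> solves it for the last row of \<open>G\<close>.\<close>
  define t where "t = (b k - (\<Sum>i\<in>I. c i * G i k)) / s"
  define x where "x i = (if i = k then t else c i - t * d i)" for i
  have xk: "x k = t" by (simp add: x_def)
  have xI: "x i = c i - t * d i" if "i \<in> I" for i using insert.hyps that by (auto simp: x_def)
  have row: "(\<Sum>i\<in>insert k I. x i * G i j) = t * G k j + (\<Sum>i\<in>I. c i * G i j) - t * (\<Sum>i\<in>I. d i * G i j)" for j
    using insert.hyps xk
    by (simp add: xI sum_distrib_left sum_subtractf algebra_simps cong: sum.cong)
  have "(\<Sum>i\<in>insert k I. x i * G i j) = b j" if j: "j \<in> insert k I" for j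
  proof (cases "j = k")
    case True
    have "t * s + (\<Sum>i\<in>I. c i * G i k) = b k" using s by (simp add: t_def)
    then show ?thesis unfolding row True by (simp add: s_def algebra_simps)
  next
    case False
    then show ?thesis unfolding row using j c d by simp
  qed
  then show ?case by blast
qed

section \<open>Linear differential equations with constant coefficients\<close>

text \<open>The solution is the power series with coefficients \<open>a n / fact n\<close>, where \<open>a\<close> is obtained by
  iterating \<open>A\<close>; the inhomogeneity enters only in the step from \<open>a 0\<close> to \<open>a 1\<close>.\<close>

lemma linear_ode_exists:
  fixes A :: "'i \<Rightarrow> 'i \<Rightarrow> real"
  assumes fin: "finite I"
  obtains c :: "real \<Rightarrow> 'i \<Rightarrow> real" where "\<And>i. i \<in> I \<Longrightarrow> c 0 i = c0 i"
    "\<And>t i. i \<in> I \<Longrightarrow> ((\<lambda>t. c t i) has_real_derivative (\<Sum>j\<in>I. A i j * c t j) + b i) (at t)"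
proof -
  define a where "a n = rec_nat c0 (\<lambda>n x i. (\<Sum>j\<in>I. A i j * x j) + (if n = 0 then b i else 0)) n" for n
  have a0: "a 0 = c0" and aS: "a (Suc n) i = (\<Sum>j\<in>I. A i j * a n j) + (if n = 0 then b i else 0)" for n i
    by (simp_all add: a_def)
  define M where "M = (\<Sum>i\<in>I. \<Sum>j\<in>I. \<bar>A i j\<bar>)"
  define C where "C = (\<Sum>i\<in>I. \<bar>c0 i\<bar>) + (\<Sum>i\<in>I. \<bar>b i\<bar>)"
  have M0: "M \<ge> 0" and C0: "C \<ge> 0" unfolding M_def C_def by (auto intro!: sum_nonneg add_nonneg_nonneg)
  have row: "(\<Sum>j\<in>I. \<bar>A i j\<bar>) \<le> M" if "i \<in> I" for i
    unfolding M_def using member_le_sum[OF that _ fin, of "\<lambda>i. \<Sum>j\<in>I. \<bar>A i j\<bar>"] by (auto intro: sum_nonneg)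
  have c0C: "\<bar>c0 i\<bar> \<le> C" and bC: "\<bar>b i\<bar> \<le> C" if "i \<in> I" for i
    using member_le_sum[OF that _ fin, of "\<lambda>i. \<bar>c0 i\<bar>"] member_le_sum[OF that _ fin, of "\<lambda>i. \<bar>b i\<bar>"]
      sum_nonneg[of I "\<lambda>i. \<bar>c0 i\<bar>"] sum_nonneg[of I "\<lambda>i. \<bar>b i\<bar>"] by (auto simp: C_def)
  have bound: "\<forall>i\<in>I. \<bar>a n i\<bar> \<le> C * (M + 1) ^ n" for n
  proof (induction n)
    case 0
    then show ?case using c0C by (simp add: a0)
  next
    case (Suc n)
    show ?case
    proof
      fix i assume i: "i \<in> I"
      have "\<bar>\<Sum>j\<in>I. A i j * a n j\<bar> \<le> (\<Sum>j\<in>I. \<bar>A i j\<bar> * (C * (M + 1) ^ n))"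
        using Suc by (intro order_trans[OF sum_abs sum_mono]) (auto simp: abs_mult intro!: mult_left_mono)
      also have "\<dots> \<le> M * (C * (M + 1) ^ n)"
        unfolding sum_distrib_right[symmetric] using row[OF i] C0 M0 by (intro mult_right_mono) auto
      finally have 1: "\<bar>\<Sum>j\<in>I. A i j * a n j\<bar> \<le> M * (C * (M + 1) ^ n)" .
      have 2: "\<bar>if n = 0 then b i else 0\<bar> \<le> C * (M + 1) ^ n" using bC[OF i] C0 M0 by simp
      have "\<bar>a (Suc n) i\<bar> \<le> M * (C * (M + 1) ^ n) + C * (M + 1) ^ n"
        unfolding aS using 1 2 by (intro order_trans[OF abs_triangle_ineq add_mono])
      then show "\<bar>a (Suc n) i\<bar> \<le> C * (M + 1) ^ Suc n" by (simp add: algebra_simps)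
    qed
  qed
  have summ: "summable (\<lambda>n. a n i / fact n * t ^ n)" if i: "i \<in> I" for i t
  proof (rule summable_comparison_test)
    show "\<exists>N. \<forall>n\<ge>N. norm (a n i / fact n * t ^ n) \<le> C * (inverse (fact n) * ((M + 1) * \<bar>t\<bar>) ^ n)"
    proof (intro exI allI impI)
      fix n
      have "norm (a n i / fact n * t ^ n) = \<bar>a n i\<bar> * (inverse (fact n) * \<bar>t\<bar> ^ n)"
        by (simp add: abs_mult power_abs divide_inverse)
      also have "\<dots> \<le> C * (M + 1) ^ n * (inverse (fact n) * \<bar>t\<bar> ^ n)"
        using bound[of n] i by (intro mult_right_mono) auto
      finally show "norm (a n i / fact n * t ^ n) \<le> C * (inverse (fact n) * ((M + 1) * \<bar>t\<bar>) ^ n)"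
        by (simp add: power_mult_distrib mult_ac)
    qed
    show "summable (\<lambda>n. C * (inverse (fact n) * ((M + 1) * \<bar>t\<bar>) ^ n))"
      by (intro summable_mult summable_exp)
  qed
  define c where "c t i = (\<Sum>n. a n i / fact n * t ^ n)" for t i
  have der: "((\<lambda>t. c t i) has_real_derivative (\<Sum>j\<in>I. A i j * c t j) + b i) (at t)" if i: "i \<in> I" for i t
  proof -
    have "((\<lambda>t. c t i) has_real_derivative (\<Sum>n. diffs (\<lambda>n. a n i / fact n) n * t ^ n)) (at t)"
      unfolding c_def by (rule termdiffs_strong_converges_everywhere) (rule summ[OF i])
    moreover have "(\<lambda>n. diffs (\<lambda>n. a n i / fact n) n * t ^ n) sums ((\<Sum>j\<in>I. A i j * c t j) + b i)"
    proof -
      have "(\<lambda>n. \<Sum>j\<in>I. A i j * (a n j / fact n * t ^ n)) sums (\<Sum>j\<in>I. A i j * c t j)"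
        unfolding c_def by (intro sums_sum sums_mult summable_sums summ)
      moreover have "(\<lambda>n. if n = 0 then b i else 0) sums b i" using sums_single[of 0 "\<lambda>_. b i"] by simp
      ultimately have "(\<lambda>n. (\<Sum>j\<in>I. A i j * (a n j / fact n * t ^ n)) + (if n = 0 then b i else 0))
          sums ((\<Sum>j\<in>I. A i j * c t j) + b i)" by (rule sums_add)
      moreover have "diffs (\<lambda>n. a n i / fact n) n * t ^ n
          = (\<Sum>j\<in>I. A i j * (a n j / fact n * t ^ n)) + (if n = 0 then b i else 0)" for n
      proof -
        have "diffs (\<lambda>n. a n i / fact n) n * t ^ n = a (Suc n) i / fact n * t ^ n"
          by (simp add: diffs_def field_simps del: of_nat_Suc)
        moreover have "(\<Sum>j\<in>I. A i j * a n j) / fact n * t ^ n = (\<Sum>j\<in>I. A i j * (a n j / fact n * t ^ n))"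
          by (simp add: sum_divide_distrib sum_distrib_right mult.assoc)
        moreover have "(if n = 0 then b i else 0) / fact n * t ^ n = (if n = 0 then b i else 0)" by simp
        ultimately show ?thesis by (simp add: aS add_divide_distrib distrib_right del: of_nat_Suc)
      qed
      ultimately show ?thesis by simp
    qed
    ultimately show ?thesis by (simp add: sums_iff)
  qed
  have "c 0 i = a 0 i / fact 0" for i unfolding c_def by (rule powser_zero)
  then have "c 0 i = c0 i" for i by (simp add: a0)
  with that[of c] der show ?thesis by blast
qed

lemma C1_has_weak_partial:
  fixes c c' :: "real \<Rightarrow> real"
  assumes d: "\<And>t. t \<in> {0<..<T} \<Longrightarrow> (c has_real_derivative c' t) (at t)" and c': "continuous_on {0..T} c'"
  shows "has_weak_partial {0<..<T} 1 c c'"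
proof -
  have "bounded (c' ` {0..T})" by (intro compact_imp_bounded compact_continuous_image c') simp
  then obtain B where B: "\<forall>t\<in>{0..T}. \<bar>c' t\<bar> \<le> B" by (auto simp: bounded_iff)
  have der: "(c has_derivative (\<lambda>h. c' t \<bullet> h)) (at t)" if "t \<in> {0<..<T}" for t
    using d[OF that] by (simp add: has_field_derivative_def)
  have "(max B 0)-lipschitz_on {0<..<T} c"
  proof (rule lipschitz_if_bounded_grad[OF der])
    show "norm (c' t) \<le> max B 0" if "t \<in> {0<..<T}" for t
      using B that by (auto simp: le_max_iff_disj)
  qed auto
  moreover have "c' \<in> borel_measurable (lebesgue_on {0<..<T})"
    by (intro continuous_imp_measurable_on_sets_lebesgue continuous_on_subset[OF c']) auto
  ultimately have "has_weak_gradient {0<..<T} c c'"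
    by (intro lipschitz_has_weak_gradient) (use der in auto)
  then show ?thesis by (simp add: has_weak_gradient_def)
qed

text \<open>The difference between \<open>u\<close> and the integral of \<open>f\<close> is continuous with weak derivative 0, hence constant.
  Weak solutions of a differential equation with continuous right-hand side are thereby classical.\<close>

lemma continuous_weak_derivative_imp_derivative:
  fixes u u' f :: "real \<Rightarrow> real"
  assumes u: "continuous_on {0..T} u" and f: "continuous_on {0..T} f"
    and weak: "has_weak_partial {0<..<T} 1 u u'" and ae: "AE t in lebesgue_on {0<..<T}. u' t = f t"
    and t: "t \<in> {0<..<T}"
  shows "(u has_real_derivative f t) (at t)"
proof -
  define p where "p t = integral {0..t} f" for t
  have pd: "(p has_real_derivative f t) (at t)" if "t \<in> {0<..<T}" for t
  proof -
    have "(p has_real_derivative f t) (at t within {0..T})"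
      unfolding p_def using integral_has_real_derivative[OF f] that by auto
    then have "(p has_real_derivative f t) (at t within {0<..<T})"
      by (rule has_field_derivative_subset) auto
    then show ?thesis using at_within_open[of t "{0<..<T}"] that by simp
  qed
  have pw: "has_weak_partial {0<..<T} 1 p f" by (rule C1_has_weak_partial[OF pd f])
  have pc: "continuous_on {0<..<T} p"
    using pd by (meson DERIV_isCont continuous_at_imp_continuous_on)
  define w where "w t = u t + (-1) * p t" for t
  have ww: "has_weak_partial {0<..<T} 1 w (\<lambda>t. u' t + (-1) * f t)"
    unfolding w_def by (intro has_weak_partial_add has_weak_partial_cmult weak pw) auto
  have wc: "continuous_on {0<..<T} w"
    unfolding w_def by (intro continuous_intros pc continuous_on_subset[OF u]) auto
  have w_const: "w x = w t" if x: "x \<in> {0<..<T}" for x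
  proof -
    define \<alpha> where "\<alpha> = min x t / 2"
    define \<beta> where "\<beta> = (max x t + T) / 2"
    have "\<bar>w (t + (x - t) *\<^sub>R 1) - w t\<bar> \<le> 0 * \<bar>x - t\<bar>"
    proof (rule weak_partial_bounded_imp_lipschitz[OF _ _ wc _ ww])
      show "cbox \<alpha> \<beta> \<subseteq> {0<..<T}" using x t by (auto simp: \<alpha>_def \<beta>_def)
      show "AE t in lebesgue_on {0<..<T}. \<bar>u' t + (-1) * f t\<bar> \<le> 0"
        using ae by eventually_elim simp
      show "t \<in> box \<alpha> \<beta>" "t + (x - t) *\<^sub>R 1 \<in> box \<alpha> \<beta>" using x t by (auto simp: \<alpha>_def \<beta>_def)
    qed auto
    then show ?thesis by simp
  qed
  have "((\<lambda>s. p s + w t) has_real_derivative f t) (at t)"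
    using pd[OF t] by (auto intro!: derivative_eq_intros)
  then show ?thesis
  proof (rule has_field_derivative_transform_within_open[of _ _ _ "{0<..<T}"])
    show "p s + w t = u s" if "s \<in> {0<..<T}" for s using w_const[OF that] by (simp add: w_def)
  qed (use t in auto)
qed

text \<open>The energy given by \<open>G\<close> has nonpositive derivative and starts at 0. The invertibility of \<open>G\<close>
  is used to see that \<open>u'\<close> agrees almost everywhere with the continuous function \<open>f\<close>, so that
  \<open>u\<close> is classically differentiable.\<close>

lemma dissipative_system_unique:
  fixes u u' :: "real \<Rightarrow> 'i \<Rightarrow> real" and G a :: "'i \<Rightarrow> 'i \<Rightarrow> real"
  assumes fin: "finite I" and sym: "\<And>i j. i \<in> I \<Longrightarrow> j \<in> I \<Longrightarrow> G i j = G j i"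
    and pos: "\<And>c. \<exists>i\<in>I. c i \<noteq> 0 \<Longrightarrow> (\<Sum>i\<in>I. \<Sum>j\<in>I. c i * c j * G i j) > 0"
    and dis: "\<And>c. (\<Sum>i\<in>I. \<Sum>j\<in>I. c i * c j * a i j) \<ge> 0"
    and cont: "\<And>i. i \<in> I \<Longrightarrow> continuous_on {0..T} (\<lambda>t. u t i)"
    and init: "\<And>i. i \<in> I \<Longrightarrow> u 0 i = 0"
    and weak: "\<And>i. i \<in> I \<Longrightarrow> has_weak_partial {0<..<T} 1 (\<lambda>t. u t i) (\<lambda>t. u' t i)"
    and eq: "AE t in lebesgue_on {0<..<T}. \<forall>j\<in>I. (\<Sum>i\<in>I. u' t i * G i j) + (\<Sum>i\<in>I. u t i * a i j) = 0"
    and t: "t \<in> {0..T}" and i: "i \<in> I"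
  shows "u t i = 0"
proof -
  have "\<forall>k. \<exists>c. \<forall>j\<in>I. (\<Sum>i\<in>I. c i * G i j) = (if k = j then 1 else 0)"
    by (intro allI positive_definite_solve fin) (erule (1) sym, erule pos)
  then obtain N where N: "\<And>k j. j \<in> I \<Longrightarrow> (\<Sum>i\<in>I. N k i * G i j) = (if k = j then 1 else 0)" by metis
  define r where "r t j = (\<Sum>i\<in>I. u t i * a i j)" for t j
  \<comment> \<open>The rows of \<open>N\<close> are the rows of the inverse matrix; \<open>f\<close> solves the system for the derivative.\<close>
  define f where "f t i = (\<Sum>k\<in>I. - r t k * N k i)" for t i
  have fG: "(\<Sum>i\<in>I. f t i * G i j) = - r t j" if j: "j \<in> I" for t j
  proof -
    have "(\<Sum>i\<in>I. f t i * G i j) = (\<Sum>i\<in>I. \<Sum>k\<in>I. - r t k * (N k i * G i j))"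
      by (simp add: f_def sum_distrib_right mult.assoc)
    also have "\<dots> = (\<Sum>k\<in>I. \<Sum>i\<in>I. - r t k * (N k i * G i j))" by (rule sum.swap)
    also have "\<dots> = (\<Sum>k\<in>I. - r t k * (if k = j then 1 else 0))"
      unfolding sum_distrib_left[symmetric] by (simp only: N[OF j])
    also have "\<dots> = (\<Sum>k\<in>I. if k = j then - r t k else 0)" by (rule sum.cong) auto
    also have "\<dots> = - r t j" using fin j by simp
    finally show ?thesis .
  qed
  have ae: "AE t in lebesgue_on {0<..<T}. \<forall>i\<in>I. u' t i = f t i"
    using eq
  proof eventually_elim
    case (elim t)
    define w where "w i = u' t i - f t i" for i
    have "(\<Sum>i\<in>I. w i * G i j) = 0" if j: "j \<in> I" for j
      using elim j fG[OF j, of t] by (simp add: w_def left_diff_distrib sum_subtractf r_def)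
    then have "(\<Sum>j\<in>I. w j * (\<Sum>i\<in>I. w i * G i j)) = 0" by simp
    then have "(\<Sum>j\<in>I. \<Sum>i\<in>I. w i * w j * G i j) = 0" by (simp add: sum_distrib_left mult_ac)
    then have "(\<Sum>i\<in>I. \<Sum>j\<in>I. w i * w j * G i j) = 0" by (subst sum.swap)
    then have "\<not> (\<exists>i\<in>I. w i \<noteq> 0)" using pos[of w] by auto
    then show ?case by (auto simp: w_def)
  qed
  have fc: "continuous_on {0..T} (\<lambda>t. f t i)" for i
    unfolding f_def r_def by (intro continuous_intros cont)
  have der: "((\<lambda>t. u t i) has_real_derivative f t i) (at t)" if "i \<in> I" "t \<in> {0<..<T}" for i t
  proof (rule continuous_weak_derivative_imp_derivative[OF cont[OF that(1)] fc weak[OF that(1)] _ that(2)])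
    show "AE t in lebesgue_on {0<..<T}. u' t i = f t i" using ae by eventually_elim (use that in blast)
  qed
  define E where "E t = (\<Sum>i\<in>I. \<Sum>j\<in>I. u t i * u t j * G i j)" for t
  have "E 0 \<ge> E t"
  proof (rule DERIV_nonpos_imp_decreasing_open[of 0 t E])
    show "0 \<le> t" using t by simp
    show "continuous_on {0..t} E"
    proof (rule continuous_on_subset)
      show "continuous_on {0..T} E" unfolding E_def by (intro continuous_intros cont)
    qed (use t in auto)
    fix s assume s: "0 < s" "s < t"
    then have s': "s \<in> {0<..<T}" using t by auto
    have "(E has_real_derivative (\<Sum>i\<in>I. \<Sum>j\<in>I. (f s i * u s j + f s j * u s i) * G i j)) (at s)"
      unfolding E_def by (intro DERIV_sum DERIV_cmult_right DERIV_mult der s')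
    moreover have "(\<Sum>i\<in>I. \<Sum>j\<in>I. (f s i * u s j + f s j * u s i) * G i j) \<le> 0"
    proof -
      have 1: "(\<Sum>i\<in>I. \<Sum>j\<in>I. f s i * u s j * G i j) = - (\<Sum>i\<in>I. \<Sum>j\<in>I. u s i * u s j * a i j)"
      proof -
        have "(\<Sum>i\<in>I. \<Sum>j\<in>I. f s i * u s j * G i j) = (\<Sum>j\<in>I. \<Sum>i\<in>I. f s i * u s j * G i j)"
          by (rule sum.swap)
        also have "\<dots> = (\<Sum>j\<in>I. u s j * (\<Sum>i\<in>I. f s i * G i j))" by (simp add: sum_distrib_left mult_ac)
        also have "\<dots> = (\<Sum>j\<in>I. u s j * - r s j)" by (rule sum.cong) (use fG in auto)
        also have "\<dots> = - (\<Sum>j\<in>I. \<Sum>i\<in>I. u s i * u s j * a i j)"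
          by (simp add: r_def sum_distrib_left sum_negf mult_ac)
        also have "(\<Sum>j\<in>I. \<Sum>i\<in>I. u s i * u s j * a i j) = (\<Sum>i\<in>I. \<Sum>j\<in>I. u s i * u s j * a i j)"
          by (rule sum.swap)
        finally show ?thesis .
      qed
      have 2: "(\<Sum>i\<in>I. \<Sum>j\<in>I. f s j * u s i * G i j) = (\<Sum>i\<in>I. \<Sum>j\<in>I. f s i * u s j * G i j)"
      proof -
        have "(\<Sum>i\<in>I. \<Sum>j\<in>I. f s j * u s i * G i j) = (\<Sum>i\<in>I. \<Sum>j\<in>I. f s j * u s i * G j i)"
          by (intro sum.cong refl) (simp add: sym)
        also have "\<dots> = (\<Sum>j\<in>I. \<Sum>i\<in>I. f s j * u s i * G j i)" by (rule sum.swap)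
        finally show ?thesis .
      qed
      show ?thesis using 1 2 dis[of "u s"] by (simp add: distrib_right sum.distrib)
    qed
    ultimately show "\<exists>y. (E has_real_derivative y) (at s) \<and> y \<le> 0" by blast
  qed
  moreover have "E 0 = 0" using init by (simp add: E_def)
  ultimately have "\<not> (\<exists>i\<in>I. u t i \<noteq> 0)" using pos[of "u t"] by (auto simp: E_def)
  then show ?thesis using i by blast
qed

section \<open>Positive semidefinite forms\<close>

text \<open>Spaces of functions are treated as subsets closed under pointwise operations, since their
  dimension is not known in advance and functions carry no vector space structure.\<close>

definition fun_subspace :: "('z \<Rightarrow> real) set \<Rightarrow> bool" where
  "fun_subspace X \<longleftrightarrow> (\<lambda>z. 0) \<in> X \<and> (\<forall>u\<in>X. \<forall>v\<in>X. (\<lambda>z. u z + v z) \<in> X) \<and>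
     (\<forall>u\<in>X. \<forall>c. (\<lambda>z. c * u z) \<in> X)"

definition psd_form :: "('z \<Rightarrow> real) set \<Rightarrow> (('z \<Rightarrow> real) \<Rightarrow> ('z \<Rightarrow> real) \<Rightarrow> real) \<Rightarrow> bool" where
  "psd_form X \<beta> \<longleftrightarrow>
     (\<forall>u\<in>X. \<forall>v\<in>X. \<forall>w\<in>X. \<beta> (\<lambda>z. u z + v z) w = \<beta> u w + \<beta> v w) \<and>
     (\<forall>u\<in>X. \<forall>w\<in>X. \<forall>c. \<beta> (\<lambda>z. c * u z) w = c * \<beta> u w) \<and>
     (\<forall>u\<in>X. \<forall>v\<in>X. \<beta> u v = \<beta> v u) \<and> (\<forall>u\<in>X. \<beta> u u \<ge> 0)"

lemma fun_subspace_zero: "fun_subspace X \<Longrightarrow> (\<lambda>z. 0) \<in> X"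
  and fun_subspace_add: "fun_subspace X \<Longrightarrow> u \<in> X \<Longrightarrow> v \<in> X \<Longrightarrow> (\<lambda>z. u z + v z) \<in> X"
  and fun_subspace_cmult: "fun_subspace X \<Longrightarrow> u \<in> X \<Longrightarrow> (\<lambda>z. c * u z) \<in> X"
  by (simp_all add: fun_subspace_def)

lemma fun_subspace_sum:
  assumes X: "fun_subspace X" and e: "\<And>i. i \<in> I \<Longrightarrow> e i \<in> X"
  shows "(\<lambda>z. \<Sum>i\<in>I. c i * e i z) \<in> X"
  using e
proof (induction I rule: infinite_finite_induct)
  case (insert x I)
  then show ?case
    using fun_subspace_add[OF X fun_subspace_cmult[OF X, of "e x" "c x"] insert.IH] by simp
qed (simp_all add: fun_subspace_zero[OF X])

context
  fixes X :: "('z \<Rightarrow> real) set" and \<beta> :: "('z \<Rightarrow> real) \<Rightarrow> ('z \<Rightarrow> real) \<Rightarrow> real"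
  assumes X: "fun_subspace X" and \<beta>: "psd_form X \<beta>"
begin

lemma psd_add: "u \<in> X \<Longrightarrow> v \<in> X \<Longrightarrow> w \<in> X \<Longrightarrow> \<beta> (\<lambda>z. u z + v z) w = \<beta> u w + \<beta> v w"
  and psd_cmult: "u \<in> X \<Longrightarrow> w \<in> X \<Longrightarrow> \<beta> (\<lambda>z. c * u z) w = c * \<beta> u w"
  and psd_sym: "u \<in> X \<Longrightarrow> v \<in> X \<Longrightarrow> \<beta> u v = \<beta> v u"
  and psd_nonneg: "u \<in> X \<Longrightarrow> \<beta> u u \<ge> 0"
  using \<beta> unfolding psd_form_def by blast+

lemma psd_zero: "w \<in> X \<Longrightarrow> \<beta> (\<lambda>z. 0) w = 0"
  using psd_cmult[of "\<lambda>z. 0" w 0] fun_subspace_zero[OF X] by simp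

lemma psd_add_right: "u \<in> X \<Longrightarrow> v \<in> X \<Longrightarrow> w \<in> X \<Longrightarrow> \<beta> w (\<lambda>z. u z + v z) = \<beta> w u + \<beta> w v"
  using psd_add[of u v w] psd_sym fun_subspace_add[OF X, of u v] by simp

lemma psd_cmult_right: "u \<in> X \<Longrightarrow> w \<in> X \<Longrightarrow> \<beta> w (\<lambda>z. c * u z) = c * \<beta> w u"
  using psd_cmult[of u w c] psd_sym fun_subspace_cmult[OF X, of u c] by simp

lemma psd_sum:
  assumes e: "\<And>i. i \<in> I \<Longrightarrow> e i \<in> X" and w: "w \<in> X"
  shows "\<beta> (\<lambda>z. \<Sum>i\<in>I. c i * e i z) w = (\<Sum>i\<in>I. c i * \<beta> (e i) w)"
  using e
proof (induction I rule: infinite_finite_induct)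
  case (insert x I)
  have "(\<lambda>z. \<Sum>i\<in>I. c i * e i z) \<in> X" by (rule fun_subspace_sum[OF X]) (use insert in auto)
  then show ?case
    using insert psd_add[OF fun_subspace_cmult[OF X, of "e x" "c x"] _ w] psd_cmult[OF _ w, of "e x" "c x"]
    by simp
qed (simp_all add: psd_zero[OF w])

lemma psd_sum_right:
  assumes e: "\<And>i. i \<in> I \<Longrightarrow> e i \<in> X" and w: "w \<in> X"
  shows "\<beta> w (\<lambda>z. \<Sum>i\<in>I. c i * e i z) = (\<Sum>i\<in>I. c i * \<beta> w (e i))"
proof -
  have "\<beta> w (\<lambda>z. \<Sum>i\<in>I. c i * e i z) = \<beta> (\<lambda>z. \<Sum>i\<in>I. c i * e i z) w"
    by (rule psd_sym[OF w fun_subspace_sum[OF X e]])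
  also have "\<dots> = (\<Sum>i\<in>I. c i * \<beta> (e i) w)" by (rule psd_sum[OF e w])
  also have "\<dots> = (\<Sum>i\<in>I. c i * \<beta> w (e i))"
    by (rule sum.cong) (use psd_sym[OF e w] in auto)
  finally show ?thesis .
qed

lemma psd_expand:
  assumes e: "\<And>i. i \<in> I \<Longrightarrow> e i \<in> X"
  shows "\<beta> (\<lambda>z. \<Sum>i\<in>I. c i * e i z) (\<lambda>z. \<Sum>i\<in>I. d i * e i z)
    = (\<Sum>i\<in>I. \<Sum>j\<in>I. c i * d j * \<beta> (e i) (e j))"
proof -
  have "\<beta> (\<lambda>z. \<Sum>i\<in>I. c i * e i z) (\<lambda>z. \<Sum>i\<in>I. d i * e i z)
      = (\<Sum>i\<in>I. c i * \<beta> (e i) (\<lambda>z. \<Sum>i\<in>I. d i * e i z))"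
    by (rule psd_sum[OF e fun_subspace_sum[OF X e]])
  also have "\<dots> = (\<Sum>i\<in>I. c i * (\<Sum>j\<in>I. d j * \<beta> (e i) (e j)))"
  proof (rule sum.cong[OF refl])
    fix i assume "i \<in> I"
    then have "\<beta> (e i) (\<lambda>z. \<Sum>i\<in>I. d i * e i z) = (\<Sum>j\<in>I. d j * \<beta> (e i) (e j))"
      by (intro psd_sum_right e)
    then show "c i * \<beta> (e i) (\<lambda>z. \<Sum>i\<in>I. d i * e i z) = c i * (\<Sum>j\<in>I. d j * \<beta> (e i) (e j))" by simp
  qed
  finally show ?thesis by (simp add: sum_distrib_left mult.assoc)
qed

lemma psd_Cauchy_Schwarz:
  assumes u: "u \<in> X" and v: "v \<in> X"
  shows "(\<beta> u v)\<^sup>2 \<le> \<beta> u u * \<beta> v v"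
proof -
  have q: "0 \<le> \<beta> u u + 2 * t * \<beta> u v + t\<^sup>2 * \<beta> v v" for t
  proof -
    let ?w = "\<lambda>z. u z + t * v z"
    have tv: "(\<lambda>z. t * v z) \<in> X" and w: "?w \<in> X"
      using u v by (auto intro: fun_subspace_add[OF X] fun_subspace_cmult[OF X])
    have "\<beta> ?w ?w = \<beta> u ?w + t * \<beta> v ?w" using psd_add[OF u tv w] psd_cmult[OF v w] by simp
    also have "\<dots> = \<beta> u u + 2 * t * \<beta> u v + t\<^sup>2 * \<beta> v v"
      using psd_add_right[OF u tv u] psd_add_right[OF u tv v] psd_cmult_right[OF v u, of t]
        psd_cmult_right[OF v v, of t] psd_sym[OF u v]
      by (simp add: algebra_simps power2_eq_square)
    finally show ?thesis using psd_nonneg[OF w] by simp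
  qed
  show ?thesis
  proof (cases "\<beta> v v = 0")
    case False
    then have pos: "\<beta> v v > 0" using psd_nonneg[OF v] by simp
    have "0 \<le> \<beta> u u - (\<beta> u v)\<^sup>2 / \<beta> v v"
      using q[of "- \<beta> u v / \<beta> v v"] pos by (simp add: power2_eq_square field_simps)
    then show ?thesis using pos by (simp add: field_simps)
  next
    case True
    have "\<beta> u v = 0"
    proof (rule ccontr)
      assume n: "\<beta> u v \<noteq> 0"
      have "0 \<le> \<beta> u u + 2 * (- (\<beta> u u + 1) / (2 * \<beta> u v)) * \<beta> u v"
        using q[of "- (\<beta> u u + 1) / (2 * \<beta> u v)"] True by simp
      also have "\<dots> = - 1" using n by (simp add: field_simps)
      finally show False by simp
    qed
    then show ?thesis using True by simp
  qed
qed

end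

section \<open>Bochner spaces of functions with values in a finite-dimensional space\<close>

lemma simple_function_tuple:
  fixes f :: "'i \<Rightarrow> 't \<Rightarrow> real"
  assumes "finite I" "\<And>i. i \<in> I \<Longrightarrow> simple_function M (f i)"
  shows "simple_function M (\<lambda>t i. if i \<in> I then f i t else 0)"
  using assms
proof (induction I rule: finite_induct)
  case empty
  then show ?case by simp
next
  case (insert k I)
  have "(\<lambda>t i. if i \<in> insert k I then f i t else 0) = (\<lambda>t. (\<lambda>i. if i \<in> I then f i t else 0)(k := f k t))"
    by (auto simp: fun_eq_iff)
  moreover have "simple_function M (\<lambda>t. (\<lambda>i. if i \<in> I then f i t else 0)(k := f k t))"
    using insert by (intro simple_function_compose2[where h = "\<lambda>g y. g(k := y)"]) auto
  ultimately show ?case by simp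
qed

text \<open>Here \<open>h\<close> maps coordinates to elements of the space and \<open>Q\<close> is the Gram matrix of the norm \<open>N\<close>. Strong
  measurability follows by approximating each coordinate by simple functions. The same lemma
  is used with space (values in \<open>H1 Y\<close>) and with time as the base measure.\<close>

lemma bochner_L2_synthesis:
  fixes h :: "('i \<Rightarrow> real) \<Rightarrow> 'x::minus"
  assumes I: "finite I" and M: "finite_measure M" and hX: "\<And>d. h d \<in> X"
    and diff: "\<And>d d'. h d - h d' = h (\<lambda>i. d i - d' i)"
    and N: "\<And>d. N (h d) = sqrt (\<Sum>i\<in>I. \<Sum>j\<in>I. d i * d j * Q i j)"
    and c: "\<And>i. i \<in> I \<Longrightarrow> (\<lambda>t. c t i) \<in> borel_measurable M"
    and bnd: "\<And>i t. i \<in> I \<Longrightarrow> t \<in> space M \<Longrightarrow> \<bar>c t i\<bar> \<le> C"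
  shows "(\<lambda>t. h (c t)) \<in> bochner_L2 M X N"
proof -
  have "\<forall>i\<in>I. \<exists>s. (\<forall>n. simple_function M (s n)) \<and> (\<forall>t\<in>space M. (\<lambda>n. s n t) \<longlonglongrightarrow> c t i)"
  proof
    fix i assume "i \<in> I"
    from borel_measurable_implies_sequence_metric[OF c[OF this], of 0]
    show "\<exists>s. (\<forall>n. simple_function M (s n)) \<and> (\<forall>t\<in>space M. (\<lambda>n. s n t) \<longlonglongrightarrow> c t i)" by metis
  qed
  then obtain s where s: "\<And>i n. i \<in> I \<Longrightarrow> simple_function M (s i n)"
    "\<And>i t. i \<in> I \<Longrightarrow> t \<in> space M \<Longrightarrow> (\<lambda>n. s i n t) \<longlonglongrightarrow> c t i" by metis
  define S where "S n t = h (\<lambda>i. if i \<in> I then s i n t else 0)" for n t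
  have "simple_function M (S n)" for n
    unfolding S_def using simple_function_compose1[OF simple_function_tuple[OF I], of M "\<lambda>i. s i n" h] s(1)
    by auto
  moreover have "S n \<in> space M \<rightarrow> X" for n by (simp add: S_def hX)
  moreover have "(\<lambda>n. N (S n t - h (c t))) \<longlonglongrightarrow> 0" if t: "t \<in> space M" for t
  proof -
    have "N (S n t - h (c t)) = sqrt (\<Sum>i\<in>I. \<Sum>j\<in>I. (s i n t - c t i) * (s j n t - c t j) * Q i j)" for n
      unfolding S_def diff N by (intro arg_cong[where f = sqrt] sum.cong) auto
    moreover have "(\<lambda>n. sqrt (\<Sum>i\<in>I. \<Sum>j\<in>I. (s i n t - c t i) * (s j n t - c t j) * Q i j))
        \<longlonglongrightarrow> sqrt (\<Sum>i\<in>I. \<Sum>j\<in>I. (c t i - c t i) * (c t j - c t j) * Q i j)"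
      by (intro tendsto_intros s(2) t)
    ultimately show ?thesis by simp
  qed
  moreover have "integrable M (\<lambda>t. (N (h (c t)))\<^sup>2)"
  proof -
    have int: "integrable M (\<lambda>t. c t i * c t j * Q i j)" if i: "i \<in> I" and j: "j \<in> I" for i j
    proof (rule finite_measure.integrable_const_bound[OF M, of _ "\<bar>C\<bar> * \<bar>C\<bar> * \<bar>Q i j\<bar>"])
      show "AE t in M. norm (c t i * c t j * Q i j) \<le> \<bar>C\<bar> * \<bar>C\<bar> * \<bar>Q i j\<bar>"
      proof (rule AE_I2)
        fix t assume t: "t \<in> space M"
        show "norm (c t i * c t j * Q i j) \<le> \<bar>C\<bar> * \<bar>C\<bar> * \<bar>Q i j\<bar>"
          using bnd[OF i t] bnd[OF j t] by (simp add: abs_mult mult_mono mult_right_mono)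
      qed
      show "(\<lambda>t. c t i * c t j * Q i j) \<in> borel_measurable M"
        using c[OF i] c[OF j] by measurable
    qed
    have "(N (h (c t)))\<^sup>2 = \<bar>\<Sum>i\<in>I. \<Sum>j\<in>I. c t i * c t j * Q i j\<bar>" for t
      unfolding N power2_eq_square by (rule real_sqrt_mult_self)
    moreover have "integrable M (\<lambda>t. \<bar>\<Sum>i\<in>I. \<Sum>j\<in>I. c t i * c t j * Q i j\<bar>)"
      by (intro integrable_abs Bochner_Integration.integrable_sum int)
    ultimately show ?thesis by simp
  qed
  ultimately show ?thesis
    unfolding bochner_L2_def using hX by (auto intro!: exI[of _ S] AE_I2)
qed

lemma has_weak_partial_cong_AE:
  fixes u w :: "'a::euclidean_space \<Rightarrow> real"
  assumes U: "open U" and b: "b \<in> Basis" and weak: "has_weak_partial U b u v"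
    and ae: "AE x in lebesgue_on U. u x = w x"
  shows "has_weak_partial U b w v"
proof -
  have U': "U \<in> sets lebesgue" using U by auto
  have aeU: "AE x in lebesgue. x \<in> U \<longrightarrow> u x = w x"
    using ae U' by (simp add: AE_restrict_space_iff)
  have loc: "locally_integrable U w"
    unfolding locally_integrable_def
  proof (intro allI impI)
    fix K assume K: "compact K \<and> K \<subseteq> U"
    then have K': "K \<in> sets lebesgue" by (auto intro: fmeasurableD lmeasurable_compact)
    have i: "integrable (lebesgue_on K) u"
      using weak K unfolding has_weak_partial_def locally_integrable_def by blast
    have "AE x in lebesgue. x \<in> K \<longrightarrow> w x = u x" using aeU by eventually_elim (use K in auto)
    then have a: "AE x in lebesgue_on K. w x = u x" using K' by (simp add: AE_restrict_space_iff)
    have m: "w \<in> borel_measurable (lebesgue_on K)"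
      by (rule borel_measurable_lebesgue_on_AE[OF K' borel_measurable_integrable[OF i] a])
    show "integrable (lebesgue_on K) w"
      using integrable_cong_AE[OF m borel_measurable_integrable[OF i] a] i by simp
  qed
  have "(LINT x|lebesgue_on U. w x * frechet_derivative \<phi> (at x) b)
      = (LINT x|lebesgue_on U. u x * frechet_derivative \<phi> (at x) b)" if \<phi>: "test_function U \<phi>" for \<phi>
  proof (rule integral_lebesgue_on_cong_AE[OF U'])
    have "locally_integrable U u" using weak by (simp add: has_weak_partial_def)
    from integrable_times_test[OF this U test_partial[OF \<phi> b]]
    show "(\<lambda>x. u x * frechet_derivative \<phi> (at x) b) \<in> borel_measurable (lebesgue_on U)"
      by (rule borel_measurable_integrable)
    show "AE x in lebesgue_on U. w x * frechet_derivative \<phi> (at x) b = u x * frechet_derivative \<phi> (at x) b"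
      using ae by eventually_elim simp
  qed
  then show ?thesis using weak loc unfolding has_weak_partial_def by simp
qed

text \<open>A nonempty open set is not negligible.\<close>

lemma AE_zero_continuous:
  fixes g :: "'a::euclidean_space \<Rightarrow> real"
  assumes U: "open U" and g: "continuous_on U g" and ae: "AE x in lebesgue_on U. g x = 0" and x: "x \<in> U"
  shows "g x = 0"
proof (rule ccontr)
  assume n: "g x \<noteq> 0"
  define S where "S = U \<inter> g -` (- {0})"
  have S: "open S" unfolding S_def by (rule continuous_open_preimage[OF g U]) auto
  have "AE x in lebesgue. x \<notin> S"
    using ae U unfolding S_def by (simp add: AE_restrict_space_iff) 
  then have "S \<in> null_sets lebesgue"
    using AE_iff_null_sets[of S lebesgue] S by auto
  then have "negligible S" by (simp add: negligible_iff_null_sets)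
  moreover have "S \<noteq> {}" using x n by (auto simp: S_def)
  ultimately show False using open_not_negligible[OF S] by blast
qed

section \<open>Integral forms on finite element spaces\<close>

definition mass_form :: "'a::euclidean_space set \<Rightarrow> ('a \<Rightarrow> real) \<Rightarrow> ('a \<Rightarrow> real) \<Rightarrow> real" where
  "mass_form U u v = (LINT x|lebesgue_on U. u x * v x)"

definition stiffness_form :: "'a::euclidean_space set \<Rightarrow> ('a \<Rightarrow> real) \<Rightarrow> ('a \<Rightarrow> real) \<Rightarrow> real" where
  "stiffness_form U u v = (LINT x|lebesgue_on U. weak_grad U u x \<bullet> weak_grad U v x)"

definition boundary_form :: "'a::euclidean_space set \<Rightarrow> 'a set \<Rightarrow> ('a \<Rightarrow> real) \<Rightarrow> ('a \<Rightarrow> real) \<Rightarrow> real" where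
  "boundary_form U \<Gamma> u v = (LINT y|restrict_space (surface_measure U) \<Gamma>. u y * v y)"

lemma integrable_continuous_closure:
  fixes g :: "'a::euclidean_space \<Rightarrow> real"
  assumes U: "open U" "bounded U" and g: "continuous_on (closure U) g"
  shows "integrable (lebesgue_on U) g"
proof -
  have "bounded (g ` closure U)"
    by (intro compact_imp_bounded compact_continuous_image g) (simp add: U)
  then obtain C where C: "\<forall>x\<in>closure U. \<bar>g x\<bar> \<le> C" by (auto simp: bounded_iff)
  show ?thesis
  proof (rule integrable_bounded_lebesgue_on[OF U])
    show "g \<in> borel_measurable (lebesgue_on U)"
      using U by (intro continuous_imp_measurable_on_sets_lebesgue continuous_on_subset[OF g closure_subset]) auto
    show "AE x in lebesgue_on U. norm (g x) \<le> C"
      by (rule AE_I2) (use C closure_subset in auto)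
  qed
qed

lemma sets_surface_measure [simp]: "sets (surface_measure U) = sets borel"
  unfolding surface_measure_def by (simp add: sets.sigma_sets_eq[of borel, simplified])

lemma space_surface_measure [simp]: "space (surface_measure U) = UNIV"
  unfolding surface_measure_def by (simp add: space_measure_of_conv)

text \<open>Each prism over a subset of a facet is bounded. The estimate holds whether or not the set function defining
  the surface measure is countably additive: if it is not, then \<open>measure_of\<close> yields the zero measure.\<close>

lemma emeasure_surface_measure_finite:
  assumes "bounded U"
  shows "emeasure (surface_measure U) E < \<infinity>"
proof -
  let ?prism = "\<lambda>F. {x + t *\<^sub>R facet_normal F | x t. x \<in> E \<inter> F \<and> t \<in> {0..1}}"
  obtain B where B: "\<And>x. x \<in> closure U \<Longrightarrow> norm x \<le> B"
    using assms bounded_closure by (metis bounded_iff)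
  have "emeasure lborel (?prism F) < \<infinity>" if "F facet_of closure U" for F
  proof -
    have F: "F \<subseteq> closure U" using that by (rule facet_of_imp_subset)
    have "bounded (?prism F)"
    proof (rule boundedI)
      fix z assume "z \<in> ?prism F"
      then obtain x t where z: "z = x + t *\<^sub>R facet_normal F" "x \<in> F" "t \<in> {0..1}" by auto
      have "norm z \<le> norm x + t * norm (facet_normal F)" 
        using norm_triangle_ineq[of x "t *\<^sub>R facet_normal F"] z by simp
      also have "\<dots> \<le> B + 1 * norm (facet_normal F)"
        using B[of x] F z by (intro add_mono mult_right_mono) auto
      finally show "norm z \<le> B + 1 * norm (facet_normal F)" .
    qed
    then show ?thesis by (rule emeasure_bounded_finite)
  qed
  then have "(\<Sum>F | F facet_of closure U. emeasure lborel (?prism F)) < \<infinity>"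
    by (cases "finite {F. F facet_of closure U}") (auto simp: less_top[symmetric])
  then show ?thesis
    unfolding surface_measure_def emeasure_measure_of_conv by auto
qed

lemma AE_bounded_inner_integrable:
  fixes F G :: "'a::euclidean_space \<Rightarrow> 'b::euclidean_space"
  assumes U: "open U" "bounded U" and F: "F \<in> borel_measurable (lebesgue_on U)" "AE x in lebesgue_on U. norm (F x) \<le> C"
    and G: "G \<in> borel_measurable (lebesgue_on U)" "AE x in lebesgue_on U. norm (G x) \<le> D"
  shows "integrable (lebesgue_on U) (\<lambda>x. F x \<bullet> G x)"
proof (rule integrable_bounded_lebesgue_on[OF U])
  show "(\<lambda>x. F x \<bullet> G x) \<in> borel_measurable (lebesgue_on U)" using F(1) G(1) by measurable
  show "AE x in lebesgue_on U. norm (F x \<bullet> G x) \<le> C * D"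
    using F(2) G(2)
  proof eventually_elim
    case (elim x)
    have "norm (F x \<bullet> G x) \<le> norm (F x) * norm (G x)" using Cauchy_Schwarz_ineq2 by simp
    also have "\<dots> \<le> C * D" using elim by (intro mult_mono) (auto intro: order_trans[OF norm_ge_zero])
    finally show ?case .
  qed
qed

context
  fixes U :: "'a::euclidean_space set" and H :: real and \<B> :: "'a set set"
  assumes U: "convex_polytopal_domain U" and mesh: "simplicial_partition U H \<B>"
begin

lemmas dom = domain[OF U mesh]

lemma P1_subspace: "fun_subspace (P1_space U \<B>)"
  unfolding fun_subspace_def using P1_zero[OF U mesh] P1_add[OF U mesh] P1_cmult[OF U mesh] by blast

lemma P1_subspace0: "fun_subspace (P1_space0 U \<B>)"
  using P1_subspace unfolding fun_subspace_def P1_space0_def by auto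

lemma P1_zero_on_domain:
  assumes v: "v \<in> P1_space U \<B>" and 0: "\<And>x. x \<in> U \<Longrightarrow> v x = 0"
  shows "v = (\<lambda>x. 0)"
proof
  fix x
  show "v x = 0"
  proof (cases "x \<in> closure U")
    case True
    show ?thesis by (rule continuous_constant_on_closure[OF P1_cont[OF U mesh v] 0 True])
  qed (simp add: P1_outside[OF U mesh v])
qed

lemma P1_bounded:
  assumes v: "v \<in> P1_space U \<B>"
  obtains C where "\<And>x. \<bar>v x\<bar> \<le> C"
proof -
  have "bounded (v ` closure U)"
    by (intro compact_imp_bounded compact_continuous_image P1_cont[OF U mesh v] dom(5))
  then obtain C where C: "\<forall>x\<in>closure U. \<bar>v x\<bar> \<le> C" by (auto simp: bounded_iff)
  have "\<bar>v x\<bar> \<le> max C 0" for x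
    using C P1_outside[OF U mesh v, of x] by (cases "x \<in> closure U") (auto simp: le_max_iff_disj)
  then show ?thesis using that by blast
qed

lemma P1_borel:
  assumes v: "v \<in> P1_space U \<B>"
  shows "v \<in> borel_measurable borel"
proof -
  have "(\<lambda>x. indicator (closure U) x *\<^sub>R v x) \<in> borel_measurable borel"
    by (rule borel_measurable_continuous_on_indicator[OF _ P1_cont[OF U mesh v]]) simp
  moreover have "(\<lambda>x. indicator (closure U) x *\<^sub>R v x) = v"
    using P1_outside[OF U mesh v] by (auto simp: indicator_def fun_eq_iff)
  ultimately show ?thesis by simp
qed

lemma P1_mult_integrable:
  assumes "u \<in> P1_space U \<B>" "v \<in> P1_space U \<B>"
  shows "integrable (lebesgue_on U) (\<lambda>x. u x * v x)"
  by (intro integrable_continuous_closure dom continuous_on_mult P1_cont[OF U mesh] assms)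

lemma psd_mass_form: "psd_form (P1_space U \<B>) (mass_form U)"
  unfolding psd_form_def mass_form_def
proof (intro conjI ballI allI)
  fix u v :: "'a \<Rightarrow> real"
  show "(LINT x|lebesgue_on U. u x * v x) = (LINT x|lebesgue_on U. v x * u x)"
    by (simp add: mult.commute)
qed (simp_all add: distrib_right P1_mult_integrable mult.assoc integral_nonneg_AE)

lemma mass_form_zero:
  assumes v: "v \<in> P1_space U \<B>" and 0: "mass_form U v v = 0"
  shows "v = (\<lambda>x. 0)"
proof (rule P1_zero_on_domain[OF v])
  fix x assume x: "x \<in> U"
  have c: "continuous_on U (\<lambda>x. v x * v x)"
    by (intro continuous_on_mult continuous_on_subset[OF P1_cont[OF U mesh v] closure_subset])
  have "AE x in lebesgue_on U. v x * v x = 0"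
    using 0 integral_nonneg_eq_0_iff_AE[OF P1_mult_integrable[OF v v]] by (simp add: mass_form_def)
  from AE_zero_continuous[OF dom(1) c this x] show "v x = 0" by simp
qed

lemma P1_weak_grad:
  assumes v: "v \<in> P1_space U \<B>"
  shows "has_weak_gradient U v (weak_grad U v)" "weak_grad U v \<in> borel_measurable (lebesgue_on U)"
    "\<exists>C. AE x in lebesgue_on U. norm (weak_grad U v x) \<le> C"
proof -
  obtain G C where G: "has_weak_gradient U v G" "G \<in> borel_measurable (lebesgue_on U)"
    "AE x in lebesgue_on U. norm (G x) \<le> C" by (rule P1_weak_gradient[OF U mesh v])
  note ae = AE_weak_grad[OF dom(1) G(1)]
  show "has_weak_gradient U v (weak_grad U v)"
    unfolding weak_grad_def using someI[of "has_weak_gradient U v", OF G(1)] .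
  show "weak_grad U v \<in> borel_measurable (lebesgue_on U)"
    using dom(1) by (intro borel_measurable_lebesgue_on_AE[OF _ G(2) ae]) auto
  have "AE x in lebesgue_on U. norm (weak_grad U v x) \<le> C"
    using ae G(3) by eventually_elim simp
  then show "\<exists>C. AE x in lebesgue_on U. norm (weak_grad U v x) \<le> C" ..
qed

lemma weak_grad_inner_integrable:
  assumes "u \<in> P1_space U \<B>" "v \<in> P1_space U \<B>"
  shows "integrable (lebesgue_on U) (\<lambda>x. weak_grad U u x \<bullet> weak_grad U v x)"
  using P1_weak_grad[OF assms(1)] P1_weak_grad[OF assms(2)]
    AE_bounded_inner_integrable[OF dom(1) dom(3)] by blast

text \<open>Bilinearity holds because weak gradients are additive and homogeneous almost everywhere.\<close>

lemma psd_stiffness_form: "psd_form (P1_space U \<B>) (stiffness_form U)"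
  unfolding psd_form_def
proof (intro conjI ballI allI)
  have U': "U \<in> sets lebesgue" using dom(1) by auto
  fix u assume u: "u \<in> P1_space U \<B>"
  show "stiffness_form U u u \<ge> 0" unfolding stiffness_form_def by (intro integral_nonneg_AE) auto
  fix w assume w: "w \<in> P1_space U \<B>"
  show "stiffness_form U u w = stiffness_form U w u" unfolding stiffness_form_def by (simp add: inner_commute)
  note iw = weak_grad_inner_integrable[OF _ w]
  show "stiffness_form U (\<lambda>z. c * u z) w = c * stiffness_form U u w" for c
  proof -
    have ae: "AE x in lebesgue_on U. weak_grad U (\<lambda>z. c * u z) x = c *\<^sub>R weak_grad U u x"
      by (rule AE_weak_grad[OF dom(1) has_weak_gradient_cmult[OF P1_weak_grad(1)[OF u]]])
    have "stiffness_form U (\<lambda>z. c * u z) w = (LINT x|lebesgue_on U. c * (weak_grad U u x \<bullet> weak_grad U w x))"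
      unfolding stiffness_form_def
    proof (rule integral_lebesgue_on_cong_AE[OF U'])
      show "(\<lambda>x. c * (weak_grad U u x \<bullet> weak_grad U w x)) \<in> borel_measurable (lebesgue_on U)"
        using iw[OF u] by auto
      show "AE x in lebesgue_on U. weak_grad U (\<lambda>z. c * u z) x \<bullet> weak_grad U w x
          = c * (weak_grad U u x \<bullet> weak_grad U w x)" using ae by eventually_elim simp
    qed
    then show ?thesis by (simp add: stiffness_form_def)
  qed
  fix v assume v: "v \<in> P1_space U \<B>"
  show "stiffness_form U (\<lambda>z. u z + w z) v = stiffness_form U u v + stiffness_form U w v"
  proof -
    have ae: "AE x in lebesgue_on U. weak_grad U (\<lambda>z. u z + w z) x = weak_grad U u x + weak_grad U w x"
      by (rule AE_weak_grad[OF dom(1) has_weak_gradient_add[OF dom(1) P1_weak_grad(1)[OF u] P1_weak_grad(1)[OF w]]])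
    have i: "integrable (lebesgue_on U) (\<lambda>x. weak_grad U u x \<bullet> weak_grad U v x + weak_grad U w x \<bullet> weak_grad U v x)"
      using weak_grad_inner_integrable[OF u v] weak_grad_inner_integrable[OF w v] by auto
    have "stiffness_form U (\<lambda>z. u z + w z) v
        = (LINT x|lebesgue_on U. weak_grad U u x \<bullet> weak_grad U v x + weak_grad U w x \<bullet> weak_grad U v x)"
      unfolding stiffness_form_def
      by (rule integral_lebesgue_on_cong_AE[OF U' borel_measurable_integrable[OF i]])
         (use ae in eventually_elim, simp add: inner_add_left)
    then show ?thesis
      using weak_grad_inner_integrable[OF u v] weak_grad_inner_integrable[OF w v]
      by (simp add: stiffness_form_def)
  qed
qed

lemma H1_norm_P1:
  assumes "v \<in> P1_space U \<B>"
  shows "H1_norm U v = sqrt (mass_form U v v + stiffness_form U v v)"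
  unfolding H1_norm_def mass_form_def stiffness_form_def
  by (simp add: power2_eq_square[of "v _"] power2_norm_eq_inner)

lemma P1_boundary_mult_integrable:
  assumes \<Gamma>: "\<Gamma> \<in> sets borel" and u: "u \<in> P1_space U \<B>" and v: "v \<in> P1_space U \<B>"
  shows "integrable (restrict_space (surface_measure U) \<Gamma>) u"
    "integrable (restrict_space (surface_measure U) \<Gamma>) (\<lambda>y. u y * v y)"
proof -
  have fin: "finite_measure (restrict_space (surface_measure U) \<Gamma>)"
    using emeasure_surface_measure_finite[OF dom(3), of \<Gamma>] \<Gamma>
    by (intro finite_measureI) (simp add: emeasure_restrict_space space_restrict_space)
  obtain C where C: "\<And>x. \<bar>u x\<bar> \<le> C" using P1_bounded[OF u] by metis
  obtain D where D: "\<And>x. \<bar>v x\<bar> \<le> D" using P1_bounded[OF v] by metis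
  have m: "w \<in> borel_measurable (restrict_space (surface_measure U) \<Gamma>)" if "w \<in> P1_space U \<B>" for w
    by (rule measurable_restrict_space1) (simp add: P1_borel[OF that] measurable_cong_sets[OF sets_surface_measure refl])
  show "integrable (restrict_space (surface_measure U) \<Gamma>) u"
    by (rule finite_measure.integrable_const_bound[OF fin, of _ C]) (use m[OF u] C in auto)
  have "\<bar>u y * v y\<bar> \<le> C * D" for y
    unfolding abs_mult using C[of y] D[of y] by (intro mult_mono) auto
  then show "integrable (restrict_space (surface_measure U) \<Gamma>) (\<lambda>y. u y * v y)"
    using m[OF u] m[OF v] by (intro finite_measure.integrable_const_bound[OF fin, of _ "C * D"]) auto
qed

lemma psd_boundary_form:
  assumes \<Gamma>: "\<Gamma> \<in> sets borel"
  shows "psd_form (P1_space U \<B>) (boundary_form U \<Gamma>)"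
  unfolding psd_form_def boundary_form_def
proof (intro conjI ballI allI)
  let ?M = "restrict_space (surface_measure U) \<Gamma>"
  fix u v :: "'a \<Rightarrow> real"
  show "(LINT y|?M. u y * v y) = (LINT y|?M. v y * u y)" by (simp add: mult.commute)
qed (simp_all add: distrib_right P1_boundary_mult_integrable(2)[OF \<Gamma>] mult.assoc integral_nonneg_AE)

text \<open>The constant function 1, extended by 0. It turns the linear boundary load into a value of the
  bilinear boundary form.\<close>

lemma indicator_closure_P1: "indicator (closure U) \<in> P1_space U \<B>"
  unfolding P1_space_def
proof (intro CollectI conjI ballI)
  show "continuous_on (closure U) (indicator (closure U))"
    by (rule continuous_on_eq[of _ "\<lambda>x. 1"]) auto
  fix B assume "B \<in> \<B>"
  then show "\<exists>a c. \<forall>x\<in>B. indicator (closure U) x = a \<bullet> x + c"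
    using cell(3)[OF U mesh] by (intro exI[of _ 0] exI[of _ 1]) (auto simp: indicator_def)
qed auto

end

section \<open>Tensor product spaces\<close>

lemma tensor_spanE:
  assumes "u \<in> tensor_span V W"
  obtains n c X E where "u = (\<lambda>x y. \<Sum>i<(n::nat). c i * (X i x * E i y))"
    "\<And>i. i < n \<Longrightarrow> X i \<in> V" "\<And>i. i < n \<Longrightarrow> E i \<in> W"
  using assms unfolding tensor_span_def by auto

lemma tensor_span_zero: "(\<lambda>x y. 0) \<in> tensor_span V W"
  unfolding tensor_span_def by (intro CollectI exI[of _ 0]) auto

lemma tensor_span_add_elementary:
  assumes u: "u \<in> tensor_span V W" and "\<xi> \<in> V" "\<eta> \<in> W"
  shows "(\<lambda>x y. u x y + k * (\<xi> x * \<eta> y)) \<in> tensor_span V W"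
proof -
  obtain n :: nat and c X Y where n: "u = (\<lambda>x y. \<Sum>i<n. c i * (X i x * Y i y))"
    "\<And>i. i < n \<Longrightarrow> X i \<in> V" "\<And>i. i < n \<Longrightarrow> Y i \<in> W"
    by (rule tensor_spanE[OF u]) blast
  show ?thesis
    unfolding tensor_span_def
    by (intro CollectI exI[of _ "Suc n"] exI[of _ "c(n := k)"] exI[of _ "X(n := \<xi>)"] exI[of _ "Y(n := \<eta>)"])
       (use n assms in \<open>auto simp: less_Suc_eq\<close>)
qed

lemma tensor_span_induct [consumes 1, case_names zero add]:
  assumes u: "u \<in> tensor_span V W" and 0: "P (\<lambda>x y. 0)"
    and step: "\<And>u \<xi> \<eta> k. u \<in> tensor_span V W \<Longrightarrow> P u \<Longrightarrow> \<xi> \<in> V \<Longrightarrow> \<eta> \<in> W \<Longrightarrow>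
       P (\<lambda>x y. u x y + k * (\<xi> x * \<eta> y))"
  shows "P u"
proof -
  obtain n :: nat and c X Y where n: "u = (\<lambda>x y. \<Sum>i<n. c i * (X i x * Y i y))"
    "\<And>i. i < n \<Longrightarrow> X i \<in> V" "\<And>i. i < n \<Longrightarrow> Y i \<in> W"
    by (rule tensor_spanE[OF u]) blast
  have "(\<lambda>x y. \<Sum>i<m. c i * (X i x * Y i y)) \<in> tensor_span V W \<and> P (\<lambda>x y. \<Sum>i<m. c i * (X i x * Y i y))"
    if "m \<le> n" for m
    using that
  proof (induction m)
    case 0
    then show ?case using tensor_span_zero "0.prems" assms(2) by simp
  next
    case (Suc m)
    then show ?case
      using n(2,3)[of m] step[of "\<lambda>x y. \<Sum>i<m. c i * (X i x * Y i y)" "X m" "Y m" "c m"]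
        tensor_span_add_elementary[of "\<lambda>x y. \<Sum>i<m. c i * (X i x * Y i y)" V W "X m" "Y m" "c m"]
      by simp
  qed
  then show ?thesis using n(1) by blast
qed

lemma tensor_span_add:
  assumes u: "u \<in> tensor_span V W" and v: "v \<in> tensor_span V W"
  shows "(\<lambda>x y. u x y + v x y) \<in> tensor_span V W"
  using v
proof (induction v rule: tensor_span_induct)
  case zero
  then show ?case using u by simp
next
  case (add v \<xi> \<eta> k)
  from tensor_span_add_elementary[OF add.IH add.hyps(2,3), of k] show ?case by (simp add: add.assoc)
qed

lemma tensor_span_cmult:
  assumes u: "u \<in> tensor_span V W"
  shows "(\<lambda>x y. c * u x y) \<in> tensor_span V W"
  using u
proof (induction u rule: tensor_span_induct)
  case zero
  then show ?case using tensor_span_zero by simp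
next
  case (add u \<xi> \<eta> k)
  from tensor_span_add_elementary[OF add.IH add.hyps(2,3), of "c * k"] show ?case
    by (simp add: distrib_left mult.assoc)
qed

text \<open>Uncurried elements of the tensor product, to which the theory of function spaces on a single
  set of points applies.\<close>

definition tensor_pairs :: "('a \<Rightarrow> real) set \<Rightarrow> ('b \<Rightarrow> real) set \<Rightarrow> ('a \<times> 'b \<Rightarrow> real) set" where
  "tensor_pairs V W = {p. (\<lambda>x y. p (x, y)) \<in> tensor_span V W}"

lemma tensor_pairs_subspace: "fun_subspace (tensor_pairs V W)"
  unfolding fun_subspace_def tensor_pairs_def
  by (auto simp: tensor_span_zero tensor_span_add tensor_span_cmult)

lemma tensor_slice_right:
  assumes W: "fun_subspace W" and u: "u \<in> tensor_span V W"
  shows "u x \<in> W"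
  using u
proof (induction u rule: tensor_span_induct)
  case zero
  then show ?case using fun_subspace_zero[OF W] by simp
next
  case (add u \<xi> \<eta> k)
  have "(\<lambda>y. u x y + (k * \<xi> x) * \<eta> y) \<in> W"
    by (intro fun_subspace_add[OF W] fun_subspace_cmult[OF W]) (use add in auto)
  then show ?case by (simp add: mult.assoc)
qed

lemma tensor_slice_left:
  assumes V: "fun_subspace V" and u: "u \<in> tensor_span V W"
  shows "(\<lambda>x. u x y) \<in> V"
  using u
proof (induction u rule: tensor_span_induct)
  case zero
  then show ?case using fun_subspace_zero[OF V] by simp
next
  case (add u \<xi> \<eta> k)
  have "(\<lambda>x. u x y + (k * \<eta> y) * \<xi> x) \<in> V"
    by (intro fun_subspace_add[OF V] fun_subspace_cmult[OF V]) (use add in auto)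
  then show ?case by (simp add: mult_ac)
qed

text \<open>All bilinear forms of the density equation arise from a form on functions of \<open>y\<close> by integrating
  over \<open>x\<close>.\<close>

definition slice_form ::
  "'a::euclidean_space set \<Rightarrow> (('b \<Rightarrow> real) \<Rightarrow> ('b \<Rightarrow> real) \<Rightarrow> real) \<Rightarrow>
     ('a \<times> 'b \<Rightarrow> real) \<Rightarrow> ('a \<times> 'b \<Rightarrow> real) \<Rightarrow> real" where
  "slice_form \<Omega> \<beta> p q = (LINT x|lebesgue_on \<Omega>. \<beta> (\<lambda>y. p (x, y)) (\<lambda>y. q (x, y)))"

context
  fixes \<Omega> :: "'a::euclidean_space set" and V :: "('a \<Rightarrow> real) set" and W :: "('b \<Rightarrow> real) set"
    and \<beta> :: "('b \<Rightarrow> real) \<Rightarrow> ('b \<Rightarrow> real) \<Rightarrow> real"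
  assumes \<Omega>: "open \<Omega>" "bounded \<Omega>" and V: "\<And>v. v \<in> V \<Longrightarrow> continuous_on (closure \<Omega>) v"
    and W: "fun_subspace W" and \<beta>: "psd_form W \<beta>"
begin

text \<open>The integrand over \<open>x\<close> is a finite sum of products of functions in \<open>V\<close>. Its continuity makes
  all outer integrals linear.\<close>

lemma slice_form_continuous1:
  assumes w: "w \<in> W" and u: "u \<in> tensor_span V W"
  shows "continuous_on (closure \<Omega>) (\<lambda>x. \<beta> (u x) w)"
  using u
proof (induction u rule: tensor_span_induct)
  case zero
  then show ?case by (simp add: psd_zero[OF W \<beta> w])
next
  case (add u \<xi> \<eta> k)
  have "\<beta> (\<lambda>y. u x y + k * (\<xi> x * \<eta> y)) w = \<beta> (u x) w + (k * \<xi> x) * \<beta> \<eta> w" for x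
    using psd_add[OF W \<beta> tensor_slice_right[OF W add.hyps(1), of x] fun_subspace_cmult[OF W add.hyps(3), of "k * \<xi> x"] w]
      psd_cmult[OF W \<beta> add.hyps(3) w, of "k * \<xi> x"] by (simp add: mult.assoc)
  then show ?case using add.IH V[OF add.hyps(2)] by (auto intro!: continuous_intros)
qed

lemma slice_form_continuous:
  assumes u: "u \<in> tensor_span V W" and v: "v \<in> tensor_span V W"
  shows "continuous_on (closure \<Omega>) (\<lambda>x. \<beta> (u x) (v x))"
  using v
proof (induction v rule: tensor_span_induct)
  case zero
  have "\<beta> (u x) (\<lambda>y. 0) = 0" for x
    using psd_zero[OF W \<beta> tensor_slice_right[OF W u]]
      psd_sym[OF W \<beta> fun_subspace_zero[OF W] tensor_slice_right[OF W u]] by simp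
  then show ?case by simp
next
  case (add v \<xi> \<eta> k)
  have "\<beta> (u x) (\<lambda>y. v x y + k * (\<xi> x * \<eta> y)) = \<beta> (u x) (v x) + (k * \<xi> x) * \<beta> (u x) \<eta>" for x
    using psd_add_right[OF W \<beta> tensor_slice_right[OF W add.hyps(1), of x]
        fun_subspace_cmult[OF W add.hyps(3), of "k * \<xi> x"] tensor_slice_right[OF W u, of x]]
      psd_cmult_right[OF W \<beta> add.hyps(3) tensor_slice_right[OF W u, of x], of "k * \<xi> x"]
    by (simp add: mult.assoc)
  then show ?case using add.IH V[OF add.hyps(2)] slice_form_continuous1[OF add.hyps(3) u]
    by (auto intro!: continuous_intros)
qed

lemma psd_slice_form: "psd_form (tensor_pairs V W) (slice_form \<Omega> \<beta>)"
  unfolding psd_form_def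
proof (intro conjI ballI allI)
  have int: "integrable (lebesgue_on \<Omega>) (\<lambda>x. \<beta> (\<lambda>y. p (x, y)) (\<lambda>y. q (x, y)))"
    if "p \<in> tensor_pairs V W" "q \<in> tensor_pairs V W" for p q
    using that by (intro integrable_continuous_closure[OF \<Omega>] slice_form_continuous) (simp_all add: tensor_pairs_def)
  have sl: "(\<lambda>y. p (x, y)) \<in> W" if "p \<in> tensor_pairs V W" for p x
    using tensor_slice_right[OF W, of "\<lambda>x y. p (x, y)" V x] that by (simp add: tensor_pairs_def)
  fix p assume p: "p \<in> tensor_pairs V W"
  show "slice_form \<Omega> \<beta> p p \<ge> 0"
    unfolding slice_form_def by (intro integral_nonneg_AE AE_I2 psd_nonneg[OF W \<beta>] sl p)
  fix q assume q: "q \<in> tensor_pairs V W"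
  show "slice_form \<Omega> \<beta> p q = slice_form \<Omega> \<beta> q p"
    unfolding slice_form_def
    by (intro Bochner_Integration.integral_cong refl psd_sym[OF W \<beta>] sl p q)
  show "slice_form \<Omega> \<beta> (\<lambda>z. c * p z) q = c * slice_form \<Omega> \<beta> p q" for c
    unfolding slice_form_def psd_cmult[OF W \<beta> sl[OF p] sl[OF q]] by simp
  fix r assume r: "r \<in> tensor_pairs V W"
  show "slice_form \<Omega> \<beta> (\<lambda>z. p z + q z) r = slice_form \<Omega> \<beta> p r + slice_form \<Omega> \<beta> q r"
    unfolding slice_form_def psd_add[OF W \<beta> sl[OF p] sl[OF q] sl[OF r]]
    by (rule Bochner_Integration.integral_add[OF int[OF p r] int[OF q r]])
qed

lemma slice_integral_sum:
  assumes e: "\<And>i. i \<in> I \<Longrightarrow> e i \<in> tensor_pairs V W" and w: "w \<in> W"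
  shows "(LINT x|lebesgue_on \<Omega>. \<beta> (\<lambda>y. \<Sum>i\<in>I. c i * e i (x, y)) w)
     = (\<Sum>i\<in>I. c i * (LINT x|lebesgue_on \<Omega>. \<beta> (\<lambda>y. e i (x, y)) w))"
proof -
  have sl: "(\<lambda>y. e i (x, y)) \<in> W" if "i \<in> I" for i x
    using tensor_slice_right[OF W, of "\<lambda>x y. e i (x, y)" V x] e[OF that] by (simp add: tensor_pairs_def)
  have int: "integrable (lebesgue_on \<Omega>) (\<lambda>x. \<beta> (\<lambda>y. e i (x, y)) w)" if "i \<in> I" for i
    using e[OF that] w by (intro integrable_continuous_closure[OF \<Omega>] slice_form_continuous1) (simp_all add: tensor_pairs_def)
  have "\<beta> (\<lambda>y. \<Sum>i\<in>I. c i * e i (x, y)) w = (\<Sum>i\<in>I. c i * \<beta> (\<lambda>y. e i (x, y)) w)" for x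
    using psd_sum[OF W \<beta>, of I "\<lambda>i y. e i (x, y)" w c] sl w by blast
  then show ?thesis using int by (simp add: Bochner_Integration.integral_sum)
qed

end

text \<open>Positive definiteness of the mass matrix: the inner integral is continuous in \<open>x\<close>, so it vanishes
  on all of \<open>\<Omega>\<close>.\<close>

lemma slice_form_mass_zero:
  assumes \<Omega>: "convex_polytopal_domain \<Omega>" "simplicial_partition \<Omega> H \<B>"
    and Y: "convex_polytopal_domain Y" "simplicial_partition Y h \<K>"
    and p: "p \<in> tensor_pairs (P1_space0 \<Omega> \<B>) (P1_space Y \<K>)"
    and 0: "slice_form \<Omega> (mass_form Y) p p = 0"
  shows "p = (\<lambda>z. 0)"
proof -
  let ?V = "P1_space0 \<Omega> \<B>" and ?W = "P1_space Y \<K>"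
  note dom = domain[OF \<Omega>]
  note W = P1_subspace[OF Y] and m = psd_mass_form[OF Y]
  have V: "continuous_on (closure \<Omega>) v" if "v \<in> ?V" for v
    using that P1_cont[OF \<Omega>, of v] by (simp add: P1_space0_def)
  have t: "(\<lambda>x y. p (x, y)) \<in> tensor_span ?V ?W" using p by (simp add: tensor_pairs_def)
  have sl: "(\<lambda>y. p (x, y)) \<in> ?W" for x using tensor_slice_right[OF W t] .
  let ?g = "\<lambda>x. mass_form Y (\<lambda>y. p (x, y)) (\<lambda>y. p (x, y))"
  have c: "continuous_on (closure \<Omega>) ?g"
    by (rule slice_form_continuous[OF dom(1,3) V W m t t])
  have "AE x in lebesgue_on \<Omega>. ?g x = 0"
    using 0 integral_nonneg_eq_0_iff_AE[OF integrable_continuous_closure[OF dom(1,3) c]]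
      psd_nonneg[OF W m sl] by (simp add: slice_form_def)
  then have g0: "?g x = 0" if "x \<in> \<Omega>" for x
    using AE_zero_continuous[OF dom(1) continuous_on_subset[OF c closure_subset]] that by blast
  have "(\<lambda>y. p (x, y)) = (\<lambda>y. 0)" if "x \<in> \<Omega>" for x
    by (rule mass_form_zero[OF Y sl g0[OF that]])
  then have z: "p (x, y) = 0" if "x \<in> \<Omega>" for x y using that by (metis (no_types))
  have "(\<lambda>x. p (x, y)) = (\<lambda>x. 0)" for y
  proof (rule P1_zero_on_domain[OF \<Omega>])
    show "(\<lambda>x. p (x, y)) \<in> P1_space \<Omega> \<B>"
      using tensor_slice_left[OF P1_subspace0[OF \<Omega>] t, of y] by (simp add: P1_space0_def)
  qed (rule z)
  then have "p (x, y) = 0" for x y by (rule fun_cong)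
  then show ?thesis by (auto simp: fun_eq_iff)
qed

lemma L2H1_norm_tensor:
  assumes Y: "convex_polytopal_domain Y" "simplicial_partition Y h \<K>"
    and p: "p \<in> tensor_pairs V (P1_space Y \<K>)"
    and \<Omega>: "open \<Omega>" "bounded \<Omega>" "\<And>v. v \<in> V \<Longrightarrow> continuous_on (closure \<Omega>) v"
  shows "L2H1_norm \<Omega> Y (\<lambda>x y. p (x, y)) = sqrt (slice_form \<Omega> (mass_form Y) p p + slice_form \<Omega> (stiffness_form Y) p p)"
proof -
  let ?W = "P1_space Y \<K>"
  note W = P1_subspace[OF Y]
  have t: "(\<lambda>x y. p (x, y)) \<in> tensor_span V ?W" using p by (simp add: tensor_pairs_def)
  have sl: "(\<lambda>y. p (x, y)) \<in> ?W" for x using tensor_slice_right[OF W t] .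
  have "(H1_norm Y (\<lambda>y. p (x, y)))\<^sup>2 = mass_form Y (\<lambda>y. p (x, y)) (\<lambda>y. p (x, y))
      + stiffness_form Y (\<lambda>y. p (x, y)) (\<lambda>y. p (x, y))" for x
    unfolding H1_norm_P1[OF Y sl]
    using psd_nonneg[OF W psd_mass_form[OF Y] sl] psd_nonneg[OF W psd_stiffness_form[OF Y] sl] by simp
  moreover have "integrable (lebesgue_on \<Omega>) (\<lambda>x. \<beta> (\<lambda>y. p (x, y)) (\<lambda>y. p (x, y)))" if "psd_form ?W \<beta>" for \<beta>
    using integrable_continuous_closure[OF \<Omega>(1,2) slice_form_continuous[OF \<Omega> W that t t]] .
  ultimately show ?thesis
    unfolding L2H1_norm_def slice_form_def
    using psd_mass_form[OF Y] psd_stiffness_form[OF Y] by simp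
qed

lemma tensor_span_subset_L2H1:
  assumes Y: "convex_polytopal_domain Y" "simplicial_partition Y h \<K>"
    and \<Omega>: "open \<Omega>" "bounded \<Omega>" "\<And>v. v \<in> V \<Longrightarrow> continuous_on (closure \<Omega>) v"
    and u: "u \<in> tensor_span V (P1_space Y \<K>)"
  shows "u \<in> L2H1 \<Omega> Y"
proof -
  let ?W = "P1_space Y \<K>"
  note W = P1_subspace[OF Y]
  obtain n :: nat and c X E where n: "u = (\<lambda>x y. \<Sum>i<n. c i * (X i x * E i y))"
    "\<And>i. i < n \<Longrightarrow> X i \<in> V" "\<And>i. i < n \<Longrightarrow> E i \<in> ?W"
    by (rule tensor_spanE[OF u]) blast
  have E: "E i \<in> ?W" if "i \<in> {..<n}" for i using n(3) that by simp
  define h where "h d = (\<lambda>y. \<Sum>i\<in>{..<n}. d i * E i y)" for d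
  have hW: "h d \<in> ?W" for d unfolding h_def by (rule fun_subspace_sum[OF W E])
  have "finite_measure (lebesgue_on \<Omega>)"
    using \<Omega> by (intro finite_measure_lebesgue_on) (simp add: lmeasurable_open)
  have bd: "\<forall>i\<in>{..<n}. \<exists>C. \<forall>x\<in>\<Omega>. \<bar>c i * X i x\<bar> \<le> C"
  proof
    fix i assume "i \<in> {..<n}"
    then have "continuous_on (closure \<Omega>) (\<lambda>x. c i * X i x)" using n(2) \<Omega>(3) by (auto intro!: continuous_intros)
    then have "bounded ((\<lambda>x. c i * X i x) ` closure \<Omega>)"
      using \<Omega>(2) by (intro compact_imp_bounded compact_continuous_image) auto
    then obtain C where "\<forall>x\<in>closure \<Omega>. \<bar>c i * X i x\<bar> \<le> C" by (auto simp: bounded_iff)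
    then show "\<exists>C. \<forall>x\<in>\<Omega>. \<bar>c i * X i x\<bar> \<le> C" using closure_subset by blast
  qed
  then obtain C where C: "\<And>i x. i \<in> {..<n} \<Longrightarrow> x \<in> \<Omega> \<Longrightarrow> \<bar>c i * X i x\<bar> \<le> C i" by metis
  have "(\<lambda>x. h (\<lambda>i. c i * X i x)) \<in> bochner_L2 (lebesgue_on \<Omega>) (H1 Y) (H1_norm Y)"
  proof (rule bochner_L2_synthesis[where I = "{..<n}" and C = "\<Sum>i<n. \<bar>C i\<bar>"
        and Q = "\<lambda>i j. mass_form Y (E i) (E j) + stiffness_form Y (E i) (E j)"])
    show "finite_measure (lebesgue_on \<Omega>)" by fact
    show "h d \<in> H1 Y" for d using hW P1_subset_H1[OF Y] by blast
    show "h d - h d' = h (\<lambda>i. d i - d' i)" for d d'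
      by (simp add: h_def fun_eq_iff left_diff_distrib sum_subtractf)
    show "H1_norm Y (h d) = sqrt (\<Sum>i\<in>{..<n}. \<Sum>j\<in>{..<n}. d i * d j * (mass_form Y (E i) (E j) + stiffness_form Y (E i) (E j)))" for d
      using H1_norm_P1[OF Y hW[of d]] psd_expand[OF W psd_mass_form[OF Y] E, of "{..<n}" "\<lambda>i. i" d d]
        psd_expand[OF W psd_stiffness_form[OF Y] E, of "{..<n}" "\<lambda>i. i" d d]
      by (simp add: h_def distrib_left sum.distrib)
    show "(\<lambda>x. c i * X i x) \<in> borel_measurable (lebesgue_on \<Omega>)" if "i \<in> {..<n}" for i
      using n(2) that \<Omega> continuous_on_subset[OF \<Omega>(3) closure_subset]
      by (intro borel_measurable_times borel_measurable_const continuous_imp_measurable_on_sets_lebesgue) auto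
    show "\<bar>c i * X i x\<bar> \<le> (\<Sum>i<n. \<bar>C i\<bar>)" if "i \<in> {..<n}" "x \<in> space (lebesgue_on \<Omega>)" for i x
      using C[of i x] that member_le_sum[of i "{..<n}" "\<lambda>i. \<bar>C i\<bar>"] by simp
  qed simp
  moreover have "(\<lambda>x. h (\<lambda>i. c i * X i x)) = u" by (simp add: n(1) h_def fun_eq_iff mult.assoc)
  ultimately show ?thesis by (simp add: L2H1_def)
qed

section \<open>The discrete pressure\<close>

text \<open>The Lipschitz bound in the first variable, between the points \<open>0\<close> and \<open>r\<close>.\<close>

lemma nonlinearity_bound:
  fixes f D1f :: "real \<times> real \<Rightarrow> real"
  assumes f: "continuous_on UNIV f" and D1: "has_weak_partial UNIV (1, 0) f D1f"
    and b: "AE z in lebesgue. \<bar>D1f z\<bar> \<le> \<theta>" and 0: "\<forall>s. f (0, s) = 0"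
  shows "\<bar>f (r, s)\<bar> \<le> \<theta> * \<bar>r\<bar>"
proof -
  have "\<bar>f ((0, s) + r *\<^sub>R (1, 0)) - f (0, s)\<bar> \<le> \<theta> * \<bar>r\<bar>"
  proof (rule weak_partial_bounded_imp_lipschitz[OF open_UNIV _ f _ D1])
    show "AE z in lebesgue_on UNIV. \<bar>D1f z\<bar> \<le> \<theta>" using b by (simp only: lebesgue_on_UNIV_eq)
    show "(0, s) \<in> box (- 1 - \<bar>r\<bar>, s - 1) (1 + \<bar>r\<bar>, s + 1)"
      "(0, s) + r *\<^sub>R (1, 0) \<in> box (- 1 - \<bar>r\<bar>, s - 1) (1 + \<bar>r\<bar>, s + 1)"
      by (auto simp: box_def Basis_prod_def)
    show "(1, 0) \<in> (Basis :: (real \<times> real) set)" by (simp add: Basis_prod_def)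
  qed simp
  then show ?thesis using 0 by simp
qed

context
  fixes \<Omega> :: "'a::euclidean_space set" and H :: real and \<B> :: "'a set set"
  assumes \<Omega>: "convex_polytopal_domain \<Omega>" and mesh: "simplicial_partition \<Omega> H \<B>"
begin

text \<open>Testing the equation with \<open>p\<close> gives
  \<open>A * s \<le> \<theta> * m \<le> \<theta> * C * s\<close> for the stiffness \<open>s\<close> and the mass \<open>m\<close> of \<open>p\<close>. The first
  inequality also holds when the integrand on the right-hand side is not integrable, because its
  integral is then 0 by convention.\<close>

lemma pressure_eq_imp_zero:
  assumes C: "poincare_constant \<Omega> C" and A: "A > 0" and \<theta>: "\<theta> \<ge> 0" "\<theta> * C < A"
    and f: "\<And>r s. \<bar>f (r, s)\<bar> \<le> \<theta> * \<bar>r\<bar>"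
    and p: "p \<in> P1_space0 \<Omega> \<B>" and eq: "pressure_eq \<Omega> A f q p p"
  shows "p = (\<lambda>x. 0)"
proof -
  have pV: "p \<in> P1_space \<Omega> \<B>" using p by (simp add: P1_space0_def)
  note W = P1_subspace[OF \<Omega> mesh]
  define m where "m = mass_form \<Omega> p p"
  define s where "s = stiffness_form \<Omega> p p"
  have m0: "m \<ge> 0" and s0: "s \<ge> 0"
    using psd_nonneg[OF W psd_mass_form[OF \<Omega> mesh] pV] psd_nonneg[OF W psd_stiffness_form[OF \<Omega> mesh] pV]
    by (simp_all add: m_def s_def)
  have "p \<in> H10 \<Omega>" using P1_space0_subset_H10[OF \<Omega> mesh] p by blast
  then have "(LINT x|lebesgue_on \<Omega>. (p x)\<^sup>2) \<le> C * (LINT x|lebesgue_on \<Omega>. (norm (weak_grad \<Omega> p x))\<^sup>2)"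
    using C by (simp add: poincare_constant_def)
  then have ms: "m \<le> C * s"
    unfolding m_def s_def mass_form_def stiffness_form_def
    by (simp add: power2_eq_square[of "p _"] power2_norm_eq_inner)
  have "A * s = (LINT x|lebesgue_on \<Omega>. f (p x, q x) * p x)"
    using eq by (simp add: pressure_eq_def s_def stiffness_form_def)
  also have "\<dots> \<le> \<theta> * m"
  proof (cases "integrable (lebesgue_on \<Omega>) (\<lambda>x. f (p x, q x) * p x)")
    case True
    have i: "integrable (lebesgue_on \<Omega>) (\<lambda>x. \<theta> * (p x * p x))"
      using P1_mult_integrable[OF \<Omega> mesh pV pV] by auto
    have "f (p x, q x) * p x \<le> \<theta> * (p x * p x)" for x
    proof -
      have "f (p x, q x) * p x \<le> \<bar>f (p x, q x)\<bar> * \<bar>p x\<bar>" by (metis abs_ge_self abs_mult)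
      also have "\<dots> \<le> \<theta> * \<bar>p x\<bar> * \<bar>p x\<bar>" by (intro mult_right_mono f) auto
      finally show ?thesis by (simp add: mult.assoc)
    qed
    then have "(LINT x|lebesgue_on \<Omega>. f (p x, q x) * p x) \<le> (LINT x|lebesgue_on \<Omega>. \<theta> * (p x * p x))"
      by (intro integral_mono True i)
    then show ?thesis by (simp add: m_def mass_form_def)
  next
    case False
    then show ?thesis using \<theta>(1) m0 by (simp add: not_integrable_integral_eq)
  qed
  also have "\<dots> \<le> \<theta> * C * s" using ms \<theta>(1) by (simp add: mult_left_mono mult.assoc)
  finally have "(A - \<theta> * C) * s \<le> 0" by (simp add: algebra_simps)
  then have "s = 0" using \<theta>(2) s0 by (simp add: mult_le_0_iff)
  then have "m = 0" using ms m0 by simp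
  then show ?thesis using mass_form_zero[OF \<Omega> mesh pV] by (simp add: m_def)
qed

text \<open>The exceptional null set of times in the definition of a Galerkin solution depends on the test
  function. This lemma passes from finitely many basis functions to all test functions, in
  particular to the pressure itself at the given time.\<close>

lemma pressure_eq_linear_test:
  assumes f: "continuous_on UNIV f" "\<And>r s. \<bar>f (r, s)\<bar> \<le> \<theta> * \<bar>r\<bar>" and \<theta>: "\<theta> \<ge> 0"
    and q: "q \<in> borel_measurable (lebesgue_on \<Omega>)" and p: "p \<in> P1_space \<Omega> \<B>"
    and e: "\<And>j. j \<in> J \<Longrightarrow> e j \<in> P1_space \<Omega> \<B>"
    and eq: "\<And>j. j \<in> J \<Longrightarrow> pressure_eq \<Omega> A f q p (e j)"
  shows "pressure_eq \<Omega> A f q p (\<lambda>x. \<Sum>j\<in>J. c j * e j x)"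
proof -
  note W = P1_subspace[OF \<Omega> mesh]
  obtain B where B: "\<And>x. \<bar>p x\<bar> \<le> B" using P1_bounded[OF \<Omega> mesh p] by metis
  have meas: "v \<in> borel_measurable (lebesgue_on \<Omega>)" if "v \<in> P1_space \<Omega> \<B>" for v
    by (rule measurable_restrict_space1, rule measurable_completion) (simp add: P1_borel[OF \<Omega> mesh that])
  have fm: "(\<lambda>x. f (p x, q x)) \<in> borel_measurable (lebesgue_on \<Omega>)"
    by (rule measurable_compose[OF borel_measurable_Pair[OF meas[OF p] q] borel_measurable_continuous_onI[OF f(1)]])
  have int: "integrable (lebesgue_on \<Omega>) (\<lambda>x. f (p x, q x) * e j x)" if j: "j \<in> J" for j
  proof -
    obtain C where C: "\<And>x. \<bar>e j x\<bar> \<le> C" using P1_bounded[OF \<Omega> mesh e[OF j]] by metis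
    have "norm (f (p x, q x) * e j x) \<le> \<theta> * B * C" for x
    proof -
      have "\<bar>f (p x, q x)\<bar> \<le> \<theta> * B" using f(2)[of "p x" "q x"] mult_left_mono[OF B[of x] \<theta>] by linarith
      then show ?thesis using C[of x] by (simp add: abs_mult mult_mono)
    qed
    then show ?thesis
      using fm meas[OF e[OF j]] domain[OF \<Omega> mesh]
      by (intro integrable_bounded_lebesgue_on[of _ _ "\<theta> * B * C"]) auto
  qed
  have "A * stiffness_form \<Omega> p (\<lambda>x. \<Sum>j\<in>J. c j * e j x) = (\<Sum>j\<in>J. c j * (A * stiffness_form \<Omega> p (e j)))"
    using psd_sum_right[OF W psd_stiffness_form[OF \<Omega> mesh], of J e p c] e p
    by (simp add: sum_distrib_left mult.left_commute)
  also have "\<dots> = (\<Sum>j\<in>J. c j * (LINT x|lebesgue_on \<Omega>. f (p x, q x) * e j x))"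
    using eq by (simp add: pressure_eq_def stiffness_form_def)
  also have "\<dots> = (LINT x|lebesgue_on \<Omega>. (\<Sum>j\<in>J. c j * (f (p x, q x) * e j x)))"
    using int by simp
  also have "\<dots> = (LINT x|lebesgue_on \<Omega>. f (p x, q x) * (\<Sum>j\<in>J. c j * e j x))"
    by (simp add: sum_distrib_left mult.left_commute)
  finally show ?thesis by (simp add: pressure_eq_def stiffness_form_def)
qed

lemma pressure_eq_zero:
  assumes 0: "\<forall>s. f (0, s) = 0" and \<phi>: "\<phi> \<in> P1_space \<Omega> \<B>"
  shows "pressure_eq \<Omega> A f q (\<lambda>x. 0) \<phi>"
  using psd_zero[OF P1_subspace[OF \<Omega> mesh] psd_stiffness_form[OF \<Omega> mesh] \<phi>] 0
  by (simp add: pressure_eq_def stiffness_form_def)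

lemma P1_space0_nodal_basis:
  obtains J e where "finite J" "\<And>j. j \<in> J \<Longrightarrow> e j \<in> P1_space0 \<Omega> \<B>"
    "\<And>v. v \<in> P1_space0 \<Omega> \<B> \<Longrightarrow> v = (\<lambda>x. \<Sum>j\<in>J. v j * e j x)"
proof -
  note V = P1_subspace0[OF \<Omega> mesh]
  obtain P where P: "finite P" "\<And>v. v \<in> P1_space \<Omega> \<B> \<Longrightarrow> (\<And>x. x \<in> P \<Longrightarrow> v x = 0) \<Longrightarrow> v = (\<lambda>x. 0)"
    by (rule P1_determined[OF \<Omega> mesh]) blast
  have det: "v = (\<lambda>x. 0)" if "v \<in> P1_space0 \<Omega> \<B>" "\<And>x. x \<in> P \<Longrightarrow> v x = 0" for v
    using that by (intro P(2)) (simp_all add: P1_space0_def)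
  show ?thesis
    by (rule nodal_basis[OF fun_subspace_zero[OF V] fun_subspace_add[OF V] fun_subspace_cmult[OF V] P(1) det])
       (assumption | rule that; assumption)+
qed

end

section \<open>The discrete density\<close>

context
  fixes \<Omega> :: "'a::euclidean_space set" and H :: real and \<B> :: "'a set set"
    and Y :: "'b::euclidean_space set" and h :: real and \<K> :: "'b set set"
    and \<Gamma> :: "'b set" and D \<kappa> pF R T :: real
  assumes \<Omega>: "convex_polytopal_domain \<Omega>" and mesh: "simplicial_partition \<Omega> H \<B>"
    and Y: "convex_polytopal_domain Y" and meshY: "simplicial_partition Y h \<K>"
    and \<Gamma>: "\<Gamma> \<in> sets borel" "\<Gamma> \<subseteq> closure Y"
    and pos: "D > 0" "\<kappa> > 0" "R > 0" "T > 0"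
begin

abbreviation (input) "VH \<equiv> P1_space0 \<Omega> \<B>"
abbreviation (input) "Wh \<equiv> P1_space Y \<K>"
abbreviation (input) "VW \<equiv> tensor_span VH Wh"
abbreviation (input) "decoupled_eq \<equiv> density_eq \<Omega> Y \<Gamma> D \<kappa> pF R (\<lambda>x. 0)"
abbreviation (input) "TP \<equiv> tensor_pairs VH Wh"
abbreviation (input) "mass \<equiv> slice_form \<Omega> (mass_form Y)"
abbreviation (input) "stiff \<equiv> slice_form \<Omega> (stiffness_form Y)"
abbreviation (input) "bdry \<equiv> slice_form \<Omega> (boundary_form Y \<Gamma>)"
abbreviation (input) "load Q \<equiv> (LINT x|lebesgue_on \<Omega>. boundary_form Y \<Gamma> (\<lambda>y. Q (x, y)) (indicator (closure Y)))"

lemmas dom\<Omega> = domain[OF \<Omega> mesh]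

lemma V_continuous: "v \<in> VH \<Longrightarrow> continuous_on (closure \<Omega>) v"
  using P1_cont[OF \<Omega> mesh, of v] by (simp add: P1_space0_def)

lemmas W_sub = P1_subspace[OF Y meshY]
lemmas TP_sub = tensor_pairs_subspace[of VH Wh]
lemmas psd_mass = psd_slice_form[OF dom\<Omega>(1,3) V_continuous W_sub psd_mass_form[OF Y meshY]]
lemmas psd_stiff = psd_slice_form[OF dom\<Omega>(1,3) V_continuous W_sub psd_stiffness_form[OF Y meshY]]
lemmas psd_bdry = psd_slice_form[OF dom\<Omega>(1,3) V_continuous W_sub psd_boundary_form[OF Y meshY \<Gamma>(1)]]

lemma tensor_nodal_basis:
  obtains I e where "finite I" "\<And>i. i \<in> I \<Longrightarrow> e i \<in> TP"
    "\<And>i j. i \<in> I \<Longrightarrow> j \<in> I \<Longrightarrow> e i j = (if i = j then 1 else 0)"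
    "\<And>p. p \<in> TP \<Longrightarrow> p = (\<lambda>z. \<Sum>i\<in>I. p i * e i z)"
proof -
  obtain P where P: "finite P" "\<And>v. v \<in> P1_space \<Omega> \<B> \<Longrightarrow> (\<And>x. x \<in> P \<Longrightarrow> v x = 0) \<Longrightarrow> v = (\<lambda>x. 0)"
    by (rule P1_determined[OF \<Omega> mesh]) blast
  obtain Q where Q: "finite Q" "\<And>v. v \<in> Wh \<Longrightarrow> (\<And>x. x \<in> Q \<Longrightarrow> v x = 0) \<Longrightarrow> v = (\<lambda>x. 0)"
    by (rule P1_determined[OF Y meshY]) blast
  have fin: "finite (P \<times> Q)" using P Q by simp
  have det: "p = (\<lambda>z. 0)" if p: "p \<in> TP" and 0: "\<And>z. z \<in> P \<times> Q \<Longrightarrow> p z = 0" for p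
  proof -
    have t: "(\<lambda>x y. p (x, y)) \<in> VW" using p by (simp add: tensor_pairs_def)
    have "(\<lambda>y. p (x, y)) = (\<lambda>y. 0)" if "x \<in> P" for x
      using tensor_slice_right[OF W_sub t] 0 that by (intro Q(2)) auto
    then have 1: "p (x, y) = 0" if "x \<in> P" for x y using that by (metis (no_types))
    have "(\<lambda>x. p (x, y)) = (\<lambda>x. 0)" for y
      using tensor_slice_left[OF P1_subspace0[OF \<Omega> mesh] t, of y] 1
      by (intro P(2)) (simp_all add: P1_space0_def)
    then have "p (x, y) = 0" for x y by (rule fun_cong)
    then show ?thesis by (auto simp: fun_eq_iff)
  qed
  show ?thesis
    by (rule nodal_basis[OF fun_subspace_zero[OF TP_sub] fun_subspace_add[OF TP_sub] fun_subspace_cmult[OF TP_sub] fin det])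
       (assumption | rule that; assumption)+
qed

lemma density_eq_forms:
  assumes P: "P \<in> TP" and P': "P' \<in> TP" and Q: "Q \<in> TP"
  shows "decoupled_eq (\<lambda>x y. P (x, y)) (\<lambda>x y. P' (x, y)) (\<lambda>x y. Q (x, y)) \<longleftrightarrow>
    mass P' Q + D * stiff P Q = \<kappa> * (pF * load Q - R * bdry P Q)"
proof -
  let ?M = "restrict_space (surface_measure Y) \<Gamma>"
  note one = indicator_closure_P1[OF Y meshY]
  have sl: "(\<lambda>y. p (x, y)) \<in> Wh" if "p \<in> TP" for p x
    using tensor_slice_right[OF W_sub, of "\<lambda>x y. p (x, y)" VH x] that by (simp add: tensor_pairs_def)
  have tp: "(\<lambda>x y. p (x, y)) \<in> VW" if "p \<in> TP" for p using that by (simp add: tensor_pairs_def)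
  have inner: "(LINT y|?M. (0 + pF - R * P (x, y)) * Q (x, y))
      = pF * boundary_form Y \<Gamma> (\<lambda>y. Q (x, y)) (indicator (closure Y))
        - R * boundary_form Y \<Gamma> (\<lambda>y. P (x, y)) (\<lambda>y. Q (x, y))" for x
  proof -
    have "(LINT y|?M. (0 + pF - R * P (x, y)) * Q (x, y))
        = (LINT y|?M. pF * (Q (x, y) * indicator (closure Y) y) - R * (P (x, y) * Q (x, y)))"
      by (rule Bochner_Integration.integral_cong[OF refl])
         (use \<Gamma>(2) in \<open>auto simp: space_restrict_space algebra_simps\<close>)
    also have "\<dots> = pF * (LINT y|?M. Q (x, y) * indicator (closure Y) y) - R * (LINT y|?M. P (x, y) * Q (x, y))"
      using P1_boundary_mult_integrable(2)[OF Y meshY \<Gamma>(1) sl[OF Q, of x] one]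
        P1_boundary_mult_integrable(2)[OF Y meshY \<Gamma>(1) sl[OF P, of x] sl[OF Q, of x]] by simp
    finally show ?thesis by (simp add: boundary_form_def)
  qed
  have i1: "integrable (lebesgue_on \<Omega>) (\<lambda>x. boundary_form Y \<Gamma> (\<lambda>y. Q (x, y)) (indicator (closure Y)))"
    using slice_form_continuous1[OF dom\<Omega>(1,3) V_continuous W_sub psd_boundary_form[OF Y meshY \<Gamma>(1)] one tp[OF Q]]
    by (rule integrable_continuous_closure[OF dom\<Omega>(1,3)])
  have i2: "integrable (lebesgue_on \<Omega>) (\<lambda>x. boundary_form Y \<Gamma> (\<lambda>y. P (x, y)) (\<lambda>y. Q (x, y)))"
    using slice_form_continuous[OF dom\<Omega>(1,3) V_continuous W_sub psd_boundary_form[OF Y meshY \<Gamma>(1)] tp[OF P] tp[OF Q]]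
    by (rule integrable_continuous_closure[OF dom\<Omega>(1,3)])
  have "(LINT x|lebesgue_on \<Omega>. LINT y|?M. (0 + pF - R * P (x, y)) * Q (x, y)) = pF * load Q - R * bdry P Q"
    unfolding inner slice_form_def using i1 i2 by simp
  then show ?thesis
    unfolding density_eq_def by (simp add: slice_form_def mass_form_def stiffness_form_def)
qed

lemma L2H1_norm_TP:
  "p \<in> TP \<Longrightarrow> L2H1_norm \<Omega> Y (\<lambda>x y. p (x, y)) = sqrt (mass p p + stiff p p)"
  by (rule L2H1_norm_tensor[OF Y meshY _ dom\<Omega>(1,3) V_continuous])

context
  fixes I :: "('a \<times> 'b) set" and e :: "'a \<times> 'b \<Rightarrow> 'a \<times> 'b \<Rightarrow> real"
  assumes I: "finite I" and e: "\<And>i. i \<in> I \<Longrightarrow> e i \<in> TP"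
    and nodal: "\<And>i j. i \<in> I \<Longrightarrow> j \<in> I \<Longrightarrow> e i j = (if i = j then 1 else 0)"
    and rep: "\<And>p. p \<in> TP \<Longrightarrow> p = (\<lambda>z. \<Sum>i\<in>I. p i * e i z)"
begin

abbreviation (input) "gram i j \<equiv> mass (e i) (e j)"
abbreviation (input) "energy i j \<equiv> D * stiff (e i) (e j) + \<kappa> * R * bdry (e i) (e j)"
abbreviation (input) "rhs j \<equiv> \<kappa> * pF * load (e j)"

lemma comb_TP: "(\<lambda>z. \<Sum>i\<in>I. c i * e i z) \<in> TP"
  by (rule fun_subspace_sum[OF TP_sub e])

lemma comb_nodal: "j \<in> I \<Longrightarrow> (\<Sum>i\<in>I. c i * e i j) = c j"
proof -
  assume j: "j \<in> I"
  have "(\<Sum>i\<in>I. c i * e i j) = (\<Sum>i\<in>I. if i = j then c i else 0)"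
    by (rule sum.cong) (use nodal j in auto)
  then show ?thesis using I j by simp
qed

lemma G_sym: "i \<in> I \<Longrightarrow> j \<in> I \<Longrightarrow> gram i j = gram j i"
  by (rule psd_sym[OF TP_sub psd_mass e e])

lemma G_pos:
  assumes "\<exists>i\<in>I. c i \<noteq> 0"
  shows "(\<Sum>i\<in>I. \<Sum>j\<in>I. c i * c j * gram i j) > 0"
proof -
  let ?p = "\<lambda>z. \<Sum>i\<in>I. c i * e i z"
  have eq: "mass ?p ?p = (\<Sum>i\<in>I. \<Sum>j\<in>I. c i * c j * gram i j)"
    by (rule psd_expand[OF TP_sub psd_mass e])
  have "mass ?p ?p \<noteq> 0"
  proof
    assume "mass ?p ?p = 0"
    then have "?p = (\<lambda>z. 0)" by (rule slice_form_mass_zero[OF \<Omega> mesh Y meshY comb_TP])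
    then have "?p j = 0" for j by (rule fun_cong)
    then show False using assms comb_nodal[of _ c] by metis
  qed
  then show ?thesis using psd_nonneg[OF TP_sub psd_mass comb_TP, of c] unfolding eq by simp
qed

lemma a_nonneg: "(\<Sum>i\<in>I. \<Sum>j\<in>I. c i * c j * energy i j) \<ge> 0"
proof -
  let ?p = "\<lambda>z. \<Sum>i\<in>I. c i * e i z"
  have "(\<Sum>i\<in>I. \<Sum>j\<in>I. c i * c j * energy i j) = D * stiff ?p ?p + \<kappa> * R * bdry ?p ?p"
  proof -
    have "stiff ?p ?p = (\<Sum>i\<in>I. \<Sum>j\<in>I. c i * c j * stiff (e i) (e j))"
      by (rule psd_expand[OF TP_sub psd_stiff e])
    moreover have "bdry ?p ?p = (\<Sum>i\<in>I. \<Sum>j\<in>I. c i * c j * bdry (e i) (e j))"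
      by (rule psd_expand[OF TP_sub psd_bdry e])
    ultimately show ?thesis
      by (simp add: sum_distrib_left sum.distrib[symmetric] algebra_simps)
  qed
  then show ?thesis
    using psd_nonneg[OF TP_sub psd_stiff comb_TP, of c] psd_nonneg[OF TP_sub psd_bdry comb_TP, of c] pos by simp
qed

text \<open>Tested with a basis function and for vanishing pressure, the density equation is one line of the linear system
  with mass matrix \<open>gram\<close>, stiffness matrix \<open>energy\<close> and load vector \<open>rhs\<close>.\<close>

lemma density_eq_coordinates:
  assumes P: "P \<in> TP" and P': "P' \<in> TP" and j: "j \<in> I"
  shows "decoupled_eq (\<lambda>x y. P (x, y)) (\<lambda>x y. P' (x, y)) (\<lambda>x y. e j (x, y)) \<longleftrightarrow>
    (\<Sum>i\<in>I. P' i * gram i j) + (\<Sum>i\<in>I. P i * energy i j) = rhs j"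
proof -
  have 1: "mass P' (e j) = (\<Sum>i\<in>I. P' i * gram i j)"
    using psd_sum[OF TP_sub psd_mass e e[OF j], of I "\<lambda>i. i" P'] rep[OF P'] by simp
  have 2: "stiff P (e j) = (\<Sum>i\<in>I. P i * stiff (e i) (e j))"
    using psd_sum[OF TP_sub psd_stiff e e[OF j], of I "\<lambda>i. i" P] rep[OF P] by simp
  have 3: "bdry P (e j) = (\<Sum>i\<in>I. P i * bdry (e i) (e j))"
    using psd_sum[OF TP_sub psd_bdry e e[OF j], of I "\<lambda>i. i" P] rep[OF P] by simp
  have 4: "(\<Sum>i\<in>I. P i * energy i j) = D * stiff P (e j) + \<kappa> * R * bdry P (e j)"
    unfolding 2 3 by (simp add: sum_distrib_left sum.distrib[symmetric] algebra_simps)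
  show ?thesis
    unfolding density_eq_forms[OF P P' e[OF j]] 1 4 by (simp add: algebra_simps)
qed

lemma density_eq_basis_imp_all:
  assumes P: "P \<in> TP" and P': "P' \<in> TP" and Q: "Q \<in> TP"
    and eq: "\<And>j. j \<in> I \<Longrightarrow>
      decoupled_eq (\<lambda>x y. P (x, y)) (\<lambda>x y. P' (x, y)) (\<lambda>x y. e j (x, y))"
  shows "decoupled_eq (\<lambda>x y. P (x, y)) (\<lambda>x y. P' (x, y)) (\<lambda>x y. Q (x, y))"
proof -
  let ?Q = "\<lambda>z. \<Sum>j\<in>I. Q j * e j z"
  define S where "S X \<longleftrightarrow> mass P' X + D * stiff P X = \<kappa> * (pF * load X - R * bdry P X)" for X
  have "load ?Q = (\<Sum>j\<in>I. Q j * load (e j))"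
    by (rule slice_integral_sum[OF dom\<Omega>(1,3) V_continuous W_sub psd_boundary_form[OF Y meshY \<Gamma>(1)] e
          indicator_closure_P1[OF Y meshY]])
  moreover have "mass P' ?Q = (\<Sum>j\<in>I. Q j * mass P' (e j))"
    by (rule psd_sum_right[OF TP_sub psd_mass e P'])
  moreover have "stiff P ?Q = (\<Sum>j\<in>I. Q j * stiff P (e j))"
    by (rule psd_sum_right[OF TP_sub psd_stiff e P])
  moreover have "bdry P ?Q = (\<Sum>j\<in>I. Q j * bdry P (e j))"
    by (rule psd_sum_right[OF TP_sub psd_bdry e P])
  moreover have "(\<Sum>j\<in>I. Q j * (mass P' (e j) + D * stiff P (e j)))
      = (\<Sum>j\<in>I. Q j * (\<kappa> * (pF * load (e j) - R * bdry P (e j))))"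
    by (rule sum.cong[OF refl]) (use eq density_eq_forms[OF P P' e] in auto)
  ultimately have "S ?Q"
    unfolding S_def by (simp add: sum_distrib_left sum.distrib sum_subtractf algebra_simps)
  then have "S Q" by (simp only: rep[OF Q, symmetric])
  then show ?thesis unfolding density_eq_forms[OF P P' Q] S_def .
qed

definition synthesis :: "('a \<times> 'b \<Rightarrow> real) \<Rightarrow> 'a \<Rightarrow> 'b \<Rightarrow> real" where
  "synthesis d = (\<lambda>x y. \<Sum>i\<in>I. d i * e i (x, y))"

lemma synthesis_tensor: "synthesis d \<in> VW"
  using comb_TP[of d] by (simp add: tensor_pairs_def synthesis_def)

lemma synthesis_norm:
  "L2H1_norm \<Omega> Y (synthesis d) = sqrt (\<Sum>i\<in>I. \<Sum>j\<in>I. d i * d j * (gram i j + stiff (e i) (e j)))"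
proof -
  let ?p = "\<lambda>z. \<Sum>i\<in>I. d i * e i z"
  have "mass ?p ?p = (\<Sum>i\<in>I. \<Sum>j\<in>I. d i * d j * gram i j)"
    by (rule psd_expand[OF TP_sub psd_mass e])
  moreover have "stiff ?p ?p = (\<Sum>i\<in>I. \<Sum>j\<in>I. d i * d j * stiff (e i) (e j))"
    by (rule psd_expand[OF TP_sub psd_stiff e])
  ultimately show ?thesis
    using L2H1_norm_TP[OF comb_TP, of d] by (simp add: synthesis_def distrib_left sum.distrib)
qed

lemma synthesis_diff: "synthesis d - synthesis d' = synthesis (\<lambda>i. d i - d' i)"
  by (simp add: synthesis_def fun_eq_iff left_diff_distrib sum_subtractf)

lemma synthesis_bochner:
  assumes c: "\<And>i. i \<in> I \<Longrightarrow> continuous_on {0..T} (\<lambda>t. c t i)"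
  shows "(\<lambda>t. synthesis (c t)) \<in> bochner_L2 (lebesgue_on {0<..<T}) (VW) (L2H1_norm \<Omega> Y)"
proof -
  have "\<forall>i\<in>I. \<exists>B. \<forall>t\<in>{0..T}. \<bar>c t i\<bar> \<le> B"
  proof
    fix i assume "i \<in> I"
    have "bounded ((\<lambda>t. c t i) ` {0..T})"
      by (intro compact_imp_bounded compact_continuous_image c \<open>i \<in> I\<close>) simp
    then show "\<exists>B. \<forall>t\<in>{0..T}. \<bar>c t i\<bar> \<le> B" by (auto simp: bounded_iff)
  qed
  then obtain B where B: "\<And>i t. i \<in> I \<Longrightarrow> t \<in> {0..T} \<Longrightarrow> \<bar>c t i\<bar> \<le> B i" by metis
  show ?thesis
  proof (rule bochner_L2_synthesis[where h = synthesis and I = I and C = "\<Sum>i\<in>I. \<bar>B i\<bar>"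
        and Q = "\<lambda>i j. gram i j + stiff (e i) (e j)"])
    show "finite I" by (rule I)
    show "synthesis d \<in> VW" for d by (rule synthesis_tensor)
    show "synthesis d - synthesis d' = synthesis (\<lambda>i. d i - d' i)" for d d' by (rule synthesis_diff)
    show "L2H1_norm \<Omega> Y (synthesis d) = sqrt (\<Sum>i\<in>I. \<Sum>j\<in>I. d i * d j * (gram i j + stiff (e i) (e j)))" for d
      by (rule synthesis_norm)
    show "finite_measure (lebesgue_on {0<..<T})" by (intro finite_measure_lebesgue_on) simp
    show "(\<lambda>t. c t i) \<in> borel_measurable (lebesgue_on {0<..<T})" if "i \<in> I" for i
      by (intro continuous_imp_measurable_on_sets_lebesgue continuous_on_subset[OF c[OF that]]) auto
    fix i t assume i: "i \<in> I" and "t \<in> space (lebesgue_on {0<..<T})"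
    then have "t \<in> {0..T}" by simp
    from B[OF i this] member_le_sum[OF i _ I, of "\<lambda>i. \<bar>B i\<bar>"]
    show "\<bar>c t i\<bar> \<le> (\<Sum>i\<in>I. \<bar>B i\<bar>)" by simp
  qed
qed

text \<open>Multiplication by the inverse \<open>N\<close> of the mass matrix turns the linear system into an explicit linear differential
  equation for the coordinates.\<close>

lemma density_problem_exists:
  assumes \<rho>0: "\<rho>0 \<in> VW"
  shows "\<exists>\<rho> \<rho>'. \<rho> \<in> bochner_L2 (lebesgue_on {0<..<T}) (VW) (L2H1_norm \<Omega> Y) \<and>
    \<rho>' \<in> bochner_L2 (lebesgue_on {0<..<T}) (VW) (L2H1_norm \<Omega> Y) \<and>
    (\<forall>x y. has_weak_partial {0<..<T} 1 (\<lambda>t. \<rho> t x y) (\<lambda>t. \<rho>' t x y)) \<and>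
    (\<forall>t. \<forall>\<psi>\<in>VW. decoupled_eq (\<rho> t) (\<rho>' t) \<psi>) \<and>
    has_initial_value T (VW) (L2H1_norm \<Omega> Y) \<rho> \<rho>0"
proof -
  have "\<forall>k. \<exists>c. \<forall>j\<in>I. (\<Sum>i\<in>I. c i * gram i j) = (if k = j then 1 else 0)"
    by (intro allI positive_definite_solve I) (erule (1) G_sym, erule G_pos)
  then obtain N where N: "\<And>k j. j \<in> I \<Longrightarrow> (\<Sum>i\<in>I. N k i * gram i j) = (if k = j then 1 else 0)"
    by metis
  define A where "A i l = (\<Sum>k\<in>I. - (energy l k * N k i))" for i l
  define b where "b i = (\<Sum>k\<in>I. rhs k * N k i)" for i
  obtain c where c0: "\<And>i. i \<in> I \<Longrightarrow> c 0 i = \<rho>0 (fst i) (snd i)"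
    and c: "\<And>t i. i \<in> I \<Longrightarrow> ((\<lambda>t. c t i) has_real_derivative (\<Sum>l\<in>I. A i l * c t l) + b i) (at t)"
    using linear_ode_exists[OF I, of "\<lambda>i. \<rho>0 (fst i) (snd i)" A b] by metis
  define f where "f t i = (\<Sum>l\<in>I. A i l * c t l) + b i" for t i
  have f_eq: "f t i = (\<Sum>k\<in>I. (rhs k - (\<Sum>l\<in>I. c t l * energy l k)) * N k i)" for t i
  proof -
    have "(\<Sum>l\<in>I. A i l * c t l) = (\<Sum>l\<in>I. \<Sum>k\<in>I. - (c t l * energy l k * N k i))"
      unfolding A_def sum_distrib_right by (intro sum.cong refl) (simp add: mult_ac)
    also have "\<dots> = (\<Sum>k\<in>I. \<Sum>l\<in>I. - (c t l * energy l k * N k i))" by (rule sum.swap)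
    also have "\<dots> = (\<Sum>k\<in>I. - ((\<Sum>l\<in>I. c t l * energy l k) * N k i))"
      by (simp add: sum_distrib_right sum_negf)
    finally show ?thesis
      by (simp add: f_def b_def left_diff_distrib sum_subtractf sum_negf)
  qed
  have f_gram: "(\<Sum>i\<in>I. f t i * gram i j) = rhs j - (\<Sum>l\<in>I. c t l * energy l j)" if j: "j \<in> I" for t j
  proof -
    let ?r = "\<lambda>k. rhs k - (\<Sum>l\<in>I. c t l * energy l k)"
    have "(\<Sum>i\<in>I. f t i * gram i j) = (\<Sum>i\<in>I. \<Sum>k\<in>I. ?r k * (N k i * gram i j))"
      by (simp add: f_eq sum_distrib_right mult.assoc)
    also have "\<dots> = (\<Sum>k\<in>I. \<Sum>i\<in>I. ?r k * (N k i * gram i j))" by (rule sum.swap)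
    also have "\<dots> = (\<Sum>k\<in>I. ?r k * (if k = j then 1 else 0))"
      unfolding sum_distrib_left[symmetric] by (simp only: N[OF j])
    also have "\<dots> = (\<Sum>k\<in>I. if k = j then ?r k else 0)" by (rule sum.cong) auto
    also have "\<dots> = ?r j" using I j by simp
    finally show ?thesis .
  qed
  have cc: "continuous_on S (\<lambda>t. c t i)" if "i \<in> I" for i S
    using c[OF that] by (intro continuous_at_imp_continuous_on ballI) (rule DERIV_isCont)
  have fc: "continuous_on S (\<lambda>t. f t i)" if "i \<in> I" for i S
    unfolding f_def by (intro continuous_intros cc)
  define \<rho> where "\<rho> t = synthesis (c t)" for t
  define \<rho>' where "\<rho>' t = synthesis (f t)" for t
  have weak: "has_weak_partial {0<..<T} 1 (\<lambda>t. \<rho> t x y) (\<lambda>t. \<rho>' t x y)" for x y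
    unfolding \<rho>_def \<rho>'_def synthesis_def
  proof (rule C1_has_weak_partial)
    show "((\<lambda>t. \<Sum>i\<in>I. c t i * e i (x, y)) has_real_derivative (\<Sum>i\<in>I. f t i * e i (x, y))) (at t)" for t
      unfolding f_def by (intro DERIV_sum DERIV_cmult_right c)
    show "continuous_on {0..T} (\<lambda>t. \<Sum>i\<in>I. f t i * e i (x, y))" by (intro continuous_intros fc)
  qed
  have dens: "decoupled_eq (\<rho> t) (\<rho>' t) \<psi>" if \<psi>: "\<psi> \<in> VW" for t \<psi>
  proof -
    have Q: "(\<lambda>z. \<psi> (fst z) (snd z)) \<in> TP" using \<psi> by (simp add: tensor_pairs_def)
    have "decoupled_eq (\<rho> t) (\<rho>' t) (\<lambda>x y. e j (x, y))" if j: "j \<in> I" for j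
    proof -
      have "(\<Sum>i\<in>I. (\<Sum>k\<in>I. f t k * e k i) * gram i j) = (\<Sum>i\<in>I. f t i * gram i j)"
        by (rule sum.cong) (simp_all add: comb_nodal)
      moreover have "(\<Sum>i\<in>I. (\<Sum>k\<in>I. c t k * e k i) * energy i j) = (\<Sum>i\<in>I. c t i * energy i j)"
        by (rule sum.cong) (simp_all add: comb_nodal)
      ultimately have "(\<Sum>i\<in>I. (\<Sum>k\<in>I. f t k * e k i) * gram i j)
          + (\<Sum>i\<in>I. (\<Sum>k\<in>I. c t k * e k i) * energy i j) = rhs j"
        using f_gram[OF j, of t] by simp
      then show ?thesis
        using density_eq_coordinates[OF comb_TP comb_TP j, of "c t" "f t"]
        by (simp add: \<rho>_def \<rho>'_def synthesis_def)
    qed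
    then show ?thesis
      using density_eq_basis_imp_all[OF comb_TP comb_TP Q, of "c t" "f t"]
      by (simp add: \<rho>_def \<rho>'_def synthesis_def)
  qed
  have "has_initial_value T (VW) (L2H1_norm \<Omega> Y) \<rho> \<rho>0"
    unfolding has_initial_value_def
  proof (intro exI[of _ \<rho>] conjI ballI)
    show "\<rho> t \<in> VW" for t unfolding \<rho>_def by (rule synthesis_tensor)
    show "((\<lambda>s. L2H1_norm \<Omega> Y (\<rho> s - \<rho> t)) \<longlongrightarrow> 0) (at t within {0..T})" if t: "t \<in> {0..T}" for t
    proof -
      have ct: "((\<lambda>s. c s i) \<longlongrightarrow> c t i) (at t within {0..T})" if "i \<in> I" for i
        using cc[OF that, of "{0..T}"] t by (simp add: continuous_on_def)
      have "((\<lambda>s. sqrt (\<Sum>i\<in>I. \<Sum>j\<in>I. (c s i - c t i) * (c s j - c t j) * (gram i j + stiff (e i) (e j)))) \<longlongrightarrow>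
          sqrt (\<Sum>i\<in>I. \<Sum>j\<in>I. (c t i - c t i) * (c t j - c t j) * (gram i j + stiff (e i) (e j)))) (at t within {0..T})"
        by (intro tendsto_intros ct)
      then show ?thesis unfolding \<rho>_def synthesis_diff synthesis_norm by simp
    qed
    have Q: "(\<lambda>z. \<rho>0 (fst z) (snd z)) \<in> TP" using \<rho>0 by (simp add: tensor_pairs_def)
    have "\<rho>0 x y = (\<Sum>i\<in>I. \<rho>0 (fst i) (snd i) * e i (x, y))" for x y
      using fun_cong[OF rep[OF Q], of "(x, y)"] by simp
    moreover have "\<rho> 0 x y = (\<Sum>i\<in>I. \<rho>0 (fst i) (snd i) * e i (x, y))" for x y
      unfolding \<rho>_def synthesis_def by (rule sum.cong) (simp_all add: c0)
    ultimately show "\<rho> 0 = \<rho>0" by (intro ext) metis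
  qed auto
  moreover have "\<rho> \<in> bochner_L2 (lebesgue_on {0<..<T}) (VW) (L2H1_norm \<Omega> Y)"
    unfolding \<rho>_def by (rule synthesis_bochner[OF cc])
  moreover have "\<rho>' \<in> bochner_L2 (lebesgue_on {0<..<T}) (VW) (L2H1_norm \<Omega> Y)"
    unfolding \<rho>'_def by (rule synthesis_bochner[OF fc])
  ultimately show ?thesis using weak dens by blast
qed

text \<open>Point evaluation at a node is the mass product with a fixed element \<open>r\<close> of the space, so it is bounded by the
  Cauchy-Schwarz inequality. This turns continuity in the norm into continuity of coordinates.\<close>

lemma coordinate_bound:
  assumes i: "i \<in> I"
  obtains K where "K \<ge> 0" "\<And>u. u \<in> VW \<Longrightarrow> \<bar>u (fst i) (snd i)\<bar> \<le> K * L2H1_norm \<Omega> Y u"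
proof -
  have "\<exists>c. \<forall>j\<in>I. (\<Sum>k\<in>I. c k * gram k j) = (if i = j then 1 else 0)"
    by (intro positive_definite_solve I) (erule (1) G_sym, erule G_pos)
  then obtain c where c: "\<forall>j\<in>I. (\<Sum>k\<in>I. c k * gram k j) = (if i = j then 1 else 0)" by metis
  define r where "r z = (\<Sum>k\<in>I. c k * e k z)" for z
  have r: "r \<in> TP" unfolding r_def by (rule comb_TP)
  have riesz: "mass r p = p i" if p: "p \<in> TP" for p
  proof -
    have "mass r (e j) = (if i = j then 1 else 0)" if j: "j \<in> I" for j
    proof -
      have "mass r (e j) = (\<Sum>k\<in>I. c k * gram k j)"
        unfolding r_def by (rule psd_sum[OF TP_sub psd_mass e e[OF j]])
      then show ?thesis using c j by simp
    qed
    then have "(\<Sum>j\<in>I. p j * mass r (e j)) = (\<Sum>j\<in>I. if i = j then p j else 0)"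
      by (intro sum.cong) auto
    moreover have "mass r (\<lambda>z. \<Sum>j\<in>I. p j * e j z) = (\<Sum>j\<in>I. p j * mass r (e j))"
      by (rule psd_sum_right[OF TP_sub psd_mass e r])
    ultimately have "mass r (\<lambda>z. \<Sum>j\<in>I. p j * e j z) = p i" using I i by simp
    then show ?thesis by (simp only: rep[OF p, symmetric])
  qed
  show ?thesis
  proof (rule that[of "sqrt (mass r r)"])
    show "sqrt (mass r r) \<ge> 0" using psd_nonneg[OF TP_sub psd_mass r] by simp
    fix u assume u: "u \<in> VW"
    define p where "p z = u (fst z) (snd z)" for z
    have p: "p \<in> TP" using u by (simp add: p_def tensor_pairs_def)
    have "(p i)\<^sup>2 \<le> mass r r * mass p p"
      using psd_Cauchy_Schwarz[OF TP_sub psd_mass r p] by (simp add: riesz[OF p])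
    also have "\<dots> \<le> mass r r * (mass p p + stiff p p)"
      using psd_nonneg[OF TP_sub psd_mass r] psd_nonneg[OF TP_sub psd_stiff p] by (intro mult_left_mono) auto
    finally have "\<bar>p i\<bar> \<le> sqrt (mass r r * (mass p p + stiff p p))"
      by (intro real_le_rsqrt) simp
    moreover have "L2H1_norm \<Omega> Y u = sqrt (mass p p + stiff p p)"
      using L2H1_norm_TP[OF p] by (simp add: p_def)
    ultimately show "\<bar>u (fst i) (snd i)\<bar> \<le> sqrt (mass r r) * L2H1_norm \<Omega> Y u"
      by (simp add: p_def real_sqrt_mult)
  qed
qed

lemma coordinate_continuous:
  assumes w: "\<And>t. t \<in> {0..T} \<Longrightarrow> w t \<in> VW"
    and lim: "\<And>t. t \<in> {0..T} \<Longrightarrow> ((\<lambda>s. L2H1_norm \<Omega> Y (w s - w t)) \<longlongrightarrow> 0) (at t within {0..T})"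
    and i: "i \<in> I"
  shows "continuous_on {0..T} (\<lambda>t. w t (fst i) (snd i))"
  unfolding continuous_on_def
proof
  fix t assume t: "t \<in> {0..T}"
  obtain K where K: "K \<ge> 0" "\<And>u. u \<in> VW \<Longrightarrow> \<bar>u (fst i) (snd i)\<bar> \<le> K * L2H1_norm \<Omega> Y u"
    using coordinate_bound[OF i] by metis
  have diff: "w s - w t \<in> VW" if s: "s \<in> {0..T}" for s
  proof -
    have "(\<lambda>x y. w s x y + (-1) * w t x y) \<in> VW"
      by (intro tensor_span_add tensor_span_cmult w s t)
    moreover have "(\<lambda>x y. w s x y + (-1) * w t x y) = w s - w t" by (simp add: fun_eq_iff)
    ultimately show ?thesis by simp
  qed
  have "((\<lambda>s. K * L2H1_norm \<Omega> Y (w s - w t)) \<longlongrightarrow> K * 0) (at t within {0..T})"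
    by (intro tendsto_intros lim t)
  then have z: "((\<lambda>s. K * L2H1_norm \<Omega> Y (w s - w t)) \<longlongrightarrow> 0) (at t within {0..T})" by simp
  have "((\<lambda>s. w s (fst i) (snd i) - w t (fst i) (snd i)) \<longlongrightarrow> 0) (at t within {0..T})"
  proof (rule Lim_null_comparison[OF _ z])
    show "\<forall>\<^sub>F s in at t within {0..T}. norm (w s (fst i) (snd i) - w t (fst i) (snd i))
        \<le> K * L2H1_norm \<Omega> Y (w s - w t)"
      unfolding eventually_at_filter using K(2)[OF diff] by (intro always_eventually) auto
  qed
  then show "((\<lambda>s. w s (fst i) (snd i)) \<longlongrightarrow> w t (fst i) (snd i)) (at t within {0..T})"
    by (simp add: LIM_zero_iff)
qed

text \<open>The difference of the continuous representatives solves the homogeneous system, in which the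
  load has cancelled and which is dissipative.\<close>

lemma density_problem_unique:
  assumes mem: "AE t in lebesgue_on {0<..<T}. \<rho>1' t \<in> VW" "AE t in lebesgue_on {0<..<T}. \<rho>2' t \<in> VW"
    and weak: "\<And>x y. has_weak_partial {0<..<T} 1 (\<lambda>t. \<rho>1 t x y) (\<lambda>t. \<rho>1' t x y)"
      "\<And>x y. has_weak_partial {0<..<T} 1 (\<lambda>t. \<rho>2 t x y) (\<lambda>t. \<rho>2' t x y)"
    and eq: "\<And>\<psi>. \<psi> \<in> VW \<Longrightarrow>
        AE t in lebesgue_on {0<..<T}. decoupled_eq (\<rho>1 t) (\<rho>1' t) \<psi>"
      "\<And>\<psi>. \<psi> \<in> VW \<Longrightarrow>
        AE t in lebesgue_on {0<..<T}. decoupled_eq (\<rho>2 t) (\<rho>2' t) \<psi>"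
    and init: "has_initial_value T (VW) (L2H1_norm \<Omega> Y) \<rho>1 \<rho>0"
      "has_initial_value T (VW) (L2H1_norm \<Omega> Y) \<rho>2 \<rho>0"
  shows "AE t in lebesgue_on {0<..<T}. \<rho>1 t = \<rho>2 t"
proof -
  let ?S = "lebesgue_on {0<..<T}"
  obtain w1 where w1: "\<And>t. t \<in> {0..T} \<Longrightarrow> w1 t \<in> VW"
    "\<And>t. t \<in> {0..T} \<Longrightarrow> ((\<lambda>s. L2H1_norm \<Omega> Y (w1 s - w1 t)) \<longlongrightarrow> 0) (at t within {0..T})"
    "AE t in ?S. w1 t = \<rho>1 t" "w1 0 = \<rho>0"
    using init(1) unfolding has_initial_value_def by blast
  obtain w2 where w2: "\<And>t. t \<in> {0..T} \<Longrightarrow> w2 t \<in> VW"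
    "\<And>t. t \<in> {0..T} \<Longrightarrow> ((\<lambda>s. L2H1_norm \<Omega> Y (w2 s - w2 t)) \<longlongrightarrow> 0) (at t within {0..T})"
    "AE t in ?S. w2 t = \<rho>2 t" "w2 0 = \<rho>0"
    using init(2) unfolding has_initial_value_def by blast
  define u where "u t i = w1 t (fst i) (snd i) + (-1) * w2 t (fst i) (snd i)" for t i
  define u' where "u' t i = \<rho>1' t (fst i) (snd i) + (-1) * \<rho>2' t (fst i) (snd i)" for t i
  have pw: "has_weak_partial {0<..<T} 1 (\<lambda>t. u t i) (\<lambda>t. u' t i)" for i
    unfolding u_def u'_def
  proof (intro has_weak_partial_add has_weak_partial_cmult)
    have ae: "AE t in ?S. \<rho>1 t (fst i) (snd i) = w1 t (fst i) (snd i)"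
      "AE t in ?S. \<rho>2 t (fst i) (snd i) = w2 t (fst i) (snd i)"
      using w1(3) w2(3) by (eventually_elim, simp)+
    show "has_weak_partial {0<..<T} 1 (\<lambda>t. w1 t (fst i) (snd i)) (\<lambda>t. \<rho>1' t (fst i) (snd i))"
      by (rule has_weak_partial_cong_AE[OF _ _ weak(1) ae(1)]) auto
    show "has_weak_partial {0<..<T} 1 (\<lambda>t. w2 t (fst i) (snd i)) (\<lambda>t. \<rho>2' t (fst i) (snd i))"
      by (rule has_weak_partial_cong_AE[OF _ _ weak(2) ae(2)]) auto
  qed auto
  have row: "(\<Sum>i\<in>I. r' (fst i) (snd i) * gram i j) + (\<Sum>i\<in>I. r (fst i) (snd i) * energy i j) = rhs j"
    if "r \<in> VW" "r' \<in> VW" and j: "j \<in> I"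
      and "decoupled_eq r r' (\<lambda>x y. e j (x, y))" for r r' j
    using that density_eq_coordinates[OF _ _ j, of "\<lambda>z. r (fst z) (snd z)" "\<lambda>z. r' (fst z) (snd z)"]
    by (simp add: tensor_pairs_def)
  have ej: "(\<lambda>x y. e j (x, y)) \<in> VW" if "j \<in> I" for j
    using e[OF that] by (simp add: tensor_pairs_def)
  have eqI: "AE t in ?S. \<forall>j\<in>I. decoupled_eq (\<rho>1 t) (\<rho>1' t) (\<lambda>x y. e j (x, y))"
    "AE t in ?S. \<forall>j\<in>I. decoupled_eq (\<rho>2 t) (\<rho>2' t) (\<lambda>x y. e j (x, y))"
    by (intro AE_finite_allI[OF I] eq ej; assumption)+
  have sp: "AE t in ?S. t \<in> {0..T}" by (rule AE_I2) simp
  have ode: "AE t in ?S. \<forall>j\<in>I. (\<Sum>i\<in>I. u' t i * gram i j) + (\<Sum>i\<in>I. u t i * energy i j) = 0"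
    using eqI mem w1(3) w2(3) sp
  proof eventually_elim
    case (elim t)
    show ?case
    proof
      fix j assume j: "j \<in> I"
      have 1: "(\<Sum>i\<in>I. \<rho>1' t (fst i) (snd i) * gram i j) + (\<Sum>i\<in>I. w1 t (fst i) (snd i) * energy i j) = rhs j"
        using elim j w1(1)[of t] by (intro row) auto
      have 2: "(\<Sum>i\<in>I. \<rho>2' t (fst i) (snd i) * gram i j) + (\<Sum>i\<in>I. w2 t (fst i) (snd i) * energy i j) = rhs j"
        using elim j w2(1)[of t] by (intro row) auto
      have "(\<Sum>i\<in>I. u' t i * gram i j) = (\<Sum>i\<in>I. \<rho>1' t (fst i) (snd i) * gram i j) - (\<Sum>i\<in>I. \<rho>2' t (fst i) (snd i) * gram i j)"
        by (simp add: u'_def left_diff_distrib sum_subtractf)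
      moreover have "(\<Sum>i\<in>I. u t i * energy i j) = (\<Sum>i\<in>I. w1 t (fst i) (snd i) * energy i j) - (\<Sum>i\<in>I. w2 t (fst i) (snd i) * energy i j)"
        unfolding sum_subtractf[symmetric] by (intro sum.cong refl) (simp add: u_def left_diff_distrib)
      ultimately show "(\<Sum>i\<in>I. u' t i * gram i j) + (\<Sum>i\<in>I. u t i * energy i j) = 0"
        using 1 2 by linarith
    qed
  qed
  have cont: "continuous_on {0..T} (\<lambda>t. u t i)" if i: "i \<in> I" for i
    unfolding u_def by (intro continuous_intros coordinate_continuous w1 w2 i)
  have u0: "u t i = 0" if t: "t \<in> {0..T}" and i: "i \<in> I" for t i
  proof (rule dissipative_system_unique[OF I G_sym G_pos a_nonneg cont _ pw ode t i])
    show "u 0 i = 0" for i using w1(4) w2(4) by (simp add: u_def)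
  qed
  have ww: "w1 t = w2 t" if t: "t \<in> {0..T}" for t
  proof -
    define p where "p z = w1 t (fst z) (snd z) + (-1) * w2 t (fst z) (snd z)" for z
    have "(\<lambda>x y. w1 t x y + (-1) * w2 t x y) \<in> VW"
      by (intro tensor_span_add tensor_span_cmult w1 w2 t)
    then have p: "p \<in> TP" by (simp add: p_def tensor_pairs_def)
    have p0: "p z = 0" for z
    proof -
      have "p z = (\<Sum>i\<in>I. p i * e i z)" by (rule fun_cong[OF rep[OF p]])
      also have "\<dots> = 0" using u0[OF t] by (intro sum.neutral) (simp add: p_def u_def)
      finally show ?thesis .
    qed
    show ?thesis
    proof (intro ext)
      fix x y show "w1 t x y = w2 t x y" using p0[of "(x, y)"] by (simp add: p_def)
    qed
  qed
  show ?thesis using w1(3) w2(3) sp by eventually_elim (use ww in auto)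
qed

end

end

section \<open>Existence and uniqueness of the Galerkin solution\<close>

theorem theorem1:
  fixes \<Omega> :: "(real ^ 'm) set" and Y :: "(real ^ 'n) set"
    and \<Gamma>R \<Gamma>N :: "(real ^ 'n) set"
    and T A D R pF \<kappa> C\<Omega> \<theta> Cf \<alpha> Cg H h :: real
    and f D1f D2f :: "real \<times> real \<Rightarrow> real"
    and g :: "(real ^ 'm \<Rightarrow> real ^ 'n \<Rightarrow> real) \<Rightarrow> (real ^ 'm \<Rightarrow> real)"
    and \<rho>I \<rho>IHh :: "real ^ 'm \<Rightarrow> real ^ 'n \<Rightarrow> real"
    and \<pi>IH :: "real ^ 'm \<Rightarrow> real"
    and \<B> :: "(real ^ 'm) set set" and \<K> :: "(real ^ 'n) set set"
    and V :: "(real ^ 'm \<Rightarrow> real) set" and W :: "(real ^ 'n \<Rightarrow> real) set"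
  assumes dims: "CARD('m) \<in> {1, 2, 3}" "CARD('n) \<in> {1, 2, 3}"
    and T_pos: "T > 0"
    and domains: "convex_polytopal_domain \<Omega>" "convex_polytopal_domain Y"
    and boundary: "frontier Y = \<Gamma>R \<union> \<Gamma>N" "\<Gamma>R \<inter> \<Gamma>N = {}" "\<Gamma>R \<in> sets borel"
    and poincare: "poincare_constant \<Omega> C\<Omega>"
    and constants: "A > 0" "D > 0" "R > 0" "pF > 0" "\<kappa> > 0" "2 * C\<Omega> / A < 1"
    and initial_density: "\<rho>I \<in> L2H1 \<Omega> Y"
    and f_cont: "continuous_on UNIV f"
    and f_D1: "has_weak_partial UNIV (1, 0) f D1f" "AE z in lebesgue. \<bar>D1f z\<bar> \<le> \<theta>"
    and f_D2: "has_weak_partial UNIV (0, 1) f D2f" "AE z in lebesgue. \<bar>D2f z\<bar> \<le> \<theta>"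
    and \<theta>: "\<theta> < 2 * C\<Omega> / A" "\<theta> < 1 / C\<Omega>" "1 + 4 * \<theta>\<^sup>2 < 3 / 2"
    and f_zero: "\<forall>s. f (0, s) = 0"
    and f_growth: "Cf > 0" "0 < \<alpha>" "\<alpha> < 1"
      "\<forall>r s. \<bar>f (r, s)\<bar> \<le> Cf * min \<bar>r\<bar> (\<bar>r\<bar> powr \<alpha>)"
    and g_linear: "linear_L2H1_L2 \<Omega> Y g"
    and g_bound: "Cg > 0"
      "\<forall>u\<in>L2H1 \<Omega> Y. (LINT x|lebesgue_on \<Omega>. (g u x)\<^sup>2) \<le> Cg * (L2H1_norm \<Omega> Y u)\<^sup>2"
    and meshes: "simplicial_partition \<Omega> H \<B>" "simplicial_partition Y h \<K>"
    and V: "V = P1_space0 \<Omega> \<B>"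
    and W: "W = P1_space Y \<K>"
    and discrete_density: "\<rho>IHh \<in> tensor_span V W"
      "\<forall>\<psi>\<in>tensor_span V W.
         (LINT x|lebesgue_on \<Omega>. LINT y|lebesgue_on Y. \<rho>IHh x y * \<psi> x y)
           = (LINT x|lebesgue_on \<Omega>. LINT y|lebesgue_on Y. \<rho>I x y * \<psi> x y)"
    and discrete_pressure: "\<pi>IH \<in> V" "\<forall>\<phi>\<in>V. pressure_eq \<Omega> A f (g \<rho>IHh) \<pi>IH \<phi>"
  shows "(\<exists>\<pi> \<rho>. galerkin_solution T \<Omega> Y \<Gamma>R A D \<kappa> pF R f g V W \<pi>IH \<rho>IHh \<pi> \<rho>) \<and>
    (\<forall>\<pi>1 \<rho>1 \<pi>2 \<rho>2.
       galerkin_solution T \<Omega> Y \<Gamma>R A D \<kappa> pF R f g V W \<pi>IH \<rho>IHh \<pi>1 \<rho>1 \<and>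
       galerkin_solution T \<Omega> Y \<Gamma>R A D \<kappa> pF R f g V W \<pi>IH \<rho>IHh \<pi>2 \<rho>2 \<longrightarrow>
       (AE t in lebesgue_on {0<..<T}. \<pi>1 t = \<pi>2 t \<and> \<rho>1 t = \<rho>2 t))"
proof -
  note \<Omega> = domains(1) meshes(1) and Y = domains(2) meshes(2)
  let ?S = "lebesgue_on {0<..<T}" and ?N = "L2H1_norm \<Omega> Y"
  let ?VW = "tensor_span V W"
  have \<Gamma>: "\<Gamma>R \<in> sets borel" "\<Gamma>R \<subseteq> closure Y" using boundary by (auto simp: frontier_def)
  have sub: "V \<subseteq> P1_space \<Omega> \<B>" by (auto simp: V P1_space0_def)
  \<comment> \<open>The bound holds almost everywhere on a set of positive measure.\<close>
  have \<theta>0: "\<theta> \<ge> 0"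
  proof (rule ccontr)
    assume "\<not> \<theta> \<ge> 0"
    then have "AE z in lebesgue. z \<notin> (UNIV :: (real \<times> real) set)"
      using f_D1(2) by (auto elim!: eventually_mono)
    then have "negligible (UNIV :: (real \<times> real) set)"
      using AE_iff_null_sets[of "UNIV :: (real \<times> real) set" lebesgue] by (simp add: negligible_iff_null_sets)
    then show False using open_not_negligible[of "UNIV :: (real \<times> real) set"] by simp
  qed
  \<comment> \<open>From \<open>0 \<le> \<theta> < 2 * C\<Omega> / A < 1\<close>: the constant \<open>C\<Omega>\<close> is positive, \<open>\<theta> < 1\<close> and \<open>C\<Omega> < A / 2\<close>.\<close>
  have small: "\<theta> * C\<Omega> < A"
  proof -
    have "C\<Omega> / A > 0" using \<theta>0 \<theta>(1) by simp
    then have C: "C\<Omega> > 0" using constants(1) by (simp add: zero_less_divide_iff)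
    have "\<theta> < 1" using \<theta>(1) constants(6) by simp
    then have "\<theta> * C\<Omega> < C\<Omega>" using C by simp
    also have "C\<Omega> < A" using constants(1,6) C by (simp add: field_simps)
    finally show ?thesis .
  qed
  have fb: "\<bar>f (r, s)\<bar> \<le> \<theta> * \<bar>r\<bar>" for r s
    by (rule nonlinearity_bound[OF f_cont f_D1 f_zero])
  have p_zero: "p = (\<lambda>x. 0)" if "p \<in> V" "pressure_eq \<Omega> A f q p p" for p q
    by (rule pressure_eq_imp_zero[OF \<Omega> poincare constants(1) \<theta>0 small fb]) (use that V in auto)
  have \<pi>0: "\<pi>IH = (\<lambda>x. 0)" using p_zero discrete_pressure by blast
  have H1_zero: "H1_norm \<Omega> (\<lambda>x. 0) = 0"
    using H1_norm_P1[OF \<Omega> P1_zero[OF \<Omega>]] psd_zero[OF P1_subspace[OF \<Omega>] psd_mass_form[OF \<Omega>] P1_zero[OF \<Omega>]]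
      psd_zero[OF P1_subspace[OF \<Omega>] psd_stiffness_form[OF \<Omega>] P1_zero[OF \<Omega>]] by simp
  have zeroV: "(\<lambda>x. 0) \<in> V" unfolding V by (rule fun_subspace_zero[OF P1_subspace0[OF \<Omega>]])
  have zero_diff: "(\<lambda>x::real^'m. 0::real) - (\<lambda>x. 0) = (\<lambda>x. 0)" by (simp add: fun_eq_iff)
  have \<pi>_bochner: "(\<lambda>t x. 0) \<in> bochner_L2 ?S V (H1_norm \<Omega>)"
    unfolding bochner_L2_def using zeroV
    by (auto simp: H1_zero zero_diff intro!: exI[of _ "\<lambda>n t x. 0"])
  have \<pi>_init: "has_initial_value T V (H1_norm \<Omega>) (\<lambda>t x. 0) (\<lambda>x. 0)"
    unfolding has_initial_value_def using zeroV
    by (intro exI[of _ "\<lambda>t x. 0"]) (simp add: H1_zero zero_diff)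
  obtain I e where I: "finite I" "\<And>i. i \<in> I \<Longrightarrow> e i \<in> tensor_pairs V W"
    "\<And>i j. i \<in> I \<Longrightarrow> j \<in> I \<Longrightarrow> e i j = (if i = j then 1 else 0)"
    "\<And>p. p \<in> tensor_pairs V W \<Longrightarrow> p = (\<lambda>z. \<Sum>i\<in>I. p i * e i z)"
    unfolding V W by (rule tensor_nodal_basis[OF \<Omega> Y \<Gamma> constants(2,5,3) T_pos]) blast
  note ctx = \<Omega> Y \<Gamma> constants(2,5,3) T_pos
  show ?thesis
  proof (intro conjI allI impI)
    have "\<exists>\<rho> \<rho>'. \<rho> \<in> bochner_L2 ?S ?VW ?N \<and> \<rho>' \<in> bochner_L2 ?S ?VW ?N \<and>
      (\<forall>x y. has_weak_partial {0<..<T} 1 (\<lambda>t. \<rho> t x y) (\<lambda>t. \<rho>' t x y)) \<and>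
      (\<forall>t. \<forall>\<psi>\<in>?VW. density_eq \<Omega> Y \<Gamma>R D \<kappa> pF R (\<lambda>x. 0) (\<rho> t) (\<rho>' t) \<psi>) \<and>
      has_initial_value T ?VW ?N \<rho> \<rho>IHh"
      unfolding V W
      by (rule density_problem_exists[where I = I and e = e, OF ctx])
         (fact I[unfolded V W] discrete_density(1)[unfolded V W])+
    then obtain \<rho> \<rho>' where \<rho>: "\<rho> \<in> bochner_L2 ?S ?VW ?N" "\<rho>' \<in> bochner_L2 ?S ?VW ?N"
      "\<forall>x y. has_weak_partial {0<..<T} 1 (\<lambda>t. \<rho> t x y) (\<lambda>t. \<rho>' t x y)"
      "\<forall>t. \<forall>\<psi>\<in>?VW. density_eq \<Omega> Y \<Gamma>R D \<kappa> pF R (\<lambda>x. 0) (\<rho> t) (\<rho>' t) \<psi>"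
      "has_initial_value T ?VW ?N \<rho> \<rho>IHh" by blast
    have "galerkin_solution T \<Omega> Y \<Gamma>R A D \<kappa> pF R f g V W \<pi>IH \<rho>IHh (\<lambda>t x. 0) \<rho>"
      unfolding galerkin_solution_def Let_def \<pi>0
    proof (intro conjI bexI[of _ \<rho>'] ballI AE_I2 \<pi>_bochner \<pi>_init \<rho>)
      fix \<phi> t assume "\<phi> \<in> V"
      then show "pressure_eq \<Omega> A f (g (\<rho> t)) (\<lambda>x. 0) \<phi>" using sub by (intro pressure_eq_zero[OF \<Omega> f_zero]) auto
    qed (use \<rho> in auto)
    then show "\<exists>\<pi> \<rho>. galerkin_solution T \<Omega> Y \<Gamma>R A D \<kappa> pF R f g V W \<pi>IH \<rho>IHh \<pi> \<rho>" by blast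
  next
    obtain J b where J: "finite J" "\<And>j. j \<in> J \<Longrightarrow> b j \<in> V"
      "\<And>v. v \<in> V \<Longrightarrow> v = (\<lambda>x. \<Sum>j\<in>J. v j * b j x)"
      unfolding V by (rule P1_space0_nodal_basis[OF \<Omega>]) blast
    have VWL: "?VW \<subseteq> L2H1 \<Omega> Y"
      using tensor_span_subset_L2H1[OF Y domain(1,3)[OF \<Omega>]] P1_cont[OF \<Omega>] sub unfolding W by blast
    have zero_tensor: "(\<lambda>x y. 0) \<in> ?VW" by (rule tensor_span_zero)
    \<comment> \<open>Every Galerkin solution has zero pressure, and its density solves the decoupled equation.\<close>
    have unique: "\<exists>\<rho>'. (AE t in ?S. \<pi> t = (\<lambda>x. 0)) \<and> (AE t in ?S. \<rho>' t \<in> ?VW) \<and>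
        (\<forall>x y. has_weak_partial {0<..<T} 1 (\<lambda>t. \<rho> t x y) (\<lambda>t. \<rho>' t x y)) \<and>
        (\<forall>\<psi>\<in>?VW. AE t in ?S. density_eq \<Omega> Y \<Gamma>R D \<kappa> pF R (\<lambda>x. 0) (\<rho> t) (\<rho>' t) \<psi>) \<and>
        has_initial_value T ?VW ?N \<rho> \<rho>IHh"
      if sol: "galerkin_solution T \<Omega> Y \<Gamma>R A D \<kappa> pF R f g V W \<pi>IH \<rho>IHh \<pi> \<rho>" for \<pi> \<rho>
    proof -
      from sol obtain \<rho>' where m: "\<pi> \<in> bochner_L2 ?S V (H1_norm \<Omega>)" "\<rho> \<in> bochner_L2 ?S ?VW ?N"
          "\<rho>' \<in> bochner_L2 ?S ?VW ?N"
        and w: "\<forall>x y. has_weak_partial {0<..<T} 1 (\<lambda>t. \<rho> t x y) (\<lambda>t. \<rho>' t x y)"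
        and eq: "\<forall>\<phi>\<in>V. \<forall>\<psi>\<in>?VW. AE t in ?S. pressure_eq \<Omega> A f (g (\<rho> t)) (\<pi> t) \<phi> \<and>
             density_eq \<Omega> Y \<Gamma>R D \<kappa> pF R (\<pi> t) (\<rho> t) (\<rho>' t) \<psi>"
        and i: "has_initial_value T ?VW ?N \<rho> \<rho>IHh"
        unfolding galerkin_solution_def Let_def by blast
      have mem: "AE t in ?S. \<pi> t \<in> V" "AE t in ?S. \<rho> t \<in> ?VW" "AE t in ?S. \<rho>' t \<in> ?VW"
        using m by (simp_all add: bochner_L2_def)
      have "AE t in ?S. \<forall>j\<in>J. pressure_eq \<Omega> A f (g (\<rho> t)) (\<pi> t) (b j)"
      proof (rule AE_finite_allI[OF J(1)])
        fix j assume "j \<in> J"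
        from eq[rule_format, OF J(2)[OF this] zero_tensor]
        show "AE t in ?S. pressure_eq \<Omega> A f (g (\<rho> t)) (\<pi> t) (b j)" by eventually_elim simp
      qed
      with mem(1,2) have \<pi>: "AE t in ?S. \<pi> t = (\<lambda>x. 0)"
      proof eventually_elim
        case (elim t)
        have q: "g (\<rho> t) \<in> borel_measurable (lebesgue_on \<Omega>)"
          using g_linear elim(2) VWL unfolding linear_L2H1_L2_def L2_def by blast
        have "pressure_eq \<Omega> A f (g (\<rho> t)) (\<pi> t) (\<lambda>x. \<Sum>j\<in>J. \<pi> t j * b j x)"
          by (rule pressure_eq_linear_test[OF \<Omega> f_cont fb \<theta>0 q]) (use elim J(2) sub in auto)
        then have "pressure_eq \<Omega> A f (g (\<rho> t)) (\<pi> t) (\<pi> t)" by (simp only: J(3)[OF elim(1), symmetric])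
        then show ?case by (rule p_zero[OF elim(1)])
      qed
      have "AE t in ?S. density_eq \<Omega> Y \<Gamma>R D \<kappa> pF R (\<lambda>x. 0) (\<rho> t) (\<rho>' t) \<psi>" if "\<psi> \<in> ?VW" for \<psi>
        using \<pi> eq[rule_format, OF zeroV that] by eventually_elim simp
      then show ?thesis using \<pi> mem(3) w i by blast
    qed
    fix \<pi>1 \<rho>1 \<pi>2 \<rho>2
    assume "galerkin_solution T \<Omega> Y \<Gamma>R A D \<kappa> pF R f g V W \<pi>IH \<rho>IHh \<pi>1 \<rho>1 \<and>
       galerkin_solution T \<Omega> Y \<Gamma>R A D \<kappa> pF R f g V W \<pi>IH \<rho>IHh \<pi>2 \<rho>2"
    then have s1: "galerkin_solution T \<Omega> Y \<Gamma>R A D \<kappa> pF R f g V W \<pi>IH \<rho>IHh \<pi>1 \<rho>1"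
      and s2: "galerkin_solution T \<Omega> Y \<Gamma>R A D \<kappa> pF R f g V W \<pi>IH \<rho>IHh \<pi>2 \<rho>2" by auto
    obtain \<rho>1' where 1: "AE t in ?S. \<pi>1 t = (\<lambda>x. 0)" "AE t in ?S. \<rho>1' t \<in> ?VW"
      "\<forall>x y. has_weak_partial {0<..<T} 1 (\<lambda>t. \<rho>1 t x y) (\<lambda>t. \<rho>1' t x y)"
      "\<forall>\<psi>\<in>?VW. AE t in ?S. density_eq \<Omega> Y \<Gamma>R D \<kappa> pF R (\<lambda>x. 0) (\<rho>1 t) (\<rho>1' t) \<psi>"
      "has_initial_value T ?VW ?N \<rho>1 \<rho>IHh" using unique[OF s1] by blast
    obtain \<rho>2' where 2: "AE t in ?S. \<pi>2 t = (\<lambda>x. 0)" "AE t in ?S. \<rho>2' t \<in> ?VW"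
      "\<forall>x y. has_weak_partial {0<..<T} 1 (\<lambda>t. \<rho>2 t x y) (\<lambda>t. \<rho>2' t x y)"
      "\<forall>\<psi>\<in>?VW. AE t in ?S. density_eq \<Omega> Y \<Gamma>R D \<kappa> pF R (\<lambda>x. 0) (\<rho>2 t) (\<rho>2' t) \<psi>"
      "has_initial_value T ?VW ?N \<rho>2 \<rho>IHh" using unique[OF s2] by blast
    have "AE t in ?S. \<rho>1 t = \<rho>2 t"
    proof (rule density_problem_unique[where I = I and e = e and \<rho>1' = \<rho>1' and \<rho>2' = \<rho>2' and pF = pF, OF ctx])
      show "finite I" by (fact I(1))
    qed (fact I[unfolded V W] 1(2,5)[unfolded V W] 2(2,5)[unfolded V W]
          1(3,4)[unfolded V W, rule_format] 2(3,4)[unfolded V W, rule_format])+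
    with 1(1) 2(1) show "AE t in ?S. \<pi>1 t = \<pi>2 t \<and> \<rho>1 t = \<rho>2 t" by eventually_elim simp
  qed
qed

end
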